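(* Let $\delta\in\mathbb{C}$. In the cases where $\delta\to0$ (or $\delta\to\infty$), the scattering problem $(\mathrm{SP}_\delta)$ exhibits exactly $2N$ subwavelength resonant frequencies: • a trivial frequency $\omega^*=0$; • the first nontrivial eigenfrequency $\omega_1(\delta)$ is an analytic function of $\delta$ (or $\delta^{-1}$), with leading asymptotic expansion $$\omega_1(\delta)=-2i\,\delta\,\frac{v}{r^2\sum_{j=1}^N\ell_j}+O(\delta^2),\quad\delta\to0,\qquad\text{or}\qquad \omega_1(\delta)=-2i\,\frac1\delta\,\frac{v}{\sum_{j=1}^N\ell_j}+O(\delta^{-2}),\quad\delta\to\infty;$$ • the remaining $2N-2$ frequencies are analytic functions of $\delta^{1/2}$ (or $\delta^{-1/2}$), with leading-order asymptotic expansions, for $2\le i\le N$, $$\omega_i^\pm(\delta)=\pm v\sqrt{\frac{\lambda_i\delta}{r}}-i\,\delta\,\frac{v}{2r^2}\,\frac{a_{i1}^2+a_{iN}^2}{\sum_{j=1}^Na_{ij}^2\ell_j}+O(\delta^{3/2}),\quad\delta\to0,$$ or $$\omega_i^\pm(\delta)=\pm v\sqrt{\frac{\lambda_ir}{\delta}}-i\,\frac1\delta\,\frac v2\,\frac{a_{i1}^2+a_{iN}^2}{\sum_{j=1}^Na_{ij}^2\ell_j}+O(\delta^{-3/2}),\quad\delta\to\infty,$$ where $0=\lambda_1<\lambda_2<\dots<\lambda_N$ are the eigenvalues of the generalized capacitance matrix $\mathcal C$ and $\boldsymbol a_i=(a_{i1},a_{i2},\dots,a_{iN})^\top$ is the eigenvector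 associated with $\lambda_i$.
   Context: Setting. There are $N$ resonators $(x_j^-,x_j^+)\subset\mathbb{R}$, $1\le j\le N$, with $x_j^-<x_j^+<x_{j+1}^-$; $D=\bigcup_{j=1}^N(x_j^-,x_j^+)$, $\ell_j=x_j^+-x_j^-$, $s_j=x_{j+1}^--x_j^+$. $v$ and $v_b$ are the wave speeds outside and inside $D$, $r=v/v_b$ is a fixed positive constant, and $\delta$ is the density ratio. For $\omega\in\mathbb{C}$ put $k=\omega/v$ and $k_b=\omega/v_b=rk$. $w|_\pm(x)=\lim_{s\to0^+}w(x\pm s)$. The scattering problem $(\mathrm{SP}_\delta)$ is: $u''+k^2u=0$ on $\mathbb{R}\setminus D$; $u''+k_b^2u=0$ on $D$; for all $1\le j\le N$: $u|_+(x_j^\pm)=u|_-(x_j^\pm)$, $u'|_+(x_j^-)=\delta\,u'|_-(x_j^-)$, $u'|_-(x_j^+)=\delta\,u'|_+(x_j^+)$; and $\left(\frac{d}{d|x|}-ik\right)u=0$ for $x\in(-\infty,x_1^-)\cup(x_N^+,+\infty)$. $\omega$ is a resonant frequency if this problem has a non-trivial solution $u$. A resonant frequency $\omega(\delta)\in\mathbb{C}$ is called a subwavelength resonant frequency if $\omega(\delta)$ depends continuously on $\delta\in\mathbb{C}$ for sufficiently small (or large) $\delta$ and satisfies $\omega(\delta)\to0$ as $\delta\to0$ (or $\delta\to\infty$). Square root: $\sqrt z$ is defined on $\mathbb{C}\setminus[0,+\infty)$ with the branch $\operatorname{Im}\sqrt z>0$; for $z\in[0,+\infty)$, $\sqrt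 z:=\lim_{\varepsilon\to0^+}\sqrt{z+\varepsilon i}$. Put $(t_1,\dots,t_{2N-1})=(r\ell_1,s_1,r\ell_2,s_2,\dots,s_{N-1},r\ell_N)$ and $\theta_j=\frac1{t_jt_{j+1}}$. The generalized capacitance matrix is the $N\times N$ tridiagonal matrix $$\mathcal C=\begin{pmatrix}\theta_1&-\theta_1\\-\theta_2&\theta_2+\theta_3&-\theta_3\\&-\theta_4&\theta_4+\theta_5&-\theta_5\\&&\ddots&\ddots&\ddots\\&&&-\theta_{2N-4}&\theta_{2N-4}+\theta_{2N-3}&-\theta_{2N-3}\\&&&&-\theta_{2N-2}&\theta_{2N-2}\end{pmatrix}.$$
   Formalization: "Depends continuously on δ∈ℂ" is read relative to the branch of the square root: continuous off [0,∞) and from above on it (in 1/δ for δ→∞), δ=0 excluded; with continuity on a full punctured disc the ±√δ frequencies would not be continuous and the count 2N would fail for N≥2. *)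

theory Defs
  imports
    "HOL-Complex_Analysis.Complex_Analysis"
    "HOL-Library.Landau_Symbols"
    "Jordan_Normal_Form.Char_Poly"
begin

section \<open>The branch of the square root\<close>

text \<open>The library's \<^const>\<open>csqrt\<close> has its cut along the negative reals. The branch used here has
  its cut along the nonnegative reals and values in the upper half plane; on the cut it takes the
  limit from above. The two lemmas below are its defining properties.\<close>

definition usqrt :: "complex \<Rightarrow> complex" where
  "usqrt z = (if Im (csqrt z) < 0 then - csqrt z else csqrt z)"

lemma usqrt_off_cut:
  assumes "z \<notin> \<real>\<^sub>\<ge>\<^sub>0"
  shows "(usqrt z)\<^sup>2 = z \<and> 0 < Im (usqrt z)"
proof -
  have "Im (csqrt z) \<noteq> 0"
  proof
    assume "Im (csqrt z) = 0"
    then have "csqrt z = of_real (Re (csqrt z))" by (simp add: complex_eq_iff)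
    then have "z = of_real ((Re (csqrt z))\<^sup>2)" by (metis of_real_power power2_csqrt)
    then show False using assms by (metis nonneg_Reals_of_real_iff zero_le_power2)
  qed
  then show ?thesis by (auto simp: usqrt_def simp del: csqrt.simps)
qed

lemma usqrt_on_cut:
  assumes "z \<in> \<real>\<^sub>\<ge>\<^sub>0"
  shows "((\<lambda>\<epsilon>::real. usqrt (z + of_real \<epsilon> * \<i>)) \<longlongrightarrow> usqrt z) (at_right 0)"
proof -
  obtain x where x: "z = of_real x" "0 \<le> x" using assms by (auto elim: nonneg_Reals_cases)
  have z: "usqrt z = csqrt z" using x by (simp add: usqrt_def)
  have upper: "0 \<le> Im (csqrt w)" if "0 < Im w" for w
    using that complex_Re_le_cmod[of w] by auto
  have "((\<lambda>\<epsilon>::real. csqrt (z + of_real \<epsilon> * \<i>)) \<longlongrightarrow> csqrt z) (at_right 0)"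
  proof (cases "x = 0")
    case True
    have "((\<lambda>\<epsilon>::real. sqrt \<bar>\<epsilon>\<bar>) \<longlongrightarrow> sqrt \<bar>0\<bar>) (at_right 0)"
      by (intro tendsto_intros)
    then have "((\<lambda>\<epsilon>::real. norm (csqrt (of_real \<epsilon> * \<i>))) \<longlongrightarrow> 0) (at_right 0)"
      by (simp add: norm_mult)
    then have "((\<lambda>\<epsilon>::real. csqrt (of_real \<epsilon> * \<i>)) \<longlongrightarrow> 0) (at_right 0)"
      by (rule tendsto_norm_zero_cancel)
    then show ?thesis using True x by simp
  next
    case False
    then have "isCont csqrt z" using x by (intro continuous_at_csqrt) auto
    moreover have "((\<lambda>\<epsilon>::real. z + of_real \<epsilon> * \<i>) \<longlongrightarrow> z + of_real 0 * \<i>) (at_right 0)"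
      by (intro tendsto_intros)
    ultimately show ?thesis by (intro isCont_tendsto_compose[of z csqrt]) simp_all
  qed
  moreover have "\<forall>\<^sub>F \<epsilon>::real in at_right 0.
      csqrt (z + of_real \<epsilon> * \<i>) = usqrt (z + of_real \<epsilon> * \<i>)"
    unfolding eventually_at_right_field
  proof (intro exI[of _ 1] conjI allI impI)
    fix \<epsilon> :: real assume "0 < \<epsilon>"
    then have "0 \<le> Im (csqrt (z + of_real \<epsilon> * \<i>))" using x by (intro upper) simp
    then show "csqrt (z + of_real \<epsilon> * \<i>) = usqrt (z + of_real \<epsilon> * \<i>)"
      unfolding usqrt_def by simp
  qed simp
  ultimately show ?thesis unfolding z by (rule Lim_transform_eventually)
qed

section \<open>The scattering problem\<close>

text \<open>The resonators are the intervals from \<open>xm j\<close> to \<open>xp j\<close> for \<open>1 \<le> j \<le> N\<close>; values of \<open>xm\<close> and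
  \<open>xp\<close> at other indices are irrelevant.\<close>

definition resonator_chain :: "nat \<Rightarrow> (nat \<Rightarrow> real) \<Rightarrow> (nat \<Rightarrow> real) \<Rightarrow> bool" where
  "resonator_chain N xm xp \<longleftrightarrow>
     (\<forall>j\<in>{1..N}. xm j < xp j) \<and> (\<forall>j\<in>{1..<N}. xp j < xm (j + 1))"

definition resonators :: "nat \<Rightarrow> (nat \<Rightarrow> real) \<Rightarrow> (nat \<Rightarrow> real) \<Rightarrow> real set" where
  "resonators N xm xp = (\<Union>j\<in>{1..N}. {xm j<..<xp j})"

definition res_length :: "(nat \<Rightarrow> real) \<Rightarrow> (nat \<Rightarrow> real) \<Rightarrow> nat \<Rightarrow> real" where
  "res_length xm xp j = xp j - xm j"

definition res_gap :: "(nat \<Rightarrow> real) \<Rightarrow> (nat \<Rightarrow> real) \<Rightarrow> nat \<Rightarrow> real" where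
  "res_gap xm xp j = xm (j + 1) - xp j"

definition helmholtz_on :: "complex \<Rightarrow> real set \<Rightarrow> (real \<Rightarrow> complex) \<Rightarrow> bool" where
  "helmholtz_on \<kappa> S u \<longleftrightarrow>
     (\<forall>x\<in>S. u differentiable (at x) \<and>
        ((\<lambda>y. vector_derivative u (at y)) has_vector_derivative - (\<kappa>\<^sup>2 * u x)) (at x))"

text \<open>The derivative of \<open>u\<close> jumps at the end points of the resonators, which belong to the
  complement of \<open>D\<close>. The equation outside \<open>D\<close> is therefore imposed on the interior of the
  complement, and the end points are governed by the transmission conditions. There the
  condition that both one-sided limits of \<open>u\<close> agree is read as continuity of \<open>u\<close>: otherwise the
  value of \<open>u\<close> at these finitely many points would be unconstrained, and non-triviality of \<open>u\<close>
  would say nothing. The radial derivative in the radiation condition is the derivative in the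
  outward direction, so the sign is negative to the left of all resonators and positive to the
  right of them, wherever the origin lies.\<close>

definition scattering_solution ::
  "nat \<Rightarrow> (nat \<Rightarrow> real) \<Rightarrow> (nat \<Rightarrow> real) \<Rightarrow> real \<Rightarrow> real \<Rightarrow> complex \<Rightarrow> complex \<Rightarrow> (real \<Rightarrow> complex) \<Rightarrow> bool"
where
  "scattering_solution N xm xp v vb \<delta> \<omega> u \<longleftrightarrow>
     (let k = \<omega> / of_real v; kb = \<omega> / of_real vb; D = resonators N xm xp;
          u' = (\<lambda>x. vector_derivative u (at x))
      in helmholtz_on k (interior (- D)) u \<and>
         helmholtz_on kb D u \<and>
         (\<forall>j\<in>{1..N}.
            isCont u (xm j) \<and> isCont u (xp j) \<and>
            (\<exists>p q. (u' \<longlongrightarrow> p) (at_right (xm j)) \<and> (u' \<longlongrightarrow> q) (at_left (xm j)) \<and> p = \<delta> * q) \<and>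
            (\<exists>p q. (u' \<longlongrightarrow> p) (at_left (xp j)) \<and> (u' \<longlongrightarrow> q) (at_right (xp j)) \<and> p = \<delta> * q)) \<and>
         (\<forall>x<xm 1. - u' x - \<i> * k * u x = 0) \<and>
         (\<forall>x>xp N. u' x - \<i> * k * u x = 0))"

definition resonant_frequency ::
  "nat \<Rightarrow> (nat \<Rightarrow> real) \<Rightarrow> (nat \<Rightarrow> real) \<Rightarrow> real \<Rightarrow> real \<Rightarrow> complex \<Rightarrow> complex \<Rightarrow> bool"
where
  "resonant_frequency N xm xp v vb \<delta> \<omega> \<longleftrightarrow>
     (\<exists>u. scattering_solution N xm xp v vb \<delta> \<omega> u \<and> (\<exists>x. u x \<noteq> 0))"

section \<open>Subwavelength resonant frequencies\<close>

text \<open>No branch of the square root is continuous on a full punctured disc, so continuous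
  dependence on complex \<open>\<delta>\<close> is understood relative to the branch \<^const>\<open>usqrt\<close>: continuity off the
  nonnegative real axis, and continuity from above on that axis. Equivalently,
  \<open>f (t * cis \<phi>)\<close> is continuous in \<open>t > 0\<close> and \<open>0 \<le> \<phi> < 2 * pi\<close>. Functions that are
  continuous on all of \<open>U\<close> are included.\<close>

definition branch_continuous_on :: "complex set \<Rightarrow> (complex \<Rightarrow> complex) \<Rightarrow> bool" where
  "branch_continuous_on U f \<longleftrightarrow>
     continuous_on (U - \<real>\<^sub>\<ge>\<^sub>0) f \<and> continuous_on {z \<in> U. 0 \<le> Im z} f"

definition subwavelength_at_0 ::
  "nat \<Rightarrow> (nat \<Rightarrow> real) \<Rightarrow> (nat \<Rightarrow> real) \<Rightarrow> real \<Rightarrow> real \<Rightarrow> (complex \<Rightarrow> complex) \<Rightarrow> bool"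
where
  "subwavelength_at_0 N xm xp v vb \<omega> \<longleftrightarrow>
     (\<exists>\<epsilon>>0. (\<forall>\<delta>\<in>ball 0 \<epsilon> - {0}. resonant_frequency N xm xp v vb \<delta> (\<omega> \<delta>)) \<and>
            branch_continuous_on (ball 0 \<epsilon> - {0}) \<omega>) \<and>
     (\<omega> \<longlongrightarrow> 0) (at 0)"

text \<open>For large \<open>\<delta>\<close> the branch is taken in the variable \<open>1 / \<delta>\<close>, in accordance with \<open>\<delta>\<close>
  occurring as \<open>usqrt (c / \<delta>)\<close>.\<close>

definition subwavelength_at_infinity ::
  "nat \<Rightarrow> (nat \<Rightarrow> real) \<Rightarrow> (nat \<Rightarrow> real) \<Rightarrow> real \<Rightarrow> real \<Rightarrow> (complex \<Rightarrow> complex) \<Rightarrow> bool"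
where
  "subwavelength_at_infinity N xm xp v vb \<omega> \<longleftrightarrow>
     (\<exists>\<epsilon>>0. (\<forall>\<delta>. 1 / \<epsilon> < norm \<delta> \<longrightarrow> resonant_frequency N xm xp v vb \<delta> (\<omega> \<delta>)) \<and>
            branch_continuous_on (ball 0 \<epsilon> - {0}) (\<lambda>\<eta>. \<omega> (1 / \<eta>))) \<and>
     (\<omega> \<longlongrightarrow> 0) at_infinity"

text \<open>Frequencies are functions of \<open>\<delta>\<close> near the limit point, so they are counted up to
  eventual equality along the filter \<open>F\<close>: the set \<open>S\<close> has \<open>n\<close> elements, which all have the property
  \<open>P\<close> and eventually take pairwise different values, and every function with the property \<open>P\<close>
  eventually agrees with one of them.\<close>

definition exactly_frequencies ::
  "complex filter \<Rightarrow> ((complex \<Rightarrow> complex) \<Rightarrow> bool) \<Rightarrow> (complex \<Rightarrow> complex) set \<Rightarrow> nat \<Rightarrow> bool"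
where
  "exactly_frequencies F P S n \<longleftrightarrow>
     finite S \<and> card S = n \<and> (\<forall>\<omega>\<in>S. P \<omega>) \<and>
     (\<forall>\<omega>\<in>S. \<forall>\<omega>'\<in>S. \<omega> \<noteq> \<omega>' \<longrightarrow> (\<forall>\<^sub>F \<delta> in F. \<omega> \<delta> \<noteq> \<omega>' \<delta>)) \<and>
     (\<forall>\<omega>. P \<omega> \<longrightarrow> (\<exists>\<omega>'\<in>S. \<forall>\<^sub>F \<delta> in F. \<omega> \<delta> = \<omega>' \<delta>))"

text \<open>\<open>\<omega>\<close> is, near the limit point described by \<open>F\<close>, an analytic function of the quantity \<open>\<phi> \<delta>\<close>,
  where \<open>\<phi>\<close> tends to 0 along \<open>F\<close>.\<close>

definition analytic_function_of ::
  "complex filter \<Rightarrow> (complex \<Rightarrow> complex) \<Rightarrow> (complex \<Rightarrow> complex) \<Rightarrow> bool"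
where
  "analytic_function_of F \<phi> \<omega> \<longleftrightarrow>
     (\<exists>g. g analytic_on {0} \<and> (\<forall>\<^sub>F \<delta> in F. \<omega> \<delta> = g (\<phi> \<delta>)))"

section \<open>The generalized capacitance matrix\<close>

definition cap_t :: "(nat \<Rightarrow> real) \<Rightarrow> (nat \<Rightarrow> real) \<Rightarrow> real \<Rightarrow> nat \<Rightarrow> real" where
  "cap_t xm xp r m =
     (if odd m then r * res_length xm xp ((m + 1) div 2) else res_gap xm xp (m div 2))"

definition cap_theta :: "(nat \<Rightarrow> real) \<Rightarrow> (nat \<Rightarrow> real) \<Rightarrow> real \<Rightarrow> nat \<Rightarrow> real" where
  "cap_theta xm xp r m = 1 / (cap_t xm xp r m * cap_t xm xp r (m + 1))"

text \<open>Matrix entries are indexed from 0, the resonators from 1, hence the shift by one. For a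
  single resonator the matrix is the \<open>1 \<times> 1\<close> zero matrix.\<close>

definition capacitance_matrix :: "nat \<Rightarrow> (nat \<Rightarrow> real) \<Rightarrow> (nat \<Rightarrow> real) \<Rightarrow> real \<Rightarrow> real mat" where
  "capacitance_matrix N xm xp r = mat N N (\<lambda>(i', j').
     let i = i' + 1; j = j' + 1; \<theta> = cap_theta xm xp r in
     if j = i then (if i = 1 then 0 else \<theta> (2 * i - 2)) + (if i = N then 0 else \<theta> (2 * i - 1))
     else if j = i + 1 then - \<theta> (2 * i - 1)
     else if i = j + 1 then - \<theta> (2 * i - 2)
     else 0)"

text \<open>\<open>(a\<^sub>1\<^sup>2 + a\<^sub>N\<^sup>2) / (\<Sum>j. a\<^sub>j\<^sup>2 \<ell>\<^sub>j)\<close> for a vector \<open>a\<close>.\<close>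

definition damping_ratio :: "nat \<Rightarrow> (nat \<Rightarrow> real) \<Rightarrow> (nat \<Rightarrow> real) \<Rightarrow> real vec \<Rightarrow> real" where
  "damping_ratio N xm xp a =
     ((vec_index a 0)\<^sup>2 + (vec_index a (N - 1))\<^sup>2) /
     (\<Sum>j=1..N. (vec_index a (j - 1))\<^sup>2 * res_length xm xp j)"

end

theory Submission
  imports Defs
begin

text \<open>
The scattering problem is reduced to an algebraic equation in two variables, whose zeros are
followed from the limit of vanishing contrast by an analytic implicit function theorem.

\<^bold>\<open>Propagation.\<close> Let \<open>y\<close> be the exterior derivative of \<open>u\<close>, that is \<open>u'\<close> outside and \<open>u' / \<delta>\<close>
inside the resonators. Then \<open>(u, y)\<close> is continuous at the end points and is propagated from the
outgoing data \<open>(1, - \<i> k)\<close> at the left end by one matrix for each resonator and each gap. A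
resonance occurs if and only if the result satisfies the radiation condition \<open>y = \<i> k u\<close> at the
right end (\<open>resonant_iff_outgoing\<close>).

\<^bold>\<open>Duality.\<close> The pair \<open>(y, - k\<^sup>2 u)\<close> solves the same problem with \<open>\<delta>\<close> replaced by \<open>r\<^sup>2 / \<delta>\<close>
(\<open>wave_duality\<close>). So \<open>\<delta>\<close> and \<open>r\<^sup>2 / \<delta>\<close> have the same resonances, and the case \<open>\<delta> \<rightarrow> \<infinity>\<close> is the case
\<open>\<delta> \<rightarrow> 0\<close> after this substitution.

\<^bold>\<open>Scaling.\<close> With \<open>\<delta> = z\<^sup>2\<close>, \<open>k = z \<mu>\<close> and \<open>y = \<mu> x\<close> all coefficients become entire in \<open>(\<mu>, z)\<close>,
and the resonance condition becomes \<open>\<mu> = 0\<close>, the trivial frequency, or \<open>dispersion \<mu> z = 0\<close>. For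
\<open>z = 0\<close> the function \<open>dispersion\<close> is a polynomial in \<open>\<mu>\<close> of degree \<open>2 N - 1\<close>. Its recursion is the
eigenvalue equation of the capacitance matrix with \<open>\<lambda> = r \<mu>\<^sup>2\<close> (\<open>eigenvalues_roots\<close>). Its zeros
are real by an energy identity (\<open>roots_real\<close>) and simple by a Wronskian identity
(\<open>root_wronskian\<close>), so there are \<open>2 N - 1\<close> of them (\<open>card_roots0\<close>): 0 and \<open>N - 1\<close> pairs \<open>\<plusminus> \<rho>\<close>.
This is also why the eigenvalues are real, distinct and nonnegative.

\<^bold>\<open>Branches.\<close> Each zero \<open>\<rho>\<close> continues to an analytic branch \<open>g z\<close> (\<open>analytic_implicit_function\<close>),
which yields the frequency \<open>v z g z\<close> with \<open>z\<close> the square root of \<open>\<delta>\<close>. Its expansion is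
\<open>v \<rho> z + v g' 0 z\<^sup>2 + O(z\<^sup>3)\<close>, and the derivative \<open>g' 0\<close> follows from the Wronskian and from a
Casoratian for the dependence on \<open>z\<close> (\<open>dispersion_partials\<close>); expressed by eigenvectors it is the
damping term (\<open>slope_damping\<close>). The branch at 0 is odd, so its frequency is even in \<open>z\<close> and
analytic in \<open>\<delta>\<close>.

\<^bold>\<open>Completeness.\<close> Resonances with small \<open>k\<close> have bounded \<open>\<mu>\<close> (\<open>dominance\<close>), and in a bounded region
a compactness argument leaves only the branches (\<open>dispersion_branches\<close>). A continuous frequency is
therefore a continuous choice among finitely many functions with distinct values. As \<open>z \<mapsto> z\<^sup>2\<close>
maps a convex half disc onto the punctured disc and turns branch continuity into continuity, the
choice is constant (\<open>connected_choice\<close>).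
\<close>

section \<open>Solutions of the Helmholtz equation on an interval\<close>

definition csinc :: "complex \<Rightarrow> complex" where
  "csinc z = (if z = 0 then 1 else sin z / z)"

lemma csinc_0 [simp]: "csinc 0 = 1"
  by (simp add: csinc_def)

lemma csinc_minus [simp]: "csinc (- z) = csinc z"
  by (simp add: csinc_def)

lemma mult_csinc: "z * csinc z = sin z"
  by (simp add: csinc_def)

text \<open>Away from 0 it is a quotient of entire functions, and the singularity at 0 is removable
  because \<open>sin z / z\<close> tends to \<open>cos 0 = 1\<close>.\<close>

lemma csinc_holomorphic: "csinc holomorphic_on UNIV"
proof (rule no_isolated_singularity[where K = "{0}"])
  have "((\<lambda>z. (sin (0 + z) - sin 0) / z) \<longlongrightarrow> cos (0::complex)) (at 0)"
    using DERIV_sin[of "0::complex"] by (simp add: DERIV_def)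
  then have "((\<lambda>z::complex. sin z / z) \<longlongrightarrow> 1) (at 0)" by simp
  then have "(csinc \<longlongrightarrow> 1) (at 0)"
    by (rule Lim_transform_eventually) (auto simp: csinc_def eventually_at_filter)
  then have at0: "isCont csinc 0" by (simp add: isCont_def)
  have hol: "csinc holomorphic_on UNIV - {0}"
  proof (rule holomorphic_transform)
    show "(\<lambda>z. sin z / z) holomorphic_on UNIV - {0::complex}"
      by (intro holomorphic_intros) auto
  qed (auto simp: csinc_def)
  then have "continuous_on (UNIV - {0}) csinc" by (rule holomorphic_on_imp_continuous_on)
  then have "isCont csinc z" if "z \<noteq> 0" for z
    using that by (simp add: continuous_on_eq_continuous_at open_delete)
  with at0 show "continuous_on UNIV csinc"
    by (metis continuous_at_imp_continuous_on)
  from hol show "csinc holomorphic_on UNIV - {0}" .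
qed auto

lemma csinc_has_deriv: "(csinc has_field_derivative deriv csinc z) (at z)"
  using csinc_holomorphic by (auto intro: holomorphic_derivI)

lemma isCont_csinc: "isCont csinc z"
  using csinc_has_deriv DERIV_isCont by blast

text \<open>\<open>sin (\<kappa> t) / \<kappa>\<close>, extended to \<open>\<kappa> = 0\<close> by continuity.\<close>

definition sn :: "complex \<Rightarrow> real \<Rightarrow> complex" where
  "sn \<kappa> t = of_real t * csinc (\<kappa> * of_real t)"

lemma mult_sn: "\<kappa> * sn \<kappa> t = sin (\<kappa> * of_real t)"
  using mult_csinc[of "\<kappa> * of_real t"] by (simp add: sn_def mult_ac)

lemma cos_sn_unit: "(cos (\<kappa> * of_real t))\<^sup>2 + \<kappa>\<^sup>2 * (sn \<kappa> t)\<^sup>2 = 1"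
  using sin_cos_squared_add2[of "\<kappa> * of_real t"]
  by (simp add: mult_sn[symmetric] power_mult_distrib add.commute)

lemma sn_0 [simp]: "sn \<kappa> 0 = 0"
  by (simp add: sn_def)

lemma sn_deriv: "(sn \<kappa> has_vector_derivative cos (\<kappa> * of_real t)) (at t)"
proof (cases "\<kappa> = 0")
  case True
  have "(of_real has_vector_derivative (1::complex)) (at t)"
    using has_vector_derivative_of_real[of "\<lambda>x. x" 1 "at t"] by simp
  then show ?thesis using True by (simp add: sn_def[abs_def])
next
  case False
  have eq: "sn \<kappa> = (\<lambda>t. sin (\<kappa> * of_real t) / \<kappa>)"
    using False mult_sn[of \<kappa>] by (auto simp: field_simps)
  have "((\<lambda>w. sin (\<kappa> * w) / \<kappa>) has_field_derivative cos (\<kappa> * of_real t)) (at (of_real t))"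
    using False by (auto intro!: derivative_eq_intros)
  then show ?thesis unfolding eq by (rule has_vector_derivative_real_field)
qed

lemma cos_deriv:
  "((\<lambda>t. cos (\<kappa> * of_real t)) has_vector_derivative - \<kappa>\<^sup>2 * sn \<kappa> t) (at t)"
proof -
  have "((\<lambda>w. cos (\<kappa> * w)) has_field_derivative - sin (\<kappa> * of_real t) * \<kappa>) (at (of_real t))"
    by (auto intro!: derivative_eq_intros)
  then have "((\<lambda>t. cos (\<kappa> * of_real t)) has_vector_derivative - sin (\<kappa> * of_real t) * \<kappa>) (at t)"
    by (rule has_vector_derivative_real_field)
  then show ?thesis by (simp add: mult_sn[symmetric] power2_eq_square mult_ac)
qed

text \<open>Cauchy data \<open>(a, d)\<close> at the point \<open>x0\<close>.\<close>

definition seg :: "complex \<Rightarrow> real \<Rightarrow> complex \<Rightarrow> complex \<Rightarrow> real \<Rightarrow> complex" where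
  "seg \<kappa> x0 a d x = cos (\<kappa> * of_real (x - x0)) * a + sn \<kappa> (x - x0) * d"

definition seg' :: "complex \<Rightarrow> real \<Rightarrow> complex \<Rightarrow> complex \<Rightarrow> real \<Rightarrow> complex" where
  "seg' \<kappa> x0 a d x = - \<kappa>\<^sup>2 * sn \<kappa> (x - x0) * a + cos (\<kappa> * of_real (x - x0)) * d"

lemma shifted_derivs:
  "((\<lambda>x. cos (\<kappa> * of_real (x - x0))) has_vector_derivative - \<kappa>\<^sup>2 * sn \<kappa> (x - x0)) (at x)"
  "((\<lambda>x. sn \<kappa> (x - x0)) has_vector_derivative cos (\<kappa> * of_real (x - x0))) (at x)"
proof -
  have sh: "((\<lambda>x. x - x0) has_vector_derivative 1) (at x)"
    by (auto intro!: derivative_eq_intros)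
  show "((\<lambda>x. cos (\<kappa> * of_real (x - x0))) has_vector_derivative - \<kappa>\<^sup>2 * sn \<kappa> (x - x0)) (at x)"
    using vector_diff_chain_at[OF sh cos_deriv[of \<kappa> "x - x0"]] by (simp add: o_def)
  show "((\<lambda>x. sn \<kappa> (x - x0)) has_vector_derivative cos (\<kappa> * of_real (x - x0))) (at x)"
    using vector_diff_chain_at[OF sh sn_deriv[of \<kappa> "x - x0"]] by (simp add: o_def)
qed

lemma seg_deriv: "(seg \<kappa> x0 a d has_vector_derivative seg' \<kappa> x0 a d x) (at x)"
  unfolding seg_def[abs_def] seg'_def
  by (intro has_vector_derivative_add has_vector_derivative_mult_left shifted_derivs)

lemma seg'_deriv: "(seg' \<kappa> x0 a d has_vector_derivative - (\<kappa>\<^sup>2 * seg \<kappa> x0 a d x)) (at x)"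
proof -
  have "(seg' \<kappa> x0 a d has_vector_derivative
      - \<kappa>\<^sup>2 * cos (\<kappa> * of_real (x - x0)) * a + - \<kappa>\<^sup>2 * sn \<kappa> (x - x0) * d) (at x)"
    unfolding seg'_def[abs_def]
    by (intro has_vector_derivative_add has_vector_derivative_mult_left
        has_vector_derivative_mult_right shifted_derivs)
  then show ?thesis by (simp add: seg_def algebra_simps)
qed

lemma seg_start [simp]: "seg \<kappa> x0 a d x0 = a" "seg' \<kappa> x0 a d x0 = d"
  by (simp_all add: seg_def seg'_def)

lemma isCont_seg: "isCont (seg \<kappa> x0 a d) x" "isCont (seg' \<kappa> x0 a d) x"
  using seg_deriv seg'_deriv has_vector_derivative_continuous by blast+

lemma helmholtz_on_agree:
  assumes "open S" and eq: "\<And>x. x \<in> S \<Longrightarrow> u x = f x"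
    and f: "\<And>x. (f has_vector_derivative f' x) (at x)"
    and f': "\<And>x. (f' has_vector_derivative - (\<kappa>\<^sup>2 * f x)) (at x)"
  shows "helmholtz_on \<kappa> S u" and "\<And>x. x \<in> S \<Longrightarrow> vector_derivative u (at x) = f' x"
proof -
  have u: "(u has_vector_derivative f' x) (at x)" if "x \<in> S" for x
    using has_vector_derivative_transform_within_open[OF f \<open>open S\<close> that] eq by metis
  show vd: "vector_derivative u (at x) = f' x" if "x \<in> S" for x
    using u[OF that] by (rule vector_derivative_at)
  have "((\<lambda>y. vector_derivative u (at y)) has_vector_derivative - (\<kappa>\<^sup>2 * u x)) (at x)" if "x \<in> S"
      for x
    using has_vector_derivative_transform_within_open[OF f' \<open>open S\<close> that] vd eq that by metis
  then show "helmholtz_on \<kappa> S u"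
    using u unfolding helmholtz_on_def by (metis differentiableI_vector)
qed

lemma helmholtz_deriv:
  assumes "helmholtz_on \<kappa> S u" "x \<in> S"
  shows "(u has_vector_derivative vector_derivative u (at x)) (at x)"
  using assms by (simp add: helmholtz_on_def vector_derivative_works)

text \<open>The combinations \<open>u c - u' s\<close> and \<open>\<kappa>\<^sup>2 u s + u' c\<close> of the solution with \<open>c = cos \<kappa>(x - a)\<close>
  and \<open>s = sin \<kappa>(x - a) / \<kappa>\<close> are first integrals, whose values are the Cauchy data at \<open>a\<close>. Solving
  for \<open>u\<close> and \<open>u'\<close> uses that the determinant of this linear system is \<open>c\<^sup>2 + \<kappa>\<^sup>2 s\<^sup>2 = 1\<close>.\<close>

lemma helmholtz_interval:
  assumes h: "helmholtz_on \<kappa> {a<..<b} u"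
    and ua: "(u \<longlongrightarrow> A) (at_right a)"
    and da: "((\<lambda>x. vector_derivative u (at x)) \<longlongrightarrow> B) (at_right a)"
    and x: "x \<in> {a<..<b}"
  shows "u x = seg \<kappa> a A B x" and "vector_derivative u (at x) = seg' \<kappa> a A B x"
proof -
  let ?d = "\<lambda>x. vector_derivative u (at x)"
  let ?c = "\<lambda>x. cos (\<kappa> * of_real (x - a))" and ?s = "\<lambda>x. sn \<kappa> (x - a)"
  have du: "(u has_vector_derivative ?d y) (at y)"
       "(?d has_vector_derivative - (\<kappa>\<^sup>2 * u y)) (at y)" if "y \<in> {a<..<b}" for y
    using h helmholtz_deriv that by (auto simp: helmholtz_on_def)
  let ?E = "\<lambda>y. u y * ?c y - ?d y * ?s y" and ?G = "\<lambda>y. \<kappa>\<^sup>2 * u y * ?s y + ?d y * ?c y"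
  have const: "\<exists>c. \<forall>y\<in>{a<..<b}. f y = c"
    if "\<And>y. y \<in> {a<..<b} \<Longrightarrow> (f has_vector_derivative 0) (at y)" for f :: "real \<Rightarrow> complex"
    using has_vector_derivative_zero_constant[of "{a<..<b}"
        f] has_vector_derivative_at_within[OF that]
    by (metis convex_real_interval(8))
  have "(?E has_vector_derivative 0) (at y)" if "y \<in> {a<..<b}" for y
    by (rule has_vector_derivative_eq_rhs[OF has_vector_derivative_diff[OF
        has_vector_derivative_mult[OF du(1)[OF that] shifted_derivs(1)[of \<kappa> a]]
        has_vector_derivative_mult[OF du(2)[OF that] shifted_derivs(2)[of \<kappa> a]]]])
      (simp add: algebra_simps)
  then obtain e where e: "\<And>y. y \<in> {a<..<b} \<Longrightarrow> ?E y = e" using const[of ?E] by auto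
  have "(?G has_vector_derivative 0) (at y)" if "y \<in> {a<..<b}" for y
    by (rule has_vector_derivative_eq_rhs[OF has_vector_derivative_add[OF
        has_vector_derivative_mult[OF has_vector_derivative_mult_right[OF du(1)[OF that], of "\<kappa>\<^sup>2"]
          shifted_derivs(2)[of \<kappa> a]]
        has_vector_derivative_mult[OF du(2)[OF that] shifted_derivs(1)[of \<kappa> a]]]])
      (simp add: algebra_simps)
  then obtain g where g: "\<And>y. y \<in> {a<..<b} \<Longrightarrow> ?G y = g" using const[of ?G] by auto
  have ab: "a < b" using x by auto
  have ev: "\<forall>\<^sub>F y in at_right a. y \<in> {a<..<b}"
    using ab by (auto simp: eventually_at_right_field)
  have cs: "(?c \<longlongrightarrow> ?c a) (at_right a)" "(?s \<longlongrightarrow> ?s a) (at_right a)"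
    using shifted_derivs[of \<kappa> a a, THEN has_vector_derivative_continuous]
    unfolding continuous_at by (metis filterlim_at_split)+
  have "(?E \<longlongrightarrow> A * ?c a - B * ?s a) (at_right a)"
    by (intro tendsto_intros ua da cs)
  moreover have "(?E \<longlongrightarrow> e) (at_right a)"
    by (rule tendsto_eventually) (use ev e in \<open>auto elim: eventually_mono\<close>)
  ultimately have eA: "e = A" using tendsto_unique trivial_limit_at_right_real
    by (metis (no_types, lifting) cancel_comm_monoid_add_class.diff_cancel cos_zero diff_zero
        mult.right_neutral mult_zero_right of_real_0 sn_0)
  have "(?G \<longlongrightarrow> \<kappa>\<^sup>2 * A * ?s a + B * ?c a) (at_right a)"
    by (intro tendsto_intros ua da cs)
  moreover have "(?G \<longlongrightarrow> g) (at_right a)"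
    by (rule tendsto_eventually) (use ev g in \<open>auto elim: eventually_mono\<close>)
  ultimately have gB: "g = B" using tendsto_unique trivial_limit_at_right_real
    by (metis (no_types, lifting) cancel_comm_monoid_add_class.diff_cancel cos_zero add_0
        mult.right_neutral mult_zero_right of_real_0 sn_0)
  have E: "u x * ?c x - ?d x * ?s x = A" and G: "\<kappa>\<^sup>2 * u x * ?s x + ?d x * ?c x = B"
    using e[OF x] g[OF x] eA gB by simp_all
  have unit: "(?c x)\<^sup>2 + \<kappa>\<^sup>2 * (?s x)\<^sup>2 = 1" by (rule cos_sn_unit)
  have "seg \<kappa> a A B x = u x * ((?c x)\<^sup>2 + \<kappa>\<^sup>2 * (?s x)\<^sup>2)"
    unfolding seg_def E[symmetric] G[symmetric] by (simp add: algebra_simps power2_eq_square)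
  then show "u x = seg \<kappa> a A B x" using unit by simp
  have "seg' \<kappa> a A B x = ?d x * ((?c x)\<^sup>2 + \<kappa>\<^sup>2 * (?s x)\<^sup>2)"
    unfolding seg'_def E[symmetric] G[symmetric] by (simp add: algebra_simps power2_eq_square)
  then show "?d x = seg' \<kappa> a A B x" using unit by simp
qed

text \<open>The outer half lines carry the first order equation \<open>u' = c u\<close>, so that \<open>u exp (- c x)\<close> is
  constant. The filter is the one-sided neighbourhood of the end point of the half line.\<close>

lemma first_order_zero:
  fixes u :: "real \<Rightarrow> complex"
  assumes "convex S" and d: "\<And>x. x \<in> S \<Longrightarrow> (u has_vector_derivative c * u x) (at x)"
    and F: "F \<noteq> bot" "(u \<longlongrightarrow> 0) F" "F \<le> at a" "\<forall>\<^sub>F x in F. x \<in> S" and x: "x \<in> S"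
  shows "u x = 0"
proof -
  let ?e = "\<lambda>x::real. exp (- c * of_real x)"
  have ed: "(?e has_vector_derivative - c * ?e y) (at y)" for y
  proof -
    have "((\<lambda>w. exp (- c * w)) has_field_derivative - c * ?e y) (at (of_real y))"
      by (auto intro!: derivative_eq_intros)
    then show ?thesis by (rule has_vector_derivative_real_field)
  qed
  have "((\<lambda>y. u y * ?e y) has_vector_derivative 0) (at y within S)" if "y \<in> S" for y
    by (rule has_vector_derivative_at_within, rule has_vector_derivative_eq_rhs[OF
        has_vector_derivative_mult[OF d[OF that] ed]]) simp
  then obtain k where k: "\<And>y. y \<in> S \<Longrightarrow> u y * ?e y = k"
    using has_vector_derivative_zero_constant[OF \<open>convex S\<close>, of "\<lambda>y. u y * ?e y"] by auto
  have "(?e \<longlongrightarrow> ?e a) F"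
    using has_vector_derivative_continuous[OF ed, of a] F(3) unfolding continuous_at
    by (rule tendsto_mono[rotated])
  then have "((\<lambda>y. u y * ?e y) \<longlongrightarrow> 0 * ?e a) F"
    by (intro tendsto_mult F)
  moreover have "((\<lambda>y. u y * ?e y) \<longlongrightarrow> k) F"
    by (rule tendsto_eventually) (use F(4) k in \<open>auto elim: eventually_mono\<close>)
  ultimately have "k = 0" using F(1) tendsto_unique by fastforce
  then show ?thesis using k[OF x] by simp
qed

section \<open>Propagation through the chain\<close>

definition wave_number :: "real \<Rightarrow> complex \<Rightarrow> nat \<Rightarrow> complex" where
  "wave_number r k m = (if even m then of_real r * k else k)"

definition contrast :: "complex \<Rightarrow> nat \<Rightarrow> complex" where
  "contrast \<delta> m = (if even m then \<delta> else 1)"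

text \<open>For the wave number \<open>k\<close> outside the resonators and lengths \<open>\<tau> m\<close> of consecutive pieces, of
  which those with even index are resonators: the amplitude \<open>u\<close> and the exterior derivative \<open>y\<close> at
  the successive breakpoints. Inside a resonator \<open>y\<close> is \<open>u' / \<delta>\<close>, which makes \<open>y\<close> continuous at
  the breakpoints. The initial value is that of the outgoing wave to the left of the chain.\<close>

primrec wave :: "real \<Rightarrow> (nat \<Rightarrow> real) \<Rightarrow> complex \<Rightarrow> complex \<Rightarrow> nat \<Rightarrow> complex \<times> complex" where
  "wave r \<tau> \<delta> k 0 = (1, - \<i> * k)"
| "wave r \<tau> \<delta> k (Suc m) =
    (let u = fst (wave r \<tau> \<delta> k m); y = snd (wave r \<tau> \<delta> k m); \<kappa> = wave_number r k m; b =
        contrast \<delta> m in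
     (cos (\<kappa> * of_real (\<tau> m)) * u + b * sn \<kappa> (\<tau> m) * y,
      - \<kappa>\<^sup>2 * sn \<kappa> (\<tau> m) / b * u + cos (\<kappa> * of_real (\<tau> m)) * y))"

text \<open>The pair \<open>(y, - k\<^sup>2 u)\<close> obeys the same equations and the same radiation conditions as
  \<open>(u, y)\<close>, with \<open>r\<^sup>2 / \<delta>\<close> in place of \<open>\<delta>\<close>: amplitude and flux exchange their roles. The reason is
  that inside a resonator \<open>u' = \<delta> y\<close> and \<open>y' = - (r\<^sup>2 k\<^sup>2 / \<delta>) u\<close>, whereas outside \<open>u' = y\<close> and
  \<open>y' = - k\<^sup>2 u\<close>. The initial values \<open>(1, - \<i> k)\<close> are mapped to their multiple by \<open>- \<i> k\<close>.\<close>

lemma wave_duality: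
  assumes "\<delta> \<noteq> 0" "k \<noteq> 0" "0 < r"
  shows "snd (wave r \<tau> \<delta> k m) = - \<i> * k * fst (wave r \<tau> (of_real (r\<^sup>2) / \<delta>) k m) \<and>
         - k\<^sup>2 * fst (wave r \<tau> \<delta> k m) = - \<i> * k * snd (wave r \<tau> (of_real (r\<^sup>2) / \<delta>) k m)"
proof (induction m)
  case 0
  have "\<i> * k * (\<i> * k) = (\<i> * \<i>) * (k * k)" by (simp only: mult_ac)
  then show ?case by (simp add: power2_eq_square)
next
  case (Suc m)
  let ?\<kappa> = "wave_number r k m" and ?d = "of_real (r\<^sup>2) / \<delta>"
  define c s where "c = cos (?\<kappa> * of_real (\<tau> m))" and "s = sn ?\<kappa> (\<tau> m)"
  obtain u y where w: "wave r \<tau> \<delta> k m = (u, y)" by fastforce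
  obtain u' y' where w': "wave r \<tau> ?d k m = (u', y')" by fastforce
  have b: "contrast \<delta> m \<noteq> 0" "contrast ?d m \<noteq> 0" using assms by (auto simp: contrast_def)
  have bb: "contrast ?d m * k\<^sup>2 = ?\<kappa>\<^sup>2 / contrast \<delta> m"
    by (auto simp: contrast_def wave_number_def power_mult_distrib)
  have bb': "contrast \<delta> m * k\<^sup>2 = ?\<kappa>\<^sup>2 / contrast ?d m"
    using assms by (auto simp: contrast_def wave_number_def power_mult_distrib)
  have IH: "y = - \<i> * k * u'" "- k\<^sup>2 * u = - \<i> * k * y'" using Suc w w' by auto
  have "snd (wave r \<tau> \<delta> k (Suc m)) = - ?\<kappa>\<^sup>2 / contrast \<delta> m * s * u + c * y"
    by (simp add: Let_def w c_def s_def)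
  also have "\<dots> = contrast ?d m * s * (- k\<^sup>2 * u) + c * y"
    using bb by (simp add: mult_ac)
  also have "\<dots> = - \<i> * k * fst (wave r \<tau> ?d k (Suc m))"
    unfolding IH by (simp add: Let_def w' c_def s_def algebra_simps del: of_real_power)
  finally have 1: "snd (wave r \<tau> \<delta> k (Suc m)) = - \<i> * k * fst (wave r \<tau> ?d k (Suc m))" .
  have "- k\<^sup>2 * fst (wave r \<tau> \<delta> k (Suc m)) = c * (- k\<^sup>2 * u) - (contrast \<delta> m * k\<^sup>2) * s * y"
    by (simp add: Let_def w c_def s_def algebra_simps)
  also have "\<dots> = - \<i> * k * snd (wave r \<tau> ?d k (Suc m))"
    unfolding IH bb' by (simp add: Let_def w' c_def s_def algebra_simps del: of_real_power)
  finally show ?case using 1 by simp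
qed

text \<open>The radiation condition at the right end.\<close>

definition outgoing :: "real \<Rightarrow> (nat \<Rightarrow> real) \<Rightarrow> nat \<Rightarrow> complex \<Rightarrow> complex \<Rightarrow> bool" where
  "outgoing r \<tau> n \<delta> k \<longleftrightarrow> snd (wave r \<tau> \<delta> k n) = \<i> * k * fst (wave r \<tau> \<delta> k n)"

lemma outgoing_zero: "outgoing r \<tau> n \<delta> 0"
proof -
  have "snd (wave r \<tau> \<delta> 0 m) = 0" for m
    by (induction m) (auto simp: Let_def wave_number_def)
  then show ?thesis by (simp add: outgoing_def)
qed

lemma outgoing_duality:
  assumes "\<delta> \<noteq> 0" "0 < r"
  shows "outgoing r \<tau> n \<delta> k \<longleftrightarrow> outgoing r \<tau> n (of_real (r\<^sup>2) / \<delta>) k"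
proof (cases "k = 0")
  case False
  obtain u y where w: "wave r \<tau> \<delta> k n = (u, y)" by fastforce
  obtain u' y' where w': "wave r \<tau> (of_real (r\<^sup>2) / \<delta>) k n = (u', y')" by fastforce
  have IH: "y = - \<i> * k * u'" "- k\<^sup>2 * u = - \<i> * k * y'"
    using wave_duality[OF assms(1) False assms(2), of \<tau> n] w w' by auto
  have "\<i> * k * (\<i> * k * u) = (\<i> * \<i>) * k\<^sup>2 * u" by (simp only: mult_ac power2_eq_square)
  then have "- k\<^sup>2 * u = \<i> * k * (\<i> * k * u)" by simp
  then have "y = \<i> * k * u \<longleftrightarrow> \<i> * k * y = - k\<^sup>2 * u"
    using False by simp
  also have "\<dots> \<longleftrightarrow> \<i> * k * y = - \<i> * k * y'" unfolding IH(2) ..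
  also have "\<dots> \<longleftrightarrow> y = - y'" using False mult_left_cancel[of "\<i> * k" y "- y'"] by auto
  also have "\<dots> \<longleftrightarrow> y' = \<i> * k * u'" unfolding IH(1) by auto
  finally show ?thesis by (simp add: outgoing_def w w' del: of_real_power)
qed (simp add: outgoing_zero)

section \<open>The scattering problem as an algebraic equation\<close>

locale scattering_chain =
  fixes N :: nat and xm xp :: "nat \<Rightarrow> real" and v vb r :: real
  assumes N: "1 \<le> N" and chain: "resonator_chain N xm xp"
    and v: "0 < v" and vb: "0 < vb" and r: "r = v / vb"
begin

lemma r_pos: "0 < r"
  using v vb r by simp

text \<open>The end points of the resonators in increasing order, numbered from 0 to \<open>2 N - 1\<close>: those
  with even number are left end points. The piece between the end points \<open>m\<close> and \<open>m + 1\<close> is a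
  resonator for even \<open>m\<close> and a gap for odd \<open>m\<close>.\<close>

definition brk :: "nat \<Rightarrow> real" where
  "brk m = (if even m then xm (m div 2 + 1) else xp (m div 2 + 1))"

definition piece :: "nat \<Rightarrow> real" where
  "piece m = brk (Suc m) - brk m"

lemma brk_even [simp]: "brk (2 * i) = xm (i + 1)"
  and brk_odd [simp]: "brk (Suc (2 * i)) = xp (i + 1)"
  by (simp_all add: brk_def)

lemma piece_even: "piece (2 * i) = res_length xm xp (i + 1)"
  and piece_odd: "piece (Suc (2 * i)) = res_gap xm xp (i + 1)"
proof -
  show "piece (2 * i) = res_length xm xp (i + 1)" by (simp add: piece_def res_length_def)
  have "brk (Suc (Suc (2 * i))) = xm (i + 2)" using brk_even[of "Suc i"] by simp
  then show "piece (Suc (2 * i)) = res_gap xm xp (i + 1)"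
    by (simp add: piece_def res_gap_def)
qed

definition last_brk :: nat where
  "last_brk = 2 * N - 1"

lemma last_brk: "odd last_brk" "last_brk = Suc (2 * (N - 1))" "m < 2 * N \<longleftrightarrow> m \<le> last_brk"
  "brk 0 = xm 1" "brk last_brk = xp N"
proof -
  show *: "last_brk = Suc (2 * (N - 1))" using N by (simp add: last_brk_def)
  show "brk last_brk = xp N" unfolding * brk_odd using N by simp
qed (use N in \<open>auto simp: last_brk_def brk_def\<close>)

lemma piece_pos: "m < last_brk \<Longrightarrow> 0 < piece m"
proof -
  assume m: "m < last_brk"
  define i where "i = m div 2"
  consider "m = 2 * i" | "m = Suc (2 * i)" unfolding i_def by linarith
  then show ?thesis
  proof cases
    case 1
    then have "i + 1 \<in> {1..N}" using m last_brk(2) N by auto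
    then show ?thesis using chain 1
      by (simp add: piece_even res_length_def resonator_chain_def)
  next
    case 2
    then have "i + 1 \<in> {1..<N}" using m last_brk(2) by auto
    then show ?thesis using chain 2
      by (simp add: piece_odd res_gap_def resonator_chain_def)
  qed
qed

lemma brk_less: "m < m' \<Longrightarrow> m' \<le> last_brk \<Longrightarrow> brk m < brk m'"
proof (induction m' rule: less_induct)
  case (less m')
  then obtain n where n: "m' = Suc n" by (cases m') auto
  have "brk n < brk m'" using piece_pos[of n] less n by (simp add: piece_def)
  moreover have "brk m < brk n" if "m \<noteq> n" using less n that by auto
  ultimately show ?case using n by (cases "m = n") auto
qed

lemma brk_le: "m \<le> m' \<Longrightarrow> m' \<le> last_brk \<Longrightarrow> brk m \<le> brk m'"
  using brk_less[of m m'] by (cases "m = m'") auto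

lemma resonators_brk: "resonators N xm xp = (\<Union>m\<in>{m. even m \<and> m < last_brk}. {brk m<..<brk (Suc m)})"
proof -
  have "j \<in> (\<lambda>i. i + 1) ` {..<N}" if "j \<in> {1..N}" for j
    using that by (intro image_eqI[of _ _ "j - 1"]) auto
  then have "{1..N} = (\<lambda>i. i + 1) ` {..<N}" by auto
  moreover have "{m. even m \<and> m < last_brk} = (\<lambda>i. 2 * i) ` {..<N}"
    using last_brk(2) N by (auto elim!: evenE)
  ultimately show ?thesis by (simp add: resonators_def)
qed

lemma brk_gap:
  assumes x: "brk m \<le> x" "m \<le> last_brk" "m = last_brk \<or> x < brk (Suc m)"
    and y: "brk m' \<le> x" "m' \<le> last_brk" "m' = last_brk \<or> x < brk (Suc m')"
  shows "m = m'"
proof (rule linorder_cases[of m m'])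
  assume "m < m'"
  then have "brk (Suc m) \<le> brk m'" "m \<noteq> last_brk" using y(2) by (auto intro: brk_le)
  then show ?thesis using x y by auto
next
  assume "m' < m"
  then have "brk (Suc m') \<le> brk m" "m' \<noteq> last_brk" using x(2) by (auto intro: brk_le)
  then show ?thesis using x y by auto
qed

lemma locate:
  assumes "brk 0 \<le> x"
  obtains m where "m \<le> last_brk" "brk m \<le> x" "m = last_brk \<or> x < brk (Suc m)"
proof -
  define m where "m = (GREATEST m. m \<le> last_brk \<and> brk m \<le> x)"
  have m: "m \<le> last_brk \<and> brk m \<le> x"
    unfolding m_def by (rule GreatestI_nat[of _ 0 last_brk]) (use assms in auto)
  have "x < brk (Suc m)" if "m \<noteq> last_brk"
  proof (rule ccontr)
    assume "\<not> x < brk (Suc m)"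
    then have "Suc m \<le> m"
      unfolding m_def by (intro Greatest_le_nat[of _ _ last_brk]) (use m that in \<open>auto simp:
          m_def[symmetric]\<close>)
    then show False by simp
  qed
  with m that show ?thesis by blast
qed

lemma outer_open:
  shows "{..<brk 0} \<subseteq> interior (- resonators N xm xp)"
    and "{brk last_brk<..} \<subseteq> interior (- resonators N xm xp)"
    and "odd m \<Longrightarrow> m < last_brk \<Longrightarrow> {brk m<..<brk (Suc m)} \<subseteq> interior (- resonators N xm xp)"
proof -
  have "x \<notin> resonators N xm xp" if "x < brk 0" for x
  proof
    assume "x \<in> resonators N xm xp"
    then obtain m' where "m' < last_brk" "brk m' < x" by (auto simp: resonators_brk)
    then show False using that brk_le[of 0 m'] by simp
  qed
  then show "{..<brk 0} \<subseteq> interior (- resonators N xm xp)"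
    by (intro interior_maximal) auto
  have "x \<notin> resonators N xm xp" if "brk last_brk < x" for x
  proof
    assume "x \<in> resonators N xm xp"
    then obtain m' where "m' < last_brk" "x < brk (Suc m')" by (auto simp: resonators_brk)
    then show False using that brk_le[of "Suc m'" last_brk] by simp
  qed
  then show "{brk last_brk<..} \<subseteq> interior (- resonators N xm xp)"
    by (intro interior_maximal) auto
  assume m: "odd m" "m < last_brk"
  have "x \<notin> resonators N xm xp" if "brk m < x" "x < brk (Suc m)" for x
  proof
    assume "x \<in> resonators N xm xp"
    then obtain m' where "even m'" "m' < last_brk" "brk m' < x" "x < brk (Suc m')"
      by (auto simp: resonators_brk)
    then have "m = m'" using that m by (intro brk_gap) auto
    then show False using \<open>even m'\<close> m by simp
  qed
  then show "{brk m<..<brk (Suc m)} \<subseteq> interior (- resonators N xm xp)"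
    by (intro interior_maximal) auto
qed

text \<open>No breakpoint lies in the interior of the complement, since each one is an end point of a
  resonator.\<close>

lemma interior_complement:
  "interior (- resonators N xm xp) =
     {..<brk 0} \<union> {brk last_brk<..} \<union> (\<Union>m\<in>{m. odd m \<and> m < last_brk}. {brk m<..<brk (Suc m)})"
proof (intro equalityI subsetI)
  fix x assume x: "x \<in> interior (- resonators N xm xp)"
  then have nx: "x \<notin> resonators N xm xp" using interior_subset by blast
  have nb: "x \<noteq> brk m" if "m \<le> last_brk" for m
  proof
    assume xb: "x = brk m"
    obtain e where e: "0 < e" "ball x e \<subseteq> - resonators N xm xp"
      using x by (auto simp: mem_interior)
    have "\<exists>n. even n \<and> n < last_brk \<and> (m = n \<or> m = Suc n)"
    proof (cases "even m")
      case True
      then have "m \<noteq> last_brk" using last_brk(1) by auto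
      then show ?thesis using True that by auto
    next
      case False
      then show ?thesis using that by (intro exI[of _ "m - 1"]) (auto elim: oddE)
    qed
    then obtain n where n: "even n" "n < last_brk" "m = n \<or> m = Suc n" by blast
    define a b where "a = brk n" and "b = brk (Suc n)"
    have ab: "a < b" using brk_less[of n "Suc n"] n by (simp add: a_def b_def)
    have sub: "{a<..<b} \<subseteq> resonators N xm xp"
      using n by (auto simp: resonators_brk a_def b_def)
    define h where "h = min (e/2) ((b - a)/2)"
    have h: "0 < h" "h < e" "h < b - a" using ab e by (auto simp: h_def min_def)
    define y where "y = (if x = a then a + h else b - h)"
    have "y \<in> {a<..<b}" using h by (auto simp: y_def)
    moreover have "y \<in> ball x e" using n xb h by (auto simp: y_def a_def b_def dist_real_def)
    ultimately show False using sub e by blast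
  qed
  show "x \<in> {..<brk 0} \<union> {brk last_brk<..} \<union> (\<Union>m\<in>{m. odd m \<and> m < last_brk}. {brk m<..<brk (Suc m)})"
  proof (cases "x < brk 0")
    case False
    then obtain m where m: "m \<le> last_brk" "brk m \<le> x" "m = last_brk \<or> x < brk (Suc m)"
      by (metis locate not_less)
    have lt: "brk m < x" using nb[OF m(1)] m by simp
    show ?thesis
    proof (cases "m = last_brk")
      case True
      then show ?thesis using lt by simp
    next
      case False
      then have "m < last_brk" "x < brk (Suc m)" using m by auto
      then show ?thesis using nx lt by (auto simp: resonators_brk)
    qed
  qed simp
next
  fix x assume "x \<in> {..<brk 0} \<union> {brk last_brk<..} \<union> (\<Union>m\<in>{m. odd m \<and>
      m < last_brk}. {brk m<..<brk (Suc m)})"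
  then show "x \<in> interior (- resonators N xm xp)" using outer_open by blast
qed

lemma transmission_brk:
  "(\<forall>j\<in>{1..N}. P (xm j) \<and> Q (xp j)) \<longleftrightarrow>
   (\<forall>m\<le>last_brk. if even m then P (brk m) else Q (brk m))"
proof (intro iffI allI impI ballI)
  fix m assume *: "\<forall>j\<in>{1..N}. P (xm j) \<and> Q (xp j)" and m: "m \<le> last_brk"
  have "m div 2 + 1 \<in> {1..N}" using m last_brk(2) N by auto
  then show "if even m then P (brk m) else Q (brk m)" using * by (simp add: brk_def)
next
  fix j assume *: "\<forall>m\<le>last_brk. if even m then P (brk m) else Q (brk m)" and j: "j \<in> {1..N}"
  have "2 * (j - 1) \<le> last_brk" "Suc (2 * (j - 1)) \<le> last_brk" using j last_brk(2) by auto
  from this[THEN *[rule_format]] show "P (xm j) \<and> Q (xp j)" using j by simp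
qed


lemma helmholtz_on_Un: "helmholtz_on \<kappa> (S \<union> T) u \<longleftrightarrow> helmholtz_on \<kappa> S u \<and> helmholtz_on \<kappa> T u"
  unfolding helmholtz_on_def by blast

lemma helmholtz_on_UN: "helmholtz_on \<kappa> (\<Union>i\<in>I. S i) u \<longleftrightarrow> (\<forall>i\<in>I. helmholtz_on \<kappa> (S i) u)"
  unfolding helmholtz_on_def by blast

text \<open>The transmission conditions say that the one-sided limits of \<open>u'\<close> at the breakpoint \<open>m\<close>
  stand in the ratio of the contrasts of the pieces \<open>m - 1\<close> and \<open>m\<close>.\<close>

definition lcontrast :: "complex \<Rightarrow> nat \<Rightarrow> complex" where
  "lcontrast \<delta> m = (if even m then 1 else \<delta>)"

lemma lcontrast_Suc: "lcontrast \<delta> (Suc m) = contrast \<delta> m"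
  by (simp add: lcontrast_def contrast_def)

lemma scattering_solution_brk:
  fixes \<omega> :: complex
  assumes "\<delta> \<noteq> 0"
  defines "k \<equiv> \<omega> / of_real v"
  shows "scattering_solution N xm xp v vb \<delta> \<omega> u \<longleftrightarrow>
    helmholtz_on k {..<brk 0} u \<and> helmholtz_on k {brk last_brk<..} u \<and>
    (\<forall>m<last_brk. helmholtz_on (wave_number r k m) {brk m<..<brk (Suc m)} u) \<and>
    (\<forall>m\<le>last_brk. isCont u (brk m) \<and>
       (\<exists>y. ((\<lambda>x. vector_derivative u (at x)) \<longlongrightarrow> lcontrast \<delta> m * y) (at_left (brk m)) \<and>
            ((\<lambda>x. vector_derivative u (at x)) \<longlongrightarrow> contrast \<delta> m * y) (at_right (brk m)))) \<and>
    (\<forall>x<brk 0. vector_derivative u (at x) = - \<i> * k * u x) \<and>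
    (\<forall>x>brk last_brk. vector_derivative u (at x) = \<i> * k * u x)"
proof -
  let ?d = "\<lambda>x. vector_derivative u (at x)"
  let ?T = "\<lambda>m y. (?d \<longlongrightarrow> lcontrast \<delta> m * y) (at_left (brk m)) \<and>
            (?d \<longlongrightarrow> contrast \<delta> m * y) (at_right (brk m))"
  have kb: "\<omega> / of_real vb = of_real r * k"
    using v vb r by (simp add: k_def)
  have hel: "helmholtz_on k (interior (- resonators N xm xp)) u \<and>
      helmholtz_on (of_real r * k) (resonators N xm xp) u \<longleftrightarrow>
      helmholtz_on k {..<brk 0} u \<and> helmholtz_on k {brk last_brk<..} u \<and>
    (\<forall>m<last_brk. helmholtz_on (wave_number r k m) {brk m<..<brk (Suc m)} u)"
    unfolding interior_complement unfolding resonators_brk helmholtz_on_Un helmholtz_on_UN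
        wave_number_def
    by auto
  define P where "P x \<longleftrightarrow> isCont u x \<and> (\<exists>p q. (?d \<longlongrightarrow> p) (at_right x) \<and> (?d \<longlongrightarrow> q) (at_left x) \<and> p =
      \<delta> * q)" for x
  define Q where "Q x \<longleftrightarrow> isCont u x \<and> (\<exists>p q. (?d \<longlongrightarrow> p) (at_left x) \<and> (?d \<longlongrightarrow> q) (at_right x) \<and> p =
      \<delta> * q)" for x
  have P: "P (brk m) \<longleftrightarrow> isCont u (brk m) \<and> (\<exists>y. ?T m y)" if "even m" for m
    unfolding P_def lcontrast_def contrast_def if_P[OF that] mult_1 by blast
  have Q: "Q (brk m) \<longleftrightarrow> isCont u (brk m) \<and> (\<exists>y. ?T m y)" if "odd m" for m
    unfolding Q_def lcontrast_def contrast_def if_not_P[OF that] mult_1 by blast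
  have "(\<forall>j\<in>{1..N}.
            isCont u (xm j) \<and> isCont u (xp j) \<and>
            (\<exists>p q. (?d \<longlongrightarrow> p) (at_right (xm j)) \<and> (?d \<longlongrightarrow> q) (at_left (xm j)) \<and> p = \<delta> * q) \<and>
            (\<exists>p q. (?d \<longlongrightarrow> p) (at_left (xp j)) \<and> (?d \<longlongrightarrow> q) (at_right (xp j)) \<and> p = \<delta> * q))
     \<longleftrightarrow> (\<forall>j\<in>{1..N}. P (xm j) \<and> Q (xp j))"
    unfolding P_def Q_def by blast
  also have "\<dots> \<longleftrightarrow> (\<forall>m\<le>last_brk. isCont u (brk m) \<and> (\<exists>y. ?T m y))"
    unfolding transmission_brk using P Q by auto
  finally have tr: "(\<forall>j\<in>{1..N}.
            isCont u (xm j) \<and> isCont u (xp j) \<and>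
            (\<exists>p q. (?d \<longlongrightarrow> p) (at_right (xm j)) \<and> (?d \<longlongrightarrow> q) (at_left (xm j)) \<and> p = \<delta> * q) \<and>
            (\<exists>p q. (?d \<longlongrightarrow> p) (at_left (xp j)) \<and> (?d \<longlongrightarrow> q) (at_right (xp j)) \<and> p = \<delta> * q))
     \<longleftrightarrow> (\<forall>m\<le>last_brk. isCont u (brk m) \<and> (\<exists>y. ?T m y))" .
  have rad: "(\<forall>x<xm 1. - ?d x - \<i> * k * u x = 0) \<longleftrightarrow> (\<forall>x<brk 0. ?d x = - \<i> * k * u x)"
    "(\<forall>x>xp N. ?d x - \<i> * k * u x = 0) \<longleftrightarrow> (\<forall>x>brk last_brk. ?d x = \<i> * k * u x)"
    unfolding last_brk(4,5) by (simp_all add: algebra_simps neg_eq_iff_add_eq_0 eq_neg_iff_add_eq_0)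
  show ?thesis
    unfolding scattering_solution_def Let_def k_def[symmetric] kb rad tr using hel by blast
qed

lemma ev_right: "m < last_brk \<Longrightarrow> \<forall>\<^sub>F x in at_right (brk m). x \<in> {brk m<..<brk (Suc m)}"
  using brk_less[of m "Suc m"] by (auto simp: eventually_at_right_field)

lemma ev_left: "m < last_brk \<Longrightarrow> \<forall>\<^sub>F x in at_left (brk (Suc m)). x \<in> {brk m<..<brk (Suc m)}"
  using brk_less[of m "Suc m"] by (auto simp: eventually_at_left_field)

abbreviation wv :: "complex \<Rightarrow> complex \<Rightarrow> nat \<Rightarrow> complex \<times> complex" where
  "wv \<equiv> wave r piece"

lemma wave_step:
  assumes "\<delta> \<noteq> 0"
  shows "seg (wave_number r k m) (brk m) (c * fst (wv \<delta> k m)) (contrast \<delta> m * (c * snd (wv \<delta> k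
      m))) (brk (Suc m))
         = c * fst (wv \<delta> k (Suc m))"
    and "seg' (wave_number r k m) (brk m) (c * fst (wv \<delta> k m)) (contrast \<delta> m * (c * snd (wv \<delta> k
        m))) (brk (Suc m))
         = contrast \<delta> m * (c * snd (wv \<delta> k (Suc m)))"
proof -
  have b: "contrast \<delta> m \<noteq> 0" using assms by (simp add: contrast_def)
  then show "seg (wave_number r k m) (brk m) (c * fst (wv \<delta> k m)) (contrast \<delta> m * (c * snd (wv \<delta> k
      m))) (brk (Suc m))
         = c * fst (wv \<delta> k (Suc m))"
    by (simp add: seg_def Let_def piece_def algebra_simps)
  show "seg' (wave_number r k m) (brk m) (c * fst (wv \<delta> k m)) (contrast \<delta> m * (c * snd (wv \<delta> k
      m))) (brk (Suc m))
         = contrast \<delta> m * (c * snd (wv \<delta> k (Suc m)))"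
    using b by (simp add: seg'_def Let_def piece_def field_simps)
qed

text \<open>By induction over the end points: the left limit of the derivative comes from the piece
  before, and the transmission condition turns it into the initial slope for the next piece. As
  \<open>\<delta>\<close> is not 0, this slope is uniquely determined.\<close>

lemma solution_is_wave:
  fixes \<omega> :: complex and u :: "real \<Rightarrow> complex"
  assumes d: "\<delta> \<noteq> 0" and sol: "scattering_solution N xm xp v vb \<delta> \<omega> u"
  defines "k \<equiv> \<omega> / of_real v" and "c \<equiv> u (brk 0)"
  shows "m \<le> last_brk \<Longrightarrow> u (brk m) = c * fst (wv \<delta> k m) \<and>
     ((\<lambda>x. vector_derivative u (at x)) \<longlongrightarrow> contrast \<delta> m * (c * snd (wv \<delta> k m))) (at_right (brk m))"
    and "m < last_brk \<Longrightarrow> x \<in> {brk m<..<brk (Suc m)} \<Longrightarrow>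
      u x = seg (wave_number r k m) (brk m) (c * fst (wv \<delta> k m)) (contrast \<delta> m * (c * snd (wv \<delta> k
          m))) x"
proof -
  let ?d = "\<lambda>x. vector_derivative u (at x)"
  note S = sol[unfolded scattering_solution_brk[OF d], folded k_def]
  have cont: "isCont u (brk m)" if "m \<le> last_brk" for m using S that by blast
  have tr: "(?d \<longlongrightarrow> contrast \<delta> m * y) (at_right (brk m))"
    if l: "(?d \<longlongrightarrow> lcontrast \<delta> m * y) (at_left (brk m))" and m: "m \<le> last_brk" for m y
  proof -
    obtain y' where y': "(?d \<longlongrightarrow> lcontrast \<delta> m * y') (at_left (brk m))"
        "(?d \<longlongrightarrow> contrast \<delta> m * y') (at_right (brk m))" using S m by blast
    have "lcontrast \<delta> m * y = lcontrast \<delta> m * y'"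
      using tendsto_unique[OF trivial_limit_at_left_real l y'(1)] .
    then have "y = y'" using d by (auto simp: lcontrast_def split: if_splits)
    then show ?thesis using y'(2) by simp
  qed
  have piece: "u x = seg (wave_number r k m) (brk m) (c * fst (wv \<delta> k m)) (contrast \<delta> m * (c * snd
      (wv \<delta> k m))) x \<and>
     ?d x = seg' (wave_number r k m) (brk m) (c * fst (wv \<delta> k m)) (contrast \<delta> m * (c * snd (wv \<delta> k
         m))) x"
    if "m < last_brk" "x \<in> {brk m<..<brk (Suc m)}" "u (brk m) = c * fst (wv \<delta> k m)"
     "(?d \<longlongrightarrow> contrast \<delta> m * (c * snd (wv \<delta> k m))) (at_right (brk m))" for m x
  proof -
    have h: "helmholtz_on (wave_number r k m) {brk m<..<brk (Suc m)} u" using S that(1) by blast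
    have "(u \<longlongrightarrow> u (brk m)) (at_right (brk m))"
      using cont[of m] that(1) by (simp add: isCont_def filterlim_at_split)
    then have "(u \<longlongrightarrow> c * fst (wv \<delta> k m)) (at_right (brk m))" using that(3) by simp
    from helmholtz_interval[OF h this that(4) that(2)] show ?thesis by blast
  qed
  show 1: "u (brk m) = c * fst (wv \<delta> k m) \<and>
     (?d \<longlongrightarrow> contrast \<delta> m * (c * snd (wv \<delta> k m))) (at_right (brk m))" if "m \<le> last_brk" for m
    using that
  proof (induction m)
    case 0
    have "(u \<longlongrightarrow> c) (at_left (brk 0))"
      using cont[of 0] by (simp add: isCont_def filterlim_at_split c_def)
    then have "((\<lambda>x. - \<i> * k * u x) \<longlongrightarrow> - \<i> * k * c) (at_left (brk 0))"
      by (intro tendsto_intros)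
    then have "(?d \<longlongrightarrow> - \<i> * k * c) (at_left (brk 0))"
    proof (rule Lim_transform_eventually)
      show "\<forall>\<^sub>F x in at_left (brk 0). - \<i> * k * u x = ?d x"
        unfolding eventually_at_left_field using S by (intro exI[of _ "brk 0 - 1"]) auto
    qed
    then show ?case using tr[of 0 "c * snd (wv \<delta> k 0)"]
      by (simp add: lcontrast_def c_def mult_ac)
  next
    case (Suc m)
    then have m: "m < last_brk" by simp
    have IH: "u (brk m) = c * fst (wv \<delta> k m)"
     "(?d \<longlongrightarrow> contrast \<delta> m * (c * snd (wv \<delta> k m))) (at_right (brk m))" using Suc by auto
    let ?f = "seg (wave_number r k m) (brk m) (c * fst (wv \<delta> k m)) (contrast \<delta> m * (c * snd (wv \<delta>
        k m)))"
    let ?f' = "seg' (wave_number r k m) (brk m) (c * fst (wv \<delta> k m)) (contrast \<delta> m * (c * snd (wv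
        \<delta> k m)))"
    have ev: "\<forall>\<^sub>F x in at_left (brk (Suc m)). ?f x = u x" "\<forall>\<^sub>F x in at_left (brk (Suc m)). ?f' x =
        ?d x"
      using piece[OF m _ IH] by (auto intro: eventually_mono[OF ev_left[OF m]])
    have fl: "(?f \<longlongrightarrow> ?f (brk (Suc m))) (at_left (brk (Suc m)))"
        "(?f' \<longlongrightarrow> ?f' (brk (Suc m))) (at_left (brk (Suc m)))"
      using isCont_seg by (metis isCont_def filterlim_at_split)+
    note l = Lim_transform_eventually[OF fl(1) ev(1)] Lim_transform_eventually[OF fl(2) ev(2)]
    have "(u \<longlongrightarrow> u (brk (Suc m))) (at_left (brk (Suc m)))"
      using cont[OF Suc.prems] by (simp add: isCont_def filterlim_at_split)
    then have "u (brk (Suc m)) = ?f (brk (Suc m))"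
      by (rule tendsto_unique[OF trivial_limit_at_left_real _ l(1)])
    moreover have "(?d \<longlongrightarrow> lcontrast \<delta> (Suc m) * (c * snd (wv \<delta> k (Suc m)))) (at_left (brk (Suc m)))"
      using l(2) unfolding wave_step[OF d] lcontrast_Suc .
    ultimately show ?case using tr Suc.prems unfolding wave_step[OF d] by blast
  qed
  show "u x = seg (wave_number r k m) (brk m) (c * fst (wv \<delta> k m)) (contrast \<delta> m * (c * snd (wv \<delta>
      k m))) x"
    if "m < last_brk" "x \<in> {brk m<..<brk (Suc m)}"
    using piece[OF that] 1[of m] that(1) by simp
qed

text \<open>If \<open>u (brk 0)\<close> were 0, the solution would vanish on every piece and, by the first order
  equations, on both outer half lines. So it can be divided out, and the radiation condition on
  the right becomes the condition on the propagated wave.\<close>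

lemma resonant_imp_outgoing:
  assumes d: "\<delta> \<noteq> 0" and res: "resonant_frequency N xm xp v vb \<delta> \<omega>"
  shows "outgoing r piece last_brk \<delta> (\<omega> / of_real v)"
proof -
  define k where "k = \<omega> / of_real v"
  obtain u x0 where sol: "scattering_solution N xm xp v vb \<delta> \<omega> u" and x0: "u x0 \<noteq> 0"
    using res by (auto simp: resonant_frequency_def)
  let ?d = "\<lambda>x. vector_derivative u (at x)"
  define c where "c = u (brk 0)"
  note S = sol[unfolded scattering_solution_brk[OF d], folded k_def]
  note W = solution_is_wave[OF d sol, folded k_def c_def]
  have left: "(u has_vector_derivative - \<i> * k * u x) (at x)" if "x \<in> {..<brk 0}" for x
    using S helmholtz_deriv[of k "{..<brk 0}" u x] that by (metis lessThan_iff)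
  have right: "(u has_vector_derivative \<i> * k * u x) (at x)" if "x \<in> {brk last_brk<..}" for x
    using S helmholtz_deriv[of k "{brk last_brk<..}" u x] that by (metis greaterThan_iff)
  have cont: "(u \<longlongrightarrow> u (brk m)) (at_left (brk m))" "(u \<longlongrightarrow> u (brk m)) (at_right (brk m))"
    if "m \<le> last_brk" for m
    using S that by (auto simp: isCont_def filterlim_at_split)
  have "c \<noteq> 0"
  proof
    assume c0: "c = 0"
    have ub: "u (brk m) = 0" if "m \<le> last_brk" for m using W(1)[OF that] c0 by simp
    have "u x = 0" if "x \<in> {..<brk 0}" for x
      by (rule first_order_zero[of "{..<brk 0}" u _ "at_left (brk 0)" "brk 0", OF _ left])
         (use cont(1)[of 0] ub that in \<open>auto simp: at_le eventually_at_filter\<close>)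
    moreover have "u x = 0" if "x \<in> {brk last_brk<..}" for x
      by (rule first_order_zero[of "{brk last_brk<..}" u _ "at_right (brk last_brk)"
          "brk last_brk", OF _ right])
         (use cont(2)[of last_brk] ub that in \<open>auto simp: at_le eventually_at_filter\<close>)
    moreover have "u x = 0" if "brk 0 \<le> x" "x \<le> brk last_brk" for x
    proof -
      obtain m where m: "m \<le> last_brk" "brk m \<le> x" "m = last_brk \<or> x < brk (Suc m)"
        using locate \<open>brk 0 \<le> x\<close> by metis
      show ?thesis
      proof (cases "x = brk m")
        case False
        then have "m < last_brk" "x \<in> {brk m<..<brk (Suc m)}" using m that by (auto simp: le_less)
        then show ?thesis using W(2) c0 by (simp add: seg_def)
      qed (use ub m in auto)
    qed
    ultimately show False using x0 by (metis greaterThan_iff lessThan_iff not_less)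
  qed
  have "((\<lambda>x. \<i> * k * u x) \<longlongrightarrow> \<i> * k * u (brk last_brk)) (at_right (brk last_brk))"
    by (intro tendsto_intros cont) simp
  then have "(?d \<longlongrightarrow> \<i> * k * u (brk last_brk)) (at_right (brk last_brk))"
  proof (rule Lim_transform_eventually)
    show "\<forall>\<^sub>F x in at_right (brk last_brk). \<i> * k * u x = ?d x"
      unfolding eventually_at_right_field using S by (intro exI[of _ "brk last_brk + 1"]) auto
  qed
  moreover have "(?d \<longlongrightarrow> c * snd (wv \<delta> k last_brk)) (at_right (brk last_brk))"
    using W(1)[of last_brk] last_brk(1) by (simp add: contrast_def)
  ultimately have "\<i> * k * u (brk last_brk) = c * snd (wv \<delta> k last_brk)"
    using tendsto_unique[OF trivial_limit_at_right_real] by blast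
  then have "c * snd (wv \<delta> k last_brk) = c * (\<i> * k * fst (wv \<delta> k last_brk))"
    using W(1)[of last_brk] by (auto simp: mult_ac)
  then show ?thesis using \<open>c \<noteq> 0\<close> by (simp add: outgoing_def k_def[symmetric])
qed

text \<open>The wave on the whole line, assembled from its pieces. The piece that starts at the last end
  point has no right end.\<close>

definition glued :: "complex \<Rightarrow> complex \<Rightarrow> real \<Rightarrow> complex" where
  "glued \<delta> k x =
    (if x < brk 0 then exp (- \<i> * k * of_real (x - brk 0))
     else let m = (THE m. m \<le> last_brk \<and> brk m \<le> x \<and> (m = last_brk \<or> x < brk (Suc m))) in
       seg (wave_number r k m) (brk m) (fst (wv \<delta> k m)) (contrast \<delta> m * snd (wv \<delta> k m)) x)"

lemma glued_piece:
  assumes "m \<le> last_brk" "brk m \<le> x" "m = last_brk \<or> x < brk (Suc m)"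
  shows "glued \<delta> k x = seg (wave_number r k m) (brk m) (fst (wv \<delta> k m)) (contrast \<delta> m * snd (wv \<delta>
      k m)) x"
proof -
  have "(THE m. m \<le> last_brk \<and> brk m \<le> x \<and> (m = last_brk \<or> x < brk (Suc m))) = m"
    by (rule the_equality) (use assms brk_gap in blast)+
  moreover have "\<not> x < brk 0" using brk_le[of 0 m] assms by simp
  ultimately show ?thesis by (simp add: glued_def)
qed

text \<open>At each end point the derivative of the glued wave has the left limit \<open>lcontrast \<delta> m * y\<close>
  and the right limit \<open>contrast \<delta> m * y\<close> with the same \<open>y\<close>, because both neighbouring pieces were
  built from it.\<close>

lemma outgoing_imp_resonant:
  assumes d: "\<delta> \<noteq> 0" and out: "outgoing r piece last_brk \<delta> (\<omega> / of_real v)"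
  shows "resonant_frequency N xm xp v vb \<delta> \<omega>"
proof -
  define k where "k = \<omega> / of_real v"
  define u where "u = glued \<delta> k"
  let ?d = "\<lambda>x. vector_derivative u (at x)"
  define f where "f m = seg (wave_number r k m) (brk m) (fst (wv \<delta> k m)) (contrast \<delta> m * snd (wv \<delta>
      k m))" for m
  define f' where "f' m = seg' (wave_number r k m) (brk m) (fst (wv \<delta> k m)) (contrast \<delta> m * snd
      (wv \<delta> k m))" for m
  define e where "e x = exp (- \<i> * k * of_real (x - brk 0))" for x
  have uf: "u x = f m x" if "m \<le> last_brk" "brk m \<le> x" "m = last_brk \<or> x < brk (Suc m)" for m x
    unfolding u_def f_def by (rule glued_piece[OF that])
  have f_deriv: "(f m has_vector_derivative f' m x) (at x)"
    "(f' m has_vector_derivative - ((wave_number r k m)\<^sup>2 * f m x)) (at x)" for m x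
    unfolding f_def f'_def by (rule seg_deriv seg'_deriv)+
  have e_deriv: "(e has_vector_derivative - \<i> * k * e x) (at x)" for x
  proof -
    have "((\<lambda>w. exp (- \<i> * k * (w - of_real (brk 0)))) has_field_derivative - \<i> * k * e x) (at
        (of_real x))"
      by (auto intro!: derivative_eq_intros simp: e_def)
    then have "((\<lambda>x. exp (- \<i> * k * (of_real x - of_real (brk 0)))) has_vector_derivative - \<i> * k
        * e x) (at x)"
      by (rule has_vector_derivative_real_field)
    then show ?thesis by (simp add: e_def[abs_def])
  qed
  have e_deriv2: "((\<lambda>x. - \<i> * k * e x) has_vector_derivative - (k\<^sup>2 * e x)) (at x)" for x
  proof (rule has_vector_derivative_eq_rhs[OF has_vector_derivative_mult_right[OF e_deriv]])
    have "- \<i> * k * (- \<i> * k * e x) = (\<i> * \<i>) * (k * k) * e x" by (simp only: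
        mult_ac minus_mult_minus mult_minus_left mult_minus_right minus_minus)
    then show "- \<i> * k * (- \<i> * k * e x) = - (k\<^sup>2 * e x)" by (simp add: power2_eq_square)
  qed
  have inner: "helmholtz_on (wave_number r k m) {brk m<..<brk (Suc m)} u"
    "\<And>x. x \<in> {brk m<..<brk (Suc m)} \<Longrightarrow> ?d x = f' m x" if "m < last_brk" for m
    by (rule helmholtz_on_agree[OF _ _ f_deriv, of "{brk m<..<brk (Suc m)}"]; use uf[of m] that in
        auto)+
  have wl: "wave_number r k last_brk = k" "contrast \<delta> last_brk = 1"
    using last_brk(1) by (simp_all add: wave_number_def contrast_def)
  have right: "helmholtz_on k {brk last_brk<..} u"
    "\<And>x. x \<in> {brk last_brk<..} \<Longrightarrow> ?d x = f' last_brk x"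
    by (rule helmholtz_on_agree[OF _ _ f_deriv[of last_brk, unfolded wl(1)],
        of "{brk last_brk<..}"]; use uf[of last_brk] in auto)+
  have ue: "u x = e x" if "x \<in> {..<brk 0}" for x using that by (simp add: u_def glued_def e_def)
  have left: "helmholtz_on k {..<brk 0} u" "\<And>x. x \<in> {..<brk 0} \<Longrightarrow> ?d x = - \<i> * k * e x"
    by (rule helmholtz_on_agree[OF _ ue e_deriv e_deriv2, of "{..<brk 0}"]; simp)+
  have rad_left: "?d x = - \<i> * k * u x" if "x < brk 0" for x
    using left(2)[of x] ue[of x] that by simp
  have Y: "snd (wv \<delta> k last_brk) = \<i> * k * fst (wv \<delta> k last_brk)"
    using out by (simp add: outgoing_def k_def)
  have "\<i> * k * (\<i> * k * z) = (\<i> * \<i>) * k\<^sup>2 * z" for z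
    by (simp only: mult_ac power2_eq_square)
  then have ikik: "\<i> * k * (\<i> * k * z) = - k\<^sup>2 * z" for z by simp
  have "f' last_brk x = \<i> * k * f last_brk x" for x
  proof -
    let ?a = "fst (wv \<delta> k last_brk)" and ?s = "sn k (x - brk last_brk)"
      and ?c = "cos (k * of_real (x - brk last_brk))"
    have "\<i> * k * f last_brk x = \<i> * k * ?a * ?c + \<i> * k * (\<i> * k * (?s * ?a))"
      unfolding f_def seg_def wl Y by (simp add: algebra_simps)
    also have "\<dots> = f' last_brk x"
      unfolding f'_def seg'_def wl Y ikik by (simp add: algebra_simps)
    finally show ?thesis by simp
  qed
  then have rad_right: "?d x = \<i> * k * u x" if "x > brk last_brk" for x
    using right(2)[of x] uf[of last_brk x] that by simp
  have rightlim: "(u \<longlongrightarrow> fst (wv \<delta> k m)) (at_right (brk m)) \<and>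
      (?d \<longlongrightarrow> contrast \<delta> m * snd (wv \<delta> k m)) (at_right (brk m))" if m: "m \<le> last_brk" for m
  proof -
    have "\<forall>\<^sub>F x in at_right (brk m). f m x = u x \<and> f' m x = ?d x"
    proof (cases "m = last_brk")
      case True
      then show ?thesis unfolding eventually_at_right_field
        using right(2) uf[of m] by (intro exI[of _ "brk m + 1"]) auto
    next
      case False
      then have "m < last_brk" using m by simp
      then show ?thesis using ev_right[of m] inner(2)[of m] uf[of m] by (auto elim!:
          eventually_mono)
    qed
    then have ev: "\<forall>\<^sub>F x in at_right (brk m). f m x = u x" "\<forall>\<^sub>F x in at_right (brk m). f' m x =
        ?d x"
      by (auto elim: eventually_mono)
    have fl: "(f m \<longlongrightarrow> f m (brk m)) (at_right (brk m))" "(f' m \<longlongrightarrow> f' m (brk m)) (at_right (brk m))"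
      unfolding f_def f'_def using isCont_seg by (metis isCont_def filterlim_at_split)+
    show ?thesis
      using Lim_transform_eventually[OF fl(1) ev(1)] Lim_transform_eventually[OF fl(2) ev(2)]
      by (simp add: f_def f'_def)
  qed
  have leftlim: "(u \<longlongrightarrow> fst (wv \<delta> k m)) (at_left (brk m)) \<and>
      (?d \<longlongrightarrow> lcontrast \<delta> m * snd (wv \<delta> k m)) (at_left (brk m))" if m: "m \<le> last_brk" for m
  proof (cases m)
    case 0
    have "\<forall>\<^sub>F x in at_left (brk 0). e x = u x \<and> - \<i> * k * e x = ?d x"
      unfolding eventually_at_left_field using ue left(2) by (intro exI[of _ "brk 0 - 1"]) auto
    then have ev: "\<forall>\<^sub>F x in at_left (brk 0). e x = u x" "\<forall>\<^sub>F x in at_left (brk 0). - \<i> * k * e x =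
        ?d x"
      by (auto elim: eventually_mono)
    have "isCont e (brk 0)" "isCont (\<lambda>x. - \<i> * k * e x) (brk 0)"
      using e_deriv e_deriv2 has_vector_derivative_continuous by blast+
    then have "(e \<longlongrightarrow> e (brk 0)) (at_left (brk 0))" "((\<lambda>x. - \<i> * k * e x) \<longlongrightarrow> - \<i> * k * e (brk 0))
        (at_left (brk 0))"
      by (auto simp: isCont_def filterlim_at_split)
    from Lim_transform_eventually[OF this(1) ev(1)] Lim_transform_eventually[OF this(2) ev(2)]
    show ?thesis using 0 by (simp add: e_def lcontrast_def)
  next
    case (Suc n)
    then have n: "n < last_brk" using m by simp
    have "\<forall>\<^sub>F x in at_left (brk m). f n x = u x \<and> f' n x = ?d x"
      using ev_left[OF n] inner(2)[OF n] uf[of n] n Suc by (auto elim!: eventually_mono)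
    then have ev: "\<forall>\<^sub>F x in at_left (brk m). f n x = u x" "\<forall>\<^sub>F x in at_left (brk m). f' n x = ?d x"
      by (auto elim: eventually_mono)
    have eq: "f n (brk m) = fst (wv \<delta> k m)" "f' n (brk m) = lcontrast \<delta> m * snd (wv \<delta> k m)"
      unfolding f_def f'_def Suc lcontrast_Suc using wave_step[OF d, of k n 1] by simp_all
    have fl: "(f n \<longlongrightarrow> f n (brk m)) (at_left (brk m))" "(f' n \<longlongrightarrow> f' n (brk m)) (at_left (brk m))"
      unfolding f_def f'_def using isCont_seg by (metis isCont_def filterlim_at_split)+
    show ?thesis
      using Lim_transform_eventually[OF fl(1) ev(1)] Lim_transform_eventually[OF fl(2) ev(2)]
      unfolding eq by simp
  qed
  have "isCont u (brk m)" if m: "m \<le> last_brk" for m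
  proof -
    have "u (brk m) = fst (wv \<delta> k m)"
      using uf[of m "brk m"] m brk_less[of m "Suc m"] by (cases "m = last_brk") (auto simp: f_def)
    then show ?thesis using rightlim[OF m] leftlim[OF m] by (simp add:
        isCont_def filterlim_at_split)
  qed
  then have "scattering_solution N xm xp v vb \<delta> \<omega> u"
    unfolding scattering_solution_brk[OF d] k_def[symmetric]
    using inner(1) right(1) left(1) rad_left rad_right rightlim leftlim by blast
  moreover have "u (brk 0 - 1) \<noteq> 0" by (simp add: ue e_def)
  ultimately show ?thesis by (auto simp: resonant_frequency_def)
qed

theorem resonant_iff_outgoing:
  assumes "\<delta> \<noteq> 0"
  shows "resonant_frequency N xm xp v vb \<delta> \<omega> \<longleftrightarrow> outgoing r piece last_brk \<delta> (\<omega> / of_real v)"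
  using resonant_imp_outgoing outgoing_imp_resonant assms by blast

theorem resonant_duality:
  assumes "\<delta> \<noteq> 0"
  shows "resonant_frequency N xm xp v vb \<delta> \<omega> \<longleftrightarrow>
         resonant_frequency N xm xp v vb (of_real (r\<^sup>2) / \<delta>) \<omega>"
proof -
  have "of_real (r\<^sup>2) / \<delta> \<noteq> 0" using assms r_pos by simp
  then show ?thesis
    using resonant_iff_outgoing outgoing_duality[OF assms r_pos] assms by metis
qed

end

section \<open>The subwavelength scaling\<close>

definition flux_coeff :: "real \<Rightarrow> complex \<Rightarrow> nat \<Rightarrow> complex" where
  "flux_coeff r z m = (if even m then of_real (r\<^sup>2) else z\<^sup>2)"

text \<open>With \<open>\<delta> = z\<^sup>2\<close> and \<open>k = z \<mu>\<close> the wave is \<open>(u, \<mu> x)\<close> for the following pair \<open>(u, x)\<close>, whose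
  coefficients are entire in \<open>(\<mu>, z)\<close>, also at \<open>z = 0\<close>, where they become polynomials in \<open>\<mu>\<close>.\<close>

primrec scaled_wave :: "real \<Rightarrow> (nat \<Rightarrow> real) \<Rightarrow> complex \<Rightarrow> complex \<Rightarrow> nat \<Rightarrow> complex \<times> complex" where
  "scaled_wave r \<tau> \<mu> z 0 = (1, - \<i> * z)"
| "scaled_wave r \<tau> \<mu> z (Suc m) =
    (let u = fst (scaled_wave r \<tau> \<mu> z m); x = snd (scaled_wave r \<tau> \<mu> z m); \<kappa> =
        wave_number r (z * \<mu>) m in
     (cos (\<kappa> * of_real (\<tau> m)) * u + \<mu> * contrast (z\<^sup>2) m * sn \<kappa> (\<tau> m) * x,
      cos (\<kappa> * of_real (\<tau> m)) * x - \<mu> * flux_coeff r z m * sn \<kappa> (\<tau> m) * u))"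

definition dispersion :: "real \<Rightarrow> (nat \<Rightarrow> real) \<Rightarrow> nat \<Rightarrow> complex \<Rightarrow> complex \<Rightarrow> complex" where
  "dispersion r \<tau> n \<mu> z = snd (scaled_wave r \<tau> \<mu> z n) - \<i> * z * fst (scaled_wave r \<tau> \<mu> z n)"

lemma wave_eq_scaled_wave:
  assumes "z \<noteq> 0"
  shows "wave r \<tau> (z\<^sup>2) (z * \<mu>) m = (fst (scaled_wave r \<tau> \<mu> z m), \<mu> * snd (scaled_wave r \<tau> \<mu> z m))"
proof (induction m)
  case (Suc m)
  have w0: "(wave_number r (z * \<mu>) m)\<^sup>2 / contrast (z\<^sup>2) m = \<mu>\<^sup>2 * flux_coeff r z m"
    using assms by (auto simp: wave_number_def contrast_def flux_coeff_def power_mult_distrib)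
  have w: "- (wave_number r (z * \<mu>) m)\<^sup>2 * s / contrast (z\<^sup>2) m * u =
      - (\<mu>\<^sup>2 * flux_coeff r z m) * s * u" for s u
    unfolding w0[symmetric] by (simp add: divide_inverse mult_ac)
  show ?case
    unfolding wave.simps scaled_wave.simps Let_def Suc fst_conv snd_conv w
    by (simp add: algebra_simps power2_eq_square)
qed simp

lemma outgoing_dispersion:
  assumes "z \<noteq> 0"
  shows "outgoing r \<tau> n (z\<^sup>2) (z * \<mu>) \<longleftrightarrow> \<mu> = 0 \<or> dispersion r \<tau> n \<mu> z = 0"
  unfolding outgoing_def wave_eq_scaled_wave[OF assms] dispersion_def by auto

lemma scaled_wave_odd: "scaled_wave r \<tau> (- \<mu>) (- z) m = (fst (scaled_wave r \<tau> \<mu> z m), - snd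
    (scaled_wave r \<tau> \<mu> z m))"
  by (induction m) (simp_all add: Let_def wave_number_def contrast_def flux_coeff_def)

lemma dispersion_odd: "dispersion r \<tau> n (- \<mu>) (- z) = - dispersion r \<tau> n \<mu> z"
  by (simp add: dispersion_def scaled_wave_odd)

lemma limit_wave_Suc:
  "fst (scaled_wave r \<tau> \<mu> 0 (Suc m)) = fst (scaled_wave r \<tau> \<mu> 0 m) +
     (if even m then 0 else \<mu> * of_real (\<tau> m) * snd (scaled_wave r \<tau> \<mu> 0 m))"
  "snd (scaled_wave r \<tau> \<mu> 0 (Suc m)) = snd (scaled_wave r \<tau> \<mu> 0 m) -
     (if even m then \<mu> * of_real (r\<^sup>2 * \<tau> m) * fst (scaled_wave r \<tau> \<mu> 0 m) else 0)"
  by (simp_all add: Let_def wave_number_def contrast_def flux_coeff_def sn_def)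

lemma limit_wave_real:
  "fst (scaled_wave r \<tau> (of_real \<mu>) 0 m) \<in> \<real> \<and> snd (scaled_wave r \<tau> (of_real \<mu>) 0 m) \<in> \<real>"
  by (induction m) (auto simp del: scaled_wave.simps(2) simp: limit_wave_Suc)

lemma limit_wave_nonzero: "fst (scaled_wave r \<tau> \<mu> 0 m) \<noteq> 0 \<or> snd (scaled_wave r \<tau> \<mu> 0 m) \<noteq> 0"
  by (induction m) (auto simp del: scaled_wave.simps(2) simp: limit_wave_Suc)

lemma limit_wave_at_0: "fst (scaled_wave r \<tau> 0 0 m) = 1" "snd (scaled_wave r \<tau> 0 0 m) = 0"
  by (induction m) (auto simp del: scaled_wave.simps(2) simp: limit_wave_Suc)

text \<open>Summation by parts. Multiplication by \<open>cnj u\<close> turns the two sums into sums of nonnegative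
  real numbers also for complex \<open>\<mu>\<close>, and the factor of the second sum into \<open>cnj \<mu>\<close>.\<close>

lemma energy:
  "cnj (fst (scaled_wave r \<tau> \<mu> 0 n)) * snd (scaled_wave r \<tau> \<mu> 0 n) =
    - \<mu> * of_real (\<Sum>m<n. if even m then r\<^sup>2 * \<tau> m * (cmod (fst (scaled_wave r \<tau> \<mu> 0 m)))\<^sup>2 else 0)
    + cnj \<mu> * of_real (\<Sum>m<n. if even m then 0 else \<tau> m * (cmod (snd (scaled_wave r \<tau> \<mu> 0 m)))\<^sup>2)"
proof (induction n)
  case (Suc n)
  let ?u = "fst (scaled_wave r \<tau> \<mu> 0 n)" and ?x = "snd (scaled_wave r \<tau> \<mu> 0 n)"
  have uu: "cnj ?u * ?u = of_real ((cmod ?u)\<^sup>2)" and xx: "cnj ?x * ?x = of_real ((cmod ?x)\<^sup>2)"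
    by (simp_all only: complex_norm_square mult.commute)
  show ?case
  proof (cases "even n")
    case True
    have "cnj ?u * (?x - \<mu> * of_real (r\<^sup>2 * \<tau> n) * ?u) =
        cnj ?u * ?x - \<mu> * (of_real (r\<^sup>2 * \<tau> n) * (cnj ?u * ?u))"
      by (simp add: algebra_simps)
    also have "\<dots> = cnj ?u * ?x - \<mu> * of_real (r\<^sup>2 * \<tau> n * (cmod ?u)\<^sup>2)"
      unfolding uu by simp
    finally show ?thesis unfolding limit_wave_Suc Suc using True by (simp add: distrib_left)
  next
    case False
    have "cnj (?u + \<mu> * of_real (\<tau> n) * ?x) * ?x =
        cnj ?u * ?x + cnj \<mu> * (of_real (\<tau> n) * (cnj ?x * ?x))"
      by (simp add: algebra_simps)
    also have "\<dots> = cnj ?u * ?x + cnj \<mu> * of_real (\<tau> n * (cmod ?x)\<^sup>2)"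
      unfolding xx by simp
    finally show ?thesis unfolding limit_wave_Suc Suc using False by (simp add: distrib_left)
  qed
qed simp

lemma mass_pos:
  assumes "0 < n" "\<And>m. m < n \<Longrightarrow> 0 < \<tau> m" "0 < r"
  shows "0 < (\<Sum>m<n. if even m then r\<^sup>2 * \<tau> m * (cmod (fst (scaled_wave r \<tau> \<mu> 0 m)))\<^sup>2 else 0)"
proof (rule sum_pos2[of _ 0])
  show "0 < (if even (0::nat) then r\<^sup>2 * \<tau> 0 * (cmod (fst (scaled_wave r \<tau> \<mu> 0 0)))\<^sup>2 else 0)"
    using assms by simp
  have "0 \<le> \<tau> m" if "m < n" for m using assms(2)[OF that] by simp
  then show "0 \<le> (if even m then r\<^sup>2 * \<tau> m * (cmod (fst (scaled_wave r \<tau> \<mu> 0 m)))\<^sup>2 else 0)"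
    if "m \<in> {..<n}" for m using that by (auto intro!: mult_nonneg_nonneg)
qed (use assms in auto)

text \<open>At a zero, the identity above reads \<open>\<mu> A = cnj \<mu> B\<close> with \<open>A > 0\<close> and \<open>B \<ge> 0\<close>.\<close>

lemma roots_real:
  assumes "0 < n" "\<And>m. m < n \<Longrightarrow> 0 < \<tau> m" "0 < r" and zero: "snd (scaled_wave r \<tau> \<mu> 0 n) = 0"
  shows "\<mu> \<in> \<real>"
proof (rule ccontr)
  assume nr: "\<mu> \<notin> \<real>"
  define A where "A = (\<Sum>m<n. if even m then r\<^sup>2 * \<tau> m * (cmod (fst (scaled_wave r \<tau> \<mu> 0 m)))\<^sup>2
      else 0)"
  define B where "B = (\<Sum>m<n. if even m then 0 else \<tau> m * (cmod (snd (scaled_wave r \<tau> \<mu> 0 m)))\<^sup>2)"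
  have A: "0 < A" unfolding A_def by (rule mass_pos[OF assms(1-3)])
  have "0 \<le> \<tau> m" if "m < n" for m using assms(2)[OF that] by simp
  then have B: "0 \<le> B" unfolding B_def by (intro sum_nonneg) (auto intro!: mult_nonneg_nonneg)
  have eq: "\<mu> * of_real A = cnj \<mu> * of_real B"
    using energy[of r \<tau> \<mu> n] zero by (simp add: A_def B_def)
  then have "cmod \<mu> * A = cmod \<mu> * B"
    using A B by (metis abs_of_nonneg abs_of_pos complex_mod_cnj norm_mult norm_of_real)
  then have "A = B" using nr by auto
  then have "\<mu> = cnj \<mu>" using eq A by simp
  then show False using nr by (metis Reals_cnj_iff)
qed

text \<open>The discrete Wronskian of the solution and its derivative with respect to \<open>\<mu>\<close>: in each step
  it loses the square of the component that drives the step. At a zero of \<open>x\<close> only the term with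
  \<open>x'\<close> survives on the left, so this computes the derivative of \<open>x\<close> there.\<close>

lemma limit_wave_deriv:
  "\<exists>u' x'. ((\<lambda>\<mu>. fst (scaled_wave r \<tau> \<mu> 0 n)) has_field_derivative u') (at \<mu>) \<and>
     ((\<lambda>\<mu>. snd (scaled_wave r \<tau> \<mu> 0 n)) has_field_derivative x') (at \<mu>) \<and>
     x' * fst (scaled_wave r \<tau> \<mu> 0 n) - snd (scaled_wave r \<tau> \<mu> 0 n) * u' =
     - (\<Sum>m<n. if even m then of_real (r\<^sup>2 * \<tau> m) * (fst (scaled_wave r \<tau> \<mu> 0 m))\<^sup>2
               else of_real (\<tau> m) * (snd (scaled_wave r \<tau> \<mu> 0 m))\<^sup>2)"
proof (induction n)
  case 0
  show ?case by (intro exI[of _ 0]) auto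
next
  case (Suc n)
  let ?u = "\<lambda>\<mu>. fst (scaled_wave r \<tau> \<mu> 0 n)" and ?x = "\<lambda>\<mu>. snd (scaled_wave r \<tau> \<mu> 0 n)"
  obtain u' x' where d: "(?u has_field_derivative u') (at \<mu>)" "(?x has_field_derivative x') (at \<mu>)"
    and w: "x' * ?u \<mu> - ?x \<mu> * u' =
     - (\<Sum>m<n. if even m then of_real (r\<^sup>2 * \<tau> m) * (fst (scaled_wave r \<tau> \<mu> 0 m))\<^sup>2
               else of_real (\<tau> m) * (snd (scaled_wave r \<tau> \<mu> 0 m))\<^sup>2)" (is "_ = - ?S")
    using Suc by blast
  show ?case
  proof (cases "even n")
    case True
    let ?a = "of_real (r\<^sup>2 * \<tau> n) :: complex"
    have "((\<lambda>\<mu>. ?x \<mu> - \<mu> * ?a * ?u \<mu>) has_field_derivative x' - (?a * ?u \<mu> + \<mu> * ?a * u')) (at \<mu>)"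
      by (auto intro!: derivative_eq_intros d)
    moreover have "(x' - (?a * ?u \<mu> + \<mu> * ?a * u')) * ?u \<mu> - (?x \<mu> - \<mu> * ?a * ?u \<mu>) * u'
       = - ?S - ?a * (?u \<mu>)\<^sup>2"
      unfolding w[symmetric] by (simp add: algebra_simps power2_eq_square)
    ultimately show ?thesis using True d(1)
      by (intro exI[of _ u'] exI[of _ "x' - (?a * ?u \<mu> + \<mu> * ?a * u')"])
        (simp del: scaled_wave.simps(2) of_real_mult of_real_power add: limit_wave_Suc)
  next
    case False
    let ?a = "of_real (\<tau> n) :: complex"
    have "((\<lambda>\<mu>. ?u \<mu> + \<mu> * ?a * ?x \<mu>) has_field_derivative u' + (?a * ?x \<mu> + \<mu> * ?a * x')) (at \<mu>)"
      by (auto intro!: derivative_eq_intros d)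
    moreover have "x' * (?u \<mu> + \<mu> * ?a * ?x \<mu>) - ?x \<mu> * (u' + (?a * ?x \<mu> + \<mu> * ?a * x'))
       = - ?S - ?a * (?x \<mu>)\<^sup>2"
      unfolding w[symmetric] by (simp add: algebra_simps power2_eq_square)
    ultimately show ?thesis using False d(2)
      by (intro exI[of _ x'] exI[of _ "u' + (?a * ?x \<mu> + \<mu> * ?a * x')"])
        (simp del: scaled_wave.simps(2) add: limit_wave_Suc)
  qed
qed

lemma deriv_even_0:
  assumes d: "(f has_field_derivative D) (at 0)" and even: "\<And>z::complex. f (- z) = f z"
  shows "D = 0"
proof -
  have "(f has_field_derivative D) (at (- 0))" using d by simp
  from DERIV_chain2[OF this DERIV_minus[OF DERIV_ident]]
  have "((\<lambda>z. f (- z)) has_field_derivative - D) (at 0)"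
    unfolding mult_minus_right mult_1_right .
  then have "(f has_field_derivative - D) (at 0)" unfolding even .
  then have "D = - D" by (rule DERIV_unique[OF d])
  then show ?thesis by simp
qed

text \<open>To first order in \<open>z\<close> the propagation does not change, since its coefficients are even in
  \<open>z\<close>. So the derivative with respect to \<open>z\<close> satisfies the same recursion, and its Casoratian with
  the solution itself is constant.\<close>

lemma scaled_wave_z_deriv:
  "\<exists>u' x'. ((\<lambda>z. fst (scaled_wave r \<tau> \<mu> z n)) has_field_derivative u') (at 0) \<and>
     ((\<lambda>z. snd (scaled_wave r \<tau> \<mu> z n)) has_field_derivative x') (at 0) \<and>
     fst (scaled_wave r \<tau> \<mu> 0 n) * x' - snd (scaled_wave r \<tau> \<mu> 0 n) * u' = - \<i>"
proof (induction n)
  case 0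
  show ?case by (intro exI[of _ 0] exI[of _ "- \<i>"]) (auto intro!: derivative_eq_intros)
next
  case (Suc n)
  let ?u = "\<lambda>z. fst (scaled_wave r \<tau> \<mu> z n)" and ?x = "\<lambda>z. snd (scaled_wave r \<tau> \<mu> z n)"
  obtain u' x' where d: "(?u has_field_derivative u') (at 0)" "(?x has_field_derivative x') (at 0)"
    and w: "?u 0 * x' - ?x 0 * u' = - \<i>"
    using Suc by blast
  define a where "a = wave_number r \<mu> n * of_real (\<tau> n)"
  have arg: "wave_number r (z * \<mu>) n * of_real (\<tau> n) = a * z" for z
    by (simp add: wave_number_def a_def)
  have sn: "sn (wave_number r (z * \<mu>) n) (\<tau> n) = of_real (\<tau> n) * csinc (a * z)" for z
    by (simp add: sn_def arg)
  have even0: "(f has_field_derivative 0) (at 0)"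
    if "(f has_field_derivative D) (at 0)" "\<And>z. f (- z) = f z" for f :: "complex \<Rightarrow> complex" and D
    using deriv_even_0 that by blast
  have dc: "((\<lambda>z. cos (a * z)) has_field_derivative 0) (at 0)"
    by (rule even0[of _ "- sin (a * 0) * a"]) (auto intro!: derivative_eq_intros)
  have ds: "((\<lambda>z. csinc (a * z)) has_field_derivative 0) (at 0)"
    by (rule even0[OF DERIV_chain2[OF csinc_has_deriv DERIV_cmult_Id]]) simp
  have db: "((\<lambda>z. contrast (z\<^sup>2) n) has_field_derivative 0) (at 0)"
    by (cases "even n") (auto simp: contrast_def intro!: derivative_eq_intros)
  have dw: "((\<lambda>z. flux_coeff r z n) has_field_derivative 0) (at 0)"
    by (cases "even n") (auto simp: flux_coeff_def intro!: derivative_eq_intros)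
  define b where "b = contrast 0 n * of_real (\<tau> n)"
  define e where "e = flux_coeff r 0 n * of_real (\<tau> n)"
  have be: "b * e = 0" by (simp add: b_def e_def contrast_def flux_coeff_def)
  have 1: "((\<lambda>z. cos (a * z) * ?u z + \<mu> * contrast (z\<^sup>2) n * (of_real (\<tau> n) * csinc (a * z)) * ?x z)
     has_field_derivative u' + \<mu> * b * x') (at 0)"
    by (rule derivative_eq_intros dc ds db d refl)+ (simp add: b_def)
  have 2: "((\<lambda>z. cos (a * z) * ?x z - \<mu> * flux_coeff r z n * (of_real (\<tau> n) * csinc (a * z)) * ?u z)
     has_field_derivative x' - \<mu> * e * u') (at 0)"
    by (rule derivative_eq_intros dc ds dw d refl)+ (simp add: e_def)
  have 3: "fst (scaled_wave r \<tau> \<mu> 0 (Suc n)) = ?u 0 + \<mu> * b * ?x 0"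
      "snd (scaled_wave r \<tau> \<mu> 0 (Suc n)) = ?x 0 - \<mu> * e * ?u 0"
    by (simp_all add: Let_def sn_def wave_number_def b_def e_def)
  have "(?u 0 + \<mu> * b * ?x 0) * (x' - \<mu> * e * u') - (?x 0 - \<mu> * e * ?u 0) * (u' + \<mu> * b * x')
      = (?u 0 * x' - ?x 0 * u') + \<mu>\<^sup>2 * (b * e) * (?u 0 * x' - ?x 0 * u')"
    by (simp add: algebra_simps power2_eq_square)
  also have "\<dots> = - \<i>" unfolding be w by simp
  finally have 4: "fst (scaled_wave r \<tau> \<mu> 0 (Suc n)) * (x' - \<mu> * e * u') -
       snd (scaled_wave r \<tau> \<mu> 0 (Suc n)) * (u' + \<mu> * b * x') = - \<i>" unfolding 3 .
  have f: "(\<lambda>z. fst (scaled_wave r \<tau> \<mu> z (Suc n))) =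
     (\<lambda>z. cos (a * z) * ?u z + \<mu> * contrast (z\<^sup>2) n * (of_real (\<tau> n) * csinc (a * z)) * ?x z)"
    "(\<lambda>z. snd (scaled_wave r \<tau> \<mu> z (Suc n))) =
     (\<lambda>z. cos (a * z) * ?x z - \<mu> * flux_coeff r z n * (of_real (\<tau> n) * csinc (a * z)) * ?u z)"
    by (simp_all add: Let_def sn arg)
  show ?case
    by (rule exI[of _ "u' + \<mu> * b * x'"], rule exI[of _ "x' - \<mu> * e * u'"], intro conjI 4)
       (use 1 2 f in \<open>simp_all only:\<close>)
qed

text \<open>Every step adds to one component a nonzero multiple of \<open>\<mu>\<close> times the other one, so the
  degree grows by one and the leading component alternates.\<close>

lemma limit_wave_poly:
  assumes "\<And>m. m < n \<Longrightarrow> \<tau> m \<noteq> 0" "r \<noteq> 0"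
  shows "\<exists>p q. (\<forall>\<mu>. poly p \<mu> = fst (scaled_wave r \<tau> \<mu> 0 n)) \<and> (\<forall>\<mu>. poly q \<mu> =
      snd (scaled_wave r \<tau> \<mu> 0 n)) \<and>
    (if even n then p \<noteq> 0 \<and> degree p = n \<and> degree q \<le> n else q \<noteq> 0 \<and> degree q = n \<and> degree p \<le> n)"
  using assms
proof (induction n)
  case 0
  show ?case by (intro exI[of _ 1] exI[of _ 0]) simp
next
  case (Suc n)
  then obtain p q where p: "\<And>\<mu>. poly p \<mu> = fst (scaled_wave r \<tau> \<mu> 0 n)" and q: "\<And>\<mu>. poly q \<mu> =
      snd (scaled_wave r \<tau> \<mu> 0 n)"
    and d: "if even n then p \<noteq> 0 \<and> degree p = n \<and> degree q \<le> n else q \<noteq> 0 \<and> degree q = n \<and>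
        degree p \<le> n"
    by (metis less_Suc_eq)
  have t: "\<tau> n \<noteq> 0" "r \<noteq> 0" using Suc by auto
  show ?case
  proof (cases "even n")
    case True
    let ?h = "pCons 0 (Polynomial.smult (- of_real (r\<^sup>2 * \<tau> n)) p)"
    have "degree ?h = Suc n" using True d t by simp
    then have "degree (q + ?h) = Suc n"
      using degree_add_eq_right[of q ?h] True d by simp
    moreover from this have "q + ?h \<noteq> 0" by auto
    ultimately show ?thesis using True d p q
      by (intro exI[of _ p] exI[of _ "q + ?h"]) (simp del: scaled_wave.simps(2) add: limit_wave_Suc)
  next
    case False
    let ?h = "pCons 0 (Polynomial.smult (of_real (\<tau> n)) q)"
    have "degree ?h = Suc n" using False d t by simp
    then have "degree (p + ?h) = Suc n"
      using degree_add_eq_right[of p ?h] False d by simp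
    moreover from this have "p + ?h \<noteq> 0" by auto
    ultimately show ?thesis using False d p q
      by (intro exI[of _ "p + ?h"] exI[of _ q]) (simp del: scaled_wave.simps(2) add: limit_wave_Suc)
  qed
qed

definition roots0 :: "real \<Rightarrow> (nat \<Rightarrow> real) \<Rightarrow> nat \<Rightarrow> real set" where
  "roots0 r \<tau> n = {\<rho>. snd (scaled_wave r \<tau> (of_real \<rho>) 0 n) = 0}"

lemma roots0_minus: "\<rho> \<in> roots0 r \<tau> n \<Longrightarrow> - \<rho> \<in> roots0 r \<tau> n"
  using scaled_wave_odd[of r \<tau> "of_real \<rho>" 0 n] by (simp add: roots0_def)

lemma roots0_0: "0 \<in> roots0 r \<tau> n"
  by (simp add: roots0_def limit_wave_at_0)

text \<open>All zeros are simple: for real \<open>\<rho>\<close> the Wronskian is minus a sum of squares of real numbers,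
  and the first of them is that of \<open>u = 1\<close>.\<close>

lemma root_wronskian:
  assumes "0 < n" "\<And>m. m < n \<Longrightarrow> 0 < \<tau> m" "0 < r" and root: "\<rho> \<in> roots0 r \<tau> n"
  obtains x' where
    "((\<lambda>\<mu>. snd (scaled_wave r \<tau> \<mu> 0 n)) has_field_derivative x') (at (of_real \<rho>))"
    "x' * fst (scaled_wave r \<tau> (of_real \<rho>) 0 n) =
     - (\<Sum>m<n. if even m then of_real (r\<^sup>2 * \<tau> m) * (fst (scaled_wave r \<tau> (of_real \<rho>) 0 m))\<^sup>2
               else of_real (\<tau> m) * (snd (scaled_wave r \<tau> (of_real \<rho>) 0 m))\<^sup>2)"
    "x' \<noteq> 0"
proof -
  let ?u = "\<lambda>m. fst (scaled_wave r \<tau> (of_real \<rho>) 0 m)" and ?x =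
      "\<lambda>m. snd (scaled_wave r \<tau> (of_real \<rho>) 0 m)"
  obtain u' x' where d: "((\<lambda>\<mu>. snd (scaled_wave r \<tau> \<mu> 0 n)) has_field_derivative x') (at (of_real
      \<rho>))"
    and w: "x' * ?u n - ?x n * u' =
     - (\<Sum>m<n. if even m then of_real (r\<^sup>2 * \<tau> m) * (?u m)\<^sup>2 else of_real (\<tau> m) * (?x m)\<^sup>2)"
    using limit_wave_deriv[of r \<tau> n "of_real \<rho>"] by blast
  define a b where "a m = Re (?u m)" and "b m = Re (?x m)" for m
  have ab: "?u m = of_real (a m)" "?x m = of_real (b m)" for m
    using limit_wave_real[of r \<tau> \<rho> m] by (auto simp: a_def b_def)
  have "(\<Sum>m<n. if even m then of_real (r\<^sup>2 * \<tau> m) * (?u m)\<^sup>2 else of_real (\<tau> m) * (?x m)\<^sup>2)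
     = (of_real (\<Sum>m<n. if even m then r\<^sup>2 * \<tau> m * (a m)\<^sup>2 else \<tau> m * (b m)\<^sup>2) :: complex)"
    unfolding ab of_real_sum by (intro sum.cong) auto
  moreover have "0 < (\<Sum>m<n. if even m then r\<^sup>2 * \<tau> m * (a m)\<^sup>2 else \<tau> m * (b m)\<^sup>2)"
  proof (rule sum_pos2[of _ 0])
    have "0 \<le> \<tau> m" if "m < n" for m using assms(2)[OF that] by simp
    then show "0 \<le> (if even m then r\<^sup>2 * \<tau> m * (a m)\<^sup>2 else \<tau> m * (b m)\<^sup>2)"
      if "m \<in> {..<n}" for m using that by (auto intro!: mult_nonneg_nonneg)
  qed (use assms in \<open>auto simp: a_def\<close>)
  ultimately have ne: "(\<Sum>m<n. if even m then of_real (r\<^sup>2 * \<tau> m) * (?u m)\<^sup>2 else of_real (\<tau> m) *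
      (?x m)\<^sup>2) \<noteq> 0"
    by (simp del: of_real_sum)
  show ?thesis
    by (rule that[OF d]) (use w ne root in \<open>auto simp: roots0_def\<close>)
qed

lemma card_roots0:
  assumes "odd n" "\<And>m. m < n \<Longrightarrow> 0 < \<tau> m" "0 < r"
  shows "finite (roots0 r \<tau> n)" "card (roots0 r \<tau> n) = n"
proof -
  have n: "0 < n" using assms(1) by (auto elim: oddE)
  obtain p q where q: "\<And>\<mu>. poly q \<mu> = snd (scaled_wave r \<tau> \<mu> 0 n)" "q \<noteq> 0" "degree q = n"
    using limit_wave_poly[of n \<tau> r] assms by (metis less_irrefl)
  have eq: "{z. poly q z = 0} = of_real ` roots0 r \<tau> n"
  proof (intro equalityI subsetI)
    fix z assume z: "z \<in> {z. poly q z = 0}"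
    then have "snd (scaled_wave r \<tau> z 0 n) = 0" by (simp add: q(1))
    moreover from this have "z \<in> \<real>" using roots_real[of n \<tau> r z] n assms(2,3) by blast
    ultimately show "z \<in> of_real ` roots0 r \<tau> n" by (auto simp: roots0_def elim!: Reals_cases)
  qed (auto simp: q(1) roots0_def)
  have "poly (pderiv q) z \<noteq> 0" if "poly q z = 0" for z
  proof -
    from that have "z \<in> {z. poly q z = 0}" by simp
    then obtain \<rho> where \<rho>: "\<rho> \<in> roots0 r \<tau> n" "z = of_real \<rho>" unfolding eq by (rule imageE)
    have "\<exists>x'. ((\<lambda>\<mu>. snd (scaled_wave r \<tau> \<mu> 0 n)) has_field_derivative x') (at z) \<and> x' \<noteq> 0"
      unfolding \<rho>(2)
      by (rule root_wronskian[of n \<tau> r \<rho>, OF n _ assms(3) \<rho>(1)]) (use assms(2) in blast)+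
    then obtain x' where "((\<lambda>\<mu>. snd (scaled_wave r \<tau> \<mu> 0 n)) has_field_derivative x') (at z)"
        "x' \<noteq> 0"
      by blast
    moreover have "((\<lambda>\<mu>. snd (scaled_wave r \<tau> \<mu> 0 n)) has_field_derivative poly (pderiv q) z) (at
        z)"
      unfolding q(1)[symmetric] by (rule poly_DERIV)
    ultimately show ?thesis using DERIV_unique by metis
  qed
  then have "rsquarefree q" unfolding rsquarefree_roots by blast
  then have dec: "q = Polynomial.smult (lead_coeff q) (\<Prod>z\<in>{z. poly q z = 0}. [:- z, 1:])"
    using complex_poly_decompose_rsquarefree by metis
  have "degree q = (\<Sum>z\<in>{z. poly q z = 0}. degree [:- z, 1:])"
    by (subst dec, subst degree_smult_eq, subst degree_prod_eq_sum_degree)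
       (use q(2) in auto)
  then have "card {z. poly q z = 0} = n" using q(3) by simp
  then show "card (roots0 r \<tau> n) = n" unfolding eq
    by (subst (asm) card_image) (auto intro: inj_onI)
  then show "finite (roots0 r \<tau> n)" using n card_ge_0_finite[of "roots0 r \<tau> n"] by simp
qed

text \<open>One step, in which the dominant component \<open>a\<close> is multiplied by the large weight \<open>w\<close>. The
  bound on \<open>w\<close> makes the new dominant component at least \<open>((9 + 4 T) / 2 - 2) \<bar>a\<bar>\<close>, and the
  other one is at most \<open>(2 + 2 T) \<bar>a\<bar>\<close>.\<close>

lemma dominance_step:
  fixes a b c s w t :: complex
  assumes ab: "cmod b \<le> cmod a" "a \<noteq> 0"
    and c: "cmod c \<le> 2" and s: "1 / 2 \<le> cmod s" "cmod s \<le> 2"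
    and T: "0 < T" and t: "cmod t \<le> 1" and w: "9 + 4 * T \<le> cmod w * T"
  shows "c * b + w * of_real T * s * a \<noteq> 0 \<and>
     cmod (c * a + t * of_real T * s * b) \<le> cmod (c * b + w * of_real T * s * a)"
proof -
  have a: "0 < cmod a" using ab by simp
  have "cmod (c * a + t * of_real T * s * b) \<le> cmod c * cmod a + cmod t * T * cmod s * cmod b"
    by (rule order_trans[OF norm_triangle_ineq]) (use T in \<open>simp add: norm_mult\<close>)
  also have "\<dots> \<le> 2 * cmod a + 1 * T * 2 * cmod a"
    by (intro add_mono mult_mono) (use assms in auto)
  finally have 1: "cmod (c * a + t * of_real T * s * b) \<le> (2 + 2 * T) * cmod a"
    by (simp add: algebra_simps)
  have "(9 + 4 * T) * (1/2) * cmod a \<le> cmod w * T * cmod s * cmod a"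
    by (intro mult_mono) (use assms in auto)
  moreover have "cmod c * cmod b \<le> 2 * cmod a"
    by (intro mult_mono) (use assms in auto)
  moreover have "cmod (w * of_real T * s * a) - cmod (c * b) \<le> cmod (c * b + w * of_real T * s * a)"
    by (metis add.commute norm_diff_ineq)
  ultimately have 2: "(9 + 4 * T) * (1/2) * cmod a - 2 * cmod a \<le> cmod (c * b + w * of_real T * s
      * a)"
    using T by (simp add: norm_mult)
  have "(2 + 2 * T) * cmod a < (9 + 4 * T) * (1/2) * cmod a - 2 * cmod a"
    using a by (simp add: algebra_simps)
  then have 3: "(2 + 2 * T) * cmod a < cmod (c * b + w * of_real T * s * a)" using 2 by linarith
  have "0 \<le> (2 + 2 * T) * cmod a" using T by simp
  then have "c * b + w * of_real T * s * a \<noteq> 0" using 3 by auto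
  then show ?thesis using 1 3 by linarith
qed

text \<open>For \<open>\<bar>\<mu>\<bar>\<close> large and \<open>z \<mu>\<close> small, each resonator makes \<open>x\<close> dominate \<open>u\<close> and each gap makes
  \<open>u\<close> dominate \<open>x\<close>. After the last resonator \<open>x\<close> dominates, which is incompatible with radiation.\<close>

lemma dominance:
  assumes "\<And>m. m < n \<Longrightarrow> 0 < \<tau> m" "0 < r"
  shows "\<exists>\<epsilon> M. 0 < \<epsilon> \<and> \<epsilon> \<le> 1 \<and> 1 \<le> M \<and> (\<forall>\<mu> z. cmod (z * \<mu>) < \<epsilon> \<longrightarrow> M \<le> cmod \<mu> \<longrightarrow>
    (let u = fst (scaled_wave r \<tau> \<mu> z n); x = snd (scaled_wave r \<tau> \<mu> z n) in
     if even n then u \<noteq> 0 \<and> cmod x \<le> cmod u else x \<noteq> 0 \<and> cmod u \<le> cmod x))"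
  using assms(1)
proof (induction n)
  case 0
  have "cmod z \<le> 1" if "cmod (z * \<mu>) < 1" "1 \<le> cmod \<mu>" for z \<mu> :: complex
  proof (rule ccontr)
    assume "\<not> cmod z \<le> 1"
    then have "1 * 1 \<le> cmod z * cmod \<mu>" using that by (intro mult_mono) auto
    then show False using that by (simp add: norm_mult)
  qed
  then show ?case by (intro exI[of _ 1]) (simp add: norm_mult)
next
  case (Suc n)
  then obtain \<epsilon> M where e: "0 < \<epsilon>" "\<epsilon> \<le> 1" "1 \<le> M" and IH: "\<And>\<mu> z. cmod (z * \<mu>) < \<epsilon> \<Longrightarrow> M \<le> cmod \<mu> \<Longrightarrow>
    (let u = fst (scaled_wave r \<tau> \<mu> z n); x = snd (scaled_wave r \<tau> \<mu> z n) in
     if even n then u \<noteq> 0 \<and> cmod x \<le> cmod u else x \<noteq> 0 \<and> cmod u \<le> cmod x)"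
    by (metis less_Suc_eq)
  define T where "T = \<tau> n"
  have T: "0 < T" using Suc.prems by (simp add: T_def)
  have "\<forall>\<^sub>F w in nhds 0. cmod (cos w) < 2 \<and> 1/2 < cmod (csinc w) \<and> cmod (csinc w) < 2"
  proof (intro eventually_conj)
    have "((\<lambda>w::complex. cmod (cos w)) \<longlongrightarrow> cmod (cos 0)) (nhds 0)"
      using isCont_norm[OF isCont_cos, of 0] by (simp add: tendsto_nhds_iff isCont_def)
    then show "\<forall>\<^sub>F w::complex in nhds 0. cmod (cos w) < 2" by (rule order_tendstoD) simp
    have "((\<lambda>w. cmod (csinc w)) \<longlongrightarrow> cmod (csinc 0)) (nhds 0)"
      using isCont_norm[OF isCont_csinc, of 0] by (simp add: tendsto_nhds_iff isCont_def)
    then show "\<forall>\<^sub>F w in nhds 0. 1/2 < cmod (csinc w)" "\<forall>\<^sub>F w in nhds 0. cmod (csinc w) < 2"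
      by (rule order_tendstoD; simp)+
  qed
  then obtain d where d: "0 < d" "\<And>w. cmod w < d \<Longrightarrow> cmod (cos w) < 2 \<and> 1/2 < cmod (csinc w) \<and>
      cmod (csinc w) < 2"
    unfolding eventually_nhds_metric by auto
  define \<epsilon>' where "\<epsilon>' = min \<epsilon> (d / ((1 + r) * T))"
  define M' where "M' = max M ((9 + 4 * T) / T * max 1 (1 / r\<^sup>2))"
  have e': "0 < \<epsilon>'" "\<epsilon>' \<le> \<epsilon>" "\<epsilon>' \<le> d / ((1 + r) * T)" using e d T assms(2) by (auto simp: \<epsilon>'_def)
  have M': "M \<le> M'" "(9 + 4 * T) / T * max 1 (1 / r\<^sup>2) \<le> M'" by (auto simp: M'_def)
  show ?case
  proof (rule exI[of _ \<epsilon>'], rule exI[of _ M'], intro conjI allI impI)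
    fix \<mu> z assume zm: "cmod (z * \<mu>) < \<epsilon>'" and mu: "M' \<le> cmod \<mu>"
    define u x where "u = fst (scaled_wave r \<tau> \<mu> z n)" and "x = snd (scaled_wave r \<tau> \<mu> z n)"
    define \<kappa> where "\<kappa> = wave_number r (z * \<mu>) n"
    define c s where "c = cos (\<kappa> * of_real T)" and "s = csinc (\<kappa> * of_real T)"
    have IH': "if even n then u \<noteq> 0 \<and> cmod x \<le> cmod u else x \<noteq> 0 \<and> cmod u \<le> cmod x"
      using IH[of z \<mu>] zm mu e' M' by (simp add: Let_def u_def x_def)
    have "cmod \<kappa> \<le> (1 + r) * cmod (z * \<mu>)"
      using assms(2) by (auto simp: \<kappa>_def wave_number_def norm_mult algebra_simps)
    also have "\<dots> < (1 + r) * (d / ((1 + r) * T))" using zm e' assms(2)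
        by (intro mult_strict_left_mono) auto
    also have "\<dots> = d / T" using assms(2) by simp
    finally have "cmod (\<kappa> * of_real T) < d" using T by (simp add: norm_mult field_simps)
    from d(2)[OF this] have cs: "cmod c \<le> 2" "1/2 \<le> cmod s" "cmod s \<le> 2"
      by (auto simp: c_def s_def)
    have mu1: "1 \<le> cmod \<mu>" using mu M' e by linarith
    have z1: "cmod z \<le> 1"
    proof (rule ccontr)
      assume "\<not> cmod z \<le> 1"
      then have "1 * 1 \<le> cmod z * cmod \<mu>" using mu1 by (intro mult_mono) auto
      then show False using zm e' e by (simp add: norm_mult)
    qed
    have "cmod (z * \<mu>) \<le> 1" using zm e e' by linarith
    then have "cmod z * cmod (z * \<mu>) \<le> 1 * 1" by (intro mult_mono z1) auto
    then have "cmod (z * (z * \<mu>)) \<le> 1" by (simp add: norm_mult)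
    then have zz: "cmod (\<mu> * z\<^sup>2) \<le> 1" "cmod (- \<mu> * z\<^sup>2) \<le> 1" by (simp_all add:
        power2_eq_square mult_ac)
    have big: "(9 + 4 * T) * max 1 (1 / r\<^sup>2) \<le> cmod \<mu> * T"
    proof -
      have "(9 + 4 * T) / T * max 1 (1 / r\<^sup>2) \<le> cmod \<mu>" using mu M' by linarith
      then have "(9 + 4 * T) / T * max 1 (1 / r\<^sup>2) * T \<le> cmod \<mu> * T" using T
          by (intro mult_right_mono) auto
      then show ?thesis using T by simp
    qed
    have "(9 + 4 * T) * 1 \<le> (9 + 4 * T) * max 1 (1 / r\<^sup>2)"
        "(9 + 4 * T) * (1 / r\<^sup>2) \<le> (9 + 4 * T) * max 1 (1 / r\<^sup>2)"
      using T by (intro mult_left_mono; simp)+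
    then have w1: "9 + 4 * T \<le> cmod \<mu> * T" and "(9 + 4 * T) * (1 / r\<^sup>2) \<le> cmod \<mu> * T"
      using big by (auto intro: order_trans)
    from this(2) have "(9 + 4 * T) * (1 / r\<^sup>2) * r\<^sup>2 \<le> cmod \<mu> * T * r\<^sup>2"
        by (rule mult_right_mono) simp
    then have "9 + 4 * T \<le> cmod (- \<mu> * of_real (r\<^sup>2)) * T"
      using assms(2) by (simp add: norm_mult norm_power mult_ac)
    note w = w1 this
    have nx: "fst (scaled_wave r \<tau> \<mu> z (Suc n)) = c * u + \<mu> * contrast (z\<^sup>2) n * of_real T * s * x"
      "snd (scaled_wave r \<tau> \<mu> z (Suc n)) = c * x + (- \<mu> * flux_coeff r z n) * of_real T * s * u"
      by (simp_all add: Let_def u_def x_def c_def s_def sn_def \<kappa>_def T_def algebra_simps)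
    show "let u = fst (scaled_wave r \<tau> \<mu> z (Suc n)); x = snd (scaled_wave r \<tau> \<mu> z (Suc n)) in
     if even (Suc n) then u \<noteq> 0 \<and> cmod x \<le> cmod u else x \<noteq> 0 \<and> cmod u \<le> cmod x"
    proof (cases "even n")
      case True
      have "c * x + (- \<mu> * of_real (r\<^sup>2)) * of_real T * s * u \<noteq> 0 \<and>
        cmod (c * u + (\<mu> * z\<^sup>2) * of_real T * s * x) \<le> cmod (c * x + (- \<mu> * of_real (r\<^sup>2)) *
            of_real T * s * u)"
        by (rule dominance_step) (use IH' True cs T zz w in auto)
      then show ?thesis unfolding Let_def nx using True by (simp add: contrast_def flux_coeff_def)
    next
      case False
      have "c * u + \<mu> * of_real T * s * x \<noteq> 0 \<and>
        cmod (c * x + (- \<mu> * z\<^sup>2) * of_real T * s * u) \<le> cmod (c * u + \<mu> * of_real T * s * x)"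
        by (rule dominance_step) (use IH' False cs T zz w in auto)
      then show ?thesis unfolding Let_def nx using False by (simp add: contrast_def flux_coeff_def)
    qed
  qed (use e e' M' in auto)
qed

text \<open>Radiation requires \<open>\<bar>x\<bar> = \<bar>z\<bar> \<bar>u\<bar>\<close>, which contradicts the dominance of \<open>x\<close> as soon as
  \<open>\<bar>z\<bar> < 1\<close>.\<close>

lemma dispersion_bounded_zeros:
  assumes "odd n" "\<And>m. m < n \<Longrightarrow> 0 < \<tau> m" "0 < r"
  obtains \<epsilon> M where "0 < \<epsilon>" "\<And>\<mu> z. cmod (z * \<mu>) < \<epsilon> \<Longrightarrow> dispersion r \<tau> n \<mu> z = 0 \<Longrightarrow> cmod \<mu> < M"
proof -
  obtain \<epsilon> M where e: "0 < \<epsilon>" "\<epsilon> \<le> 1" "1 \<le> M" and D: "\<And>\<mu> z. cmod (z * \<mu>) < \<epsilon> \<Longrightarrow> M \<le> cmod \<mu> \<Longrightarrow>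
     snd (scaled_wave r \<tau> \<mu> z n) \<noteq> 0 \<and> cmod (fst (scaled_wave r \<tau> \<mu> z n)) \<le> cmod (snd (scaled_wave
         r \<tau> \<mu> z n))"
    using dominance[of n \<tau> r] assms by (auto simp: Let_def)
  have "cmod \<mu> < M" if zm: "cmod (z * \<mu>) < \<epsilon>" and dispersion: "dispersion r \<tau> n \<mu> z = 0" for \<mu> z
  proof (rule ccontr)
    assume "\<not> cmod \<mu> < M"
    then have M: "M \<le> cmod \<mu>" by simp
    let ?u = "fst (scaled_wave r \<tau> \<mu> z n)" and ?x = "snd (scaled_wave r \<tau> \<mu> z n)"
    have z1: "cmod z < 1"
    proof (rule ccontr)
      assume "\<not> cmod z < 1"
      then have "1 * 1 \<le> cmod z * cmod \<mu>" using M e by (intro mult_mono) auto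
      then show False using zm e by (simp add: norm_mult)
    qed
    have "?x = \<i> * z * ?u" using dispersion by (simp add: dispersion_def)
    then have "cmod ?x = cmod z * cmod ?u" by (simp add: norm_mult)
    also have "\<dots> \<le> cmod z * cmod ?x" using D[OF zm M] by (intro mult_left_mono) auto
    also have "\<dots> < 1 * cmod ?x" using D[OF zm M] z1 by (intro mult_strict_right_mono) auto
    finally show False by simp
  qed
  then show ?thesis using that e(1) by blast
qed

section \<open>Analytic implicit functions\<close>

text \<open>Jointly complex differentiable functions on \<open>\<complex>\<^sup>2\<close>. Continuity of the first partial
  derivative is what makes the Newton map of \<open>analytic_implicit_function\<close> a contraction.\<close>

definition entire2 :: "(complex \<Rightarrow> complex \<Rightarrow> complex) \<Rightarrow> bool" where
  "entire2 h \<longleftrightarrow> (\<exists>h1 h2. continuous_on UNIV h1 \<and>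
     (\<forall>p. ((\<lambda>p. h (fst p) (snd p)) has_derivative
            (\<lambda>d. h1 p * fst d + h2 p * snd d)) (at p)))"

lemma entire2_I:
  assumes "continuous_on UNIV h1"
    and "\<And>p. ((\<lambda>p. h (fst p) (snd p)) has_derivative
            (\<lambda>d. h1 p * fst d + h2 p * snd d)) (at p)"
  shows "entire2 h"
  using assms unfolding entire2_def by blast

lemma entire2_E:
  assumes "entire2 h"
  obtains h1 h2 where "continuous_on UNIV h1"
    and "\<And>p. ((\<lambda>p. h (fst p) (snd p)) has_derivative
            (\<lambda>d. h1 p * fst d + h2 p * snd d)) (at p)"
  using assms unfolding entire2_def by blast

lemma entire2_const: "entire2 (\<lambda>x y. c)"
  by (rule entire2_I[of "\<lambda>_. 0" _ "\<lambda>_. 0"]) auto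

lemma entire2_fst: "entire2 (\<lambda>x y. x)"
  by (rule entire2_I[of "\<lambda>_. 1" _ "\<lambda>_. 0"]) (auto intro!: derivative_eq_intros)

lemma entire2_snd: "entire2 (\<lambda>x y. y)"
  by (rule entire2_I[of "\<lambda>_. 0" _ "\<lambda>_. 1"]) (auto intro!: derivative_eq_intros)

lemma entire2_add:
  assumes "entire2 f" "entire2 g"
  shows "entire2 (\<lambda>x y. f x y + g x y)"
proof -
  obtain f1 f2 where f: "continuous_on UNIV f1"
      "\<And>p. ((\<lambda>p. f (fst p) (snd p)) has_derivative
            (\<lambda>d. f1 p * fst d + f2 p * snd d)) (at p)"
    by (rule entire2_E[OF assms(1)]) (rule that)
  obtain g1 g2 where g: "continuous_on UNIV g1"
      "\<And>p. ((\<lambda>p. g (fst p) (snd p)) has_derivative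
            (\<lambda>d. g1 p * fst d + g2 p * snd d)) (at p)"
    by (rule entire2_E[OF assms(2)]) (rule that)
  show ?thesis
  proof (rule entire2_I[of "\<lambda>p. f1 p + g1 p" _ "\<lambda>p. f2 p + g2 p"])
    show "((\<lambda>p. f (fst p) (snd p) + g (fst p) (snd p)) has_derivative
       (\<lambda>d. (f1 p + g1 p) * fst d + (f2 p + g2 p) * snd d)) (at p)" for p
      by (rule has_derivative_eq_rhs[OF has_derivative_add[OF f(2) g(2)]]) (simp add: algebra_simps)
  qed (intro continuous_intros f g)
qed

lemma entire2_mult:
  assumes "entire2 f" "entire2 g"
  shows "entire2 (\<lambda>x y. f x y * g x y)"
proof -
  obtain f1 f2 where f: "continuous_on UNIV f1"
      "\<And>p. ((\<lambda>p. f (fst p) (snd p)) has_derivative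
            (\<lambda>d. f1 p * fst d + f2 p * snd d)) (at p)"
    by (rule entire2_E[OF assms(1)]) (rule that)
  obtain g1 g2 where g: "continuous_on UNIV g1"
      "\<And>p. ((\<lambda>p. g (fst p) (snd p)) has_derivative
            (\<lambda>d. g1 p * fst d + g2 p * snd d)) (at p)"
    by (rule entire2_E[OF assms(2)]) (rule that)
  have c: "continuous_on UNIV (\<lambda>p. f (fst p) (snd p))" "continuous_on UNIV (\<lambda>p. g (fst p) (snd p))"
    using f(2) g(2) by (blast intro: has_derivative_continuous continuous_at_imp_continuous_on)+
  show ?thesis
  proof (rule entire2_I[of "\<lambda>p. f (fst p) (snd p) * g1 p + f1 p * g (fst p) (snd p)"
      _ "\<lambda>p. f (fst p) (snd p) * g2 p + f2 p * g (fst p) (snd p)"])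
    show "((\<lambda>p. f (fst p) (snd p) * g (fst p) (snd p)) has_derivative
       (\<lambda>d. (f (fst p) (snd p) * g1 p + f1 p * g (fst p) (snd p)) * fst d
          + (f (fst p) (snd p) * g2 p + f2 p * g (fst p) (snd p)) * snd d)) (at p)" for p
      by (rule has_derivative_eq_rhs[OF has_derivative_mult[OF f(2) g(2)]]) (simp add:
          algebra_simps)
  qed (intro continuous_intros f g c)
qed

lemma entire2_comp:
  assumes F: "F holomorphic_on UNIV" and "entire2 f"
  shows "entire2 (\<lambda>x y. F (f x y))"
proof -
  obtain f1 f2 where f: "continuous_on UNIV f1"
      "\<And>p. ((\<lambda>p. f (fst p) (snd p)) has_derivative
            (\<lambda>d. f1 p * fst d + f2 p * snd d)) (at p)"
    by (rule entire2_E[OF assms(2)]) (rule that)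
  have c: "continuous_on UNIV (\<lambda>p. f (fst p) (snd p))"
    using f(2) by (blast intro: has_derivative_continuous continuous_at_imp_continuous_on)
  have dF: "continuous_on UNIV (deriv F)"
    using F by (intro holomorphic_on_imp_continuous_on holomorphic_deriv) auto
  have hF: "(F has_derivative (\<lambda>d. deriv F z * d)) (at z)" for z
    using holomorphic_derivI[OF F] by (simp add: has_field_derivative_def)
  show ?thesis
  proof (rule entire2_I[of "\<lambda>p. deriv F (f (fst p) (snd p)) * f1 p"
      _ "\<lambda>p. deriv F (f (fst p) (snd p)) * f2 p"])
    show "((\<lambda>p. F (f (fst p) (snd p))) has_derivative
       (\<lambda>d. deriv F (f (fst p) (snd p)) * f1 p * fst d
          + deriv F (f (fst p) (snd p)) * f2 p * snd d)) (at p)" for p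
      by (rule has_derivative_eq_rhs[OF has_derivative_compose[OF f(2) hF]]) (simp add:
          algebra_simps)
    show "continuous_on UNIV (\<lambda>p. deriv F (f (fst p) (snd p)) * f1 p)"
      by (intro continuous_on_mult f continuous_on_compose2[OF dF c]) auto
  qed
qed

lemma entire2_continuous: "entire2 h \<Longrightarrow> continuous_on UNIV (\<lambda>p. h (fst p) (snd p))"
  unfolding entire2_def by (blast intro: has_derivative_continuous continuous_at_imp_continuous_on)

lemma entire2_chain:
  assumes D: "((\<lambda>p. h (fst p) (snd p)) has_derivative (\<lambda>d. a * fst d + b * snd d)) (at (f z, g z))"
    and f: "(f has_field_derivative f') (at z)" and g: "(g has_field_derivative g') (at z)"
  shows "((\<lambda>z. h (f z) (g z)) has_field_derivative a * f' + b * g') (at z)"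
proof -
  have "((\<lambda>z. (f z, g z)) has_derivative (\<lambda>d. (f' * d, g' * d))) (at z)"
    using f g by (intro has_derivative_Pair) (simp_all add: has_field_derivative_def)
  from has_derivative_compose[OF this D]
  have "((\<lambda>z. h (f z) (g z)) has_derivative (\<lambda>d. a * (f' * d) + b * (g' * d))) (at z)" by simp
  moreover have "(\<lambda>d. a * (f' * d) + b * (g' * d)) = (*) (a * f' + b * g')"
    by (auto simp: algebra_simps)
  ultimately show ?thesis by (simp add: has_field_derivative_def)
qed

text \<open>The zero near \<open>a\<close> is the fixed point of the simplified Newton map \<open>\<mu> \<mapsto> \<mu> - h \<mu> z / A\<close>, which
  contracts a fixed disc for all small \<open>z\<close>. Its iterates starting from \<open>a\<close> are holomorphic in \<open>z\<close>
  and converge uniformly.\<close>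

lemma analytic_implicit_function:
  assumes h: "entire2 h" and zero: "h a 0 = 0"
    and dA: "((\<lambda>\<mu>. h \<mu> 0) has_field_derivative A) (at a)" and A: "A \<noteq> 0"
    and dB: "((\<lambda>z. h a z) has_field_derivative B) (at 0)" and e0: "0 < e0"
  obtains \<epsilon> \<rho> g where "0 < \<epsilon>" "0 < \<rho>" "\<rho> \<le> e0" "g holomorphic_on ball 0 \<epsilon>" "g 0 = a"
    "deriv g 0 = - B / A"
    "\<And>z. z \<in> ball 0 \<epsilon> \<Longrightarrow> g z \<in> cball a \<rho> \<and> h (g z) z = 0"
    "\<And>z \<mu>. z \<in> ball 0 \<epsilon> \<Longrightarrow> \<mu> \<in> cball a \<rho> \<Longrightarrow> h \<mu> z = 0 \<Longrightarrow> \<mu> = g z"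
proof -
  obtain h1 h2 where h1: "continuous_on UNIV h1"
    and hd: "\<And>p. ((\<lambda>p. h (fst p) (snd p)) has_derivative
            (\<lambda>d. h1 p * fst d + h2 p * snd d)) (at p)"
    by (rule entire2_E[OF h]) (rule that)
  have d1: "((\<lambda>\<mu>. h \<mu> z) has_field_derivative h1 (\<mu>, z)) (at \<mu>)" for \<mu> z
    using entire2_chain[of h "h1 (\<mu>, z)" "h2 (\<mu>, z)" "\<lambda>x. x" \<mu> "\<lambda>_. z" 1 0] hd[of "(\<mu>, z)"] by simp
  have d2: "((\<lambda>z. h \<mu> z) has_field_derivative h2 (\<mu>, z)) (at z)" for \<mu> z
    using entire2_chain[of h "h1 (\<mu>, z)" "h2 (\<mu>, z)" "\<lambda>_. \<mu>" z "\<lambda>x. x" 0 1] hd[of "(\<mu>, z)"] by simp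
  have A1: "h1 (a, 0) = A" and B1: "h2 (a, 0) = B" using DERIV_unique d1 d2 dA dB by blast+
  have comp: "(\<lambda>z. h (f z) z) holomorphic_on S" if "f holomorphic_on S" "open S" for f S
  proof (rule holomorphic_onI)
    fix z assume z: "z \<in> S"
    have "((\<lambda>z. h (f z) z) has_field_derivative h1 (f z, z) * deriv f z + h2 (f z, z) * 1) (at z)"
      by (rule entire2_chain) (use hd[of "(f z, z)"] holomorphic_derivI[OF that z] in auto)
    then show "(\<lambda>z. h (f z) z) field_differentiable at z within S"
      by (meson field_differentiable_at_within field_differentiable_def)
  qed
  have "isCont h1 (a, 0)" using h1 by (simp add: continuous_on_eq_continuous_at)
  then obtain d where d: "0 < d" "\<And>p. dist p (a, 0) < d \<Longrightarrow> cmod (h1 p - A) < cmod A / 2"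
    unfolding continuous_at_eps_delta using A A1 by (auto simp: dist_norm dest!:
        spec[of _ "cmod A / 2"])
  define \<rho> where "\<rho> = min e0 (d / 3)"
  have \<rho>: "0 < \<rho>" "\<rho> \<le> e0" "\<rho> \<le> d / 3" using d e0 by (auto simp: \<rho>_def)
  have "isCont (\<lambda>z. h a z) 0" using d2 DERIV_isCont by blast
  then obtain d' where d': "0 < d'" "\<And>z. cmod z < d' \<Longrightarrow> cmod (h a z) < cmod A * \<rho> / 2"
    unfolding continuous_at_eps_delta using A \<rho> zero by (auto simp: dist_norm dest!:
        spec[of _ "cmod A * \<rho> / 2"])
  define \<epsilon> where "\<epsilon> = min d' (d / 3)"
  have \<epsilon>: "0 < \<epsilon>" "\<epsilon> \<le> d'" "\<epsilon> \<le> d / 3" using d d' by (auto simp: \<epsilon>_def)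
  define T where "T z \<mu> = \<mu> - h \<mu> z / A" for z \<mu>
  have lip: "cmod (T z \<mu> - T z \<nu>) \<le> 1/2 * cmod (\<mu> - \<nu>)"
    if "z \<in> ball 0 \<epsilon>" "\<mu> \<in> cball a \<rho>" "\<nu> \<in> cball a \<rho>" for z \<mu> \<nu>
  proof (rule field_differentiable_bound[of "cball a \<rho>" _ "\<lambda>\<mu>. 1 - h1 (\<mu>, z) / A"])
    show "(T z has_field_derivative 1 - h1 (\<mu>, z) / A) (at \<mu> within cball a \<rho>)" for \<mu>
      unfolding T_def[abs_def] using A
      by (auto intro!: derivative_eq_intros DERIV_subset[OF d1])
    fix \<mu> assume mu: "\<mu> \<in> cball a \<rho>"
    have "dist (\<mu>, z) (a, 0) \<le> dist \<mu> a + dist z 0"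
      by (simp add: dist_Pair_Pair sqrt_sum_squares_le_sum)
    also have "\<dots> < d" using mu that(1) \<rho> \<epsilon> d by (simp add: dist_commute)
    finally have "cmod (h1 (\<mu>, z) - A) < cmod A / 2" using d(2)[of "(\<mu>, z)"] by simp
    moreover have "1 - h1 (\<mu>, z) / A = - (h1 (\<mu>, z) - A) / A" using A by (simp add: field_simps)
    ultimately show "cmod (1 - h1 (\<mu>, z) / A) \<le> 1/2"
      using A by (simp add: norm_divide norm_minus_commute field_simps)
  qed (use that in auto)
  have self: "T z \<mu> \<in> cball a \<rho>" if "z \<in> ball 0 \<epsilon>" "\<mu> \<in> cball a \<rho>" for z \<mu>
  proof -
    have "cmod (T z \<mu> - T z a) \<le> 1/2 * cmod (\<mu> - a)" by (rule lip) (use that \<rho> in auto)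
    also have "\<dots> \<le> \<rho> / 2" using that(2) by (simp add: dist_norm norm_minus_commute)
    finally have 1: "cmod (T z \<mu> - T z a) \<le> \<rho> / 2" .
    have "cmod (h a z) < cmod A * \<rho> / 2" using d'(2) that(1) \<epsilon> by simp
    then have "cmod (T z a - a) \<le> \<rho> / 2"
      using A by (simp add: T_def norm_divide field_simps)
    then have "cmod (T z \<mu> - a) \<le> \<rho>"
      using 1 norm_triangle_ineq[of "T z \<mu> - T z a" "T z a - a"] by simp
    then show ?thesis by (simp add: dist_norm norm_minus_commute)
  qed
  have fixpt: "\<exists>!\<mu>\<in>cball a \<rho>. T z \<mu> = \<mu>" if z: "z \<in> ball 0 \<epsilon>" for z
    by (rule Banach_fix[where c = "1/2"])
       (use self[OF z] lip[OF z] \<rho> in \<open>auto simp: dist_norm complete_eq_closed\<close>)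
  define g where "g z = (THE \<mu>. \<mu> \<in> cball a \<rho> \<and> T z \<mu> = \<mu>)" for z
  have g: "g z \<in> cball a \<rho>" "T z (g z) = g z" if "z \<in> ball 0 \<epsilon>" for z
    using theI'[OF fixpt[OF that]] unfolding g_def by auto
  have Th: "T z \<mu> = \<mu> \<longleftrightarrow> h \<mu> z = 0" for z \<mu> using A by (simp add: T_def)
  have uniq: "\<mu> = g z" if "z \<in> ball 0 \<epsilon>" "\<mu> \<in> cball a \<rho>" "h \<mu> z = 0" for z \<mu>
    using fixpt[OF that(1)] g[OF that(1)] that(2,3) Th by metis
  define f where "f n z = (T z ^^ n) a" for n z
  have f_in: "f n z \<in> cball a \<rho>" if "z \<in> ball 0 \<epsilon>" for n z
    using self[OF that] \<rho> by (induction n) (auto simp: f_def)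
  have f_conv: "cmod (f n z - g z) \<le> \<rho> * (1/2) ^ n" if z: "z \<in> ball 0 \<epsilon>" for n z
  proof (induction n)
    case 0
    show ?case using g(1)[OF z] by (simp add: f_def dist_norm)
  next
    case (Suc n)
    have "cmod (f (Suc n) z - g z) = cmod (T z (f n z) - T z (g z))"
      using g(2)[OF z] by (simp add: f_def)
    also have "\<dots> \<le> 1/2 * cmod (f n z - g z)" by (rule lip[OF z f_in[OF z] g(1)[OF z]])
    also have "\<dots> \<le> 1/2 * (\<rho> * (1/2) ^ n)" using Suc by simp
    finally show ?case by simp
  qed
  have f_hol: "f n holomorphic_on ball 0 \<epsilon>" for n
  proof (induction n)
    case 0
    show ?case by (simp add: f_def[abs_def])
  next
    case (Suc n)
    have "f (Suc n) = (\<lambda>z. f n z - h (f n z) z / A)" by (simp add: f_def[abs_def] T_def)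
    then show ?case using A by (auto intro!: holomorphic_intros Suc comp)
  qed
  have lim: "uniform_limit (ball 0 \<epsilon>) f g sequentially"
  proof (rule uniform_limitI)
    fix e :: real assume "0 < e"
    have "(\<lambda>n. \<rho> * (1/2) ^ n) \<longlonglongrightarrow> \<rho> * 0"
      by (intro tendsto_intros LIMSEQ_power_zero) auto
    then have "\<forall>\<^sub>F n in sequentially. \<rho> * (1/2) ^ n < e"
      using \<open>0 < e\<close> by (auto dest: order_tendstoD(2))
    then show "\<forall>\<^sub>F n in sequentially. \<forall>z\<in>ball 0 \<epsilon>. dist (f n z) (g z) < e"
    proof (rule eventually_mono, intro ballI)
      fix n and z :: complex assume "\<rho> * (1/2) ^ n < e" "z \<in> ball 0 \<epsilon>"
      then show "dist (f n z) (g z) < e" using f_conv[of z n] by (simp add: dist_norm)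
    qed
  qed
  have g_hol: "g holomorphic_on ball 0 \<epsilon>"
  proof (rule holomorphic_uniform_sequence[of "ball 0 \<epsilon>" f])
    fix z assume "z \<in> ball (0::complex) \<epsilon>"
    then obtain d where "0 < d" "cball z d \<subseteq> ball 0 \<epsilon>"
      using open_contains_cball[of "ball (0::complex) \<epsilon>"] by (metis open_ball)
    then show "\<exists>d. 0 < d \<and> cball z d \<subseteq> ball 0 \<epsilon> \<and> uniform_limit (cball z d) f g sequentially"
      using uniform_limit_on_subset[OF lim] by blast
  qed (simp_all add: f_hol)
  have g0: "g 0 = a" using uniq[of 0 a] zero \<epsilon> \<rho> by simp
  have dg: "(g has_field_derivative deriv g 0) (at 0)"
    using holomorphic_derivI[OF g_hol] \<epsilon> by simp
  have "((\<lambda>z. h (g z) z) has_field_derivative A * deriv g 0 + B * 1) (at 0)"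
    by (rule entire2_chain[OF _ dg]) (use hd[of "(a, 0)"] A1 B1 g0 in auto)
  moreover have "((\<lambda>z. h (g z) z) has_field_derivative 0) (at 0)"
  proof (rule has_field_derivative_transform_within_open[of "\<lambda>_. 0"])
    show "0 = h (g z) z" if "z \<in> ball 0 \<epsilon>" for z using g[OF that] Th by simp
  qed (use \<epsilon> in auto)
  ultimately have "A * deriv g 0 + B * 1 = 0" by (rule DERIV_unique)
  then have "deriv g 0 = - B / A" using A by (simp add: field_simps eq_neg_iff_add_eq_0)
  with that[of \<epsilon> \<rho> g] \<epsilon> \<rho> g_hol g0 g Th uniq show ?thesis by blast
qed

text \<open>The function is \<open>h w = f (csqrt w)\<close>. By evenness the sign of the root is irrelevant, so near
  the cut of \<open>csqrt\<close> a branch without cut may be used instead, and the isolated singularity at 0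
  is removable by continuity.\<close>

lemma even_holomorphic:
  fixes f :: "complex \<Rightarrow> complex"
  assumes f: "f holomorphic_on ball 0 \<epsilon>" and even: "\<And>z. z \<in> ball 0 \<epsilon> \<Longrightarrow> f (- z) = f z"
  obtains h :: "complex \<Rightarrow> complex" where "h holomorphic_on ball 0 (\<epsilon>\<^sup>2)" "\<And>z. z \<in> ball 0 \<epsilon> \<Longrightarrow> f z =
      h (z\<^sup>2)"
proof (cases "0 < \<epsilon>")
  case True
  define h where "h w = f (csqrt w)" for w
  have cs: "csqrt w \<in> ball 0 \<epsilon>" if "w \<in> ball 0 (\<epsilon>\<^sup>2)" for w
  proof -
    have "(cmod (csqrt w))\<^sup>2 < \<epsilon>\<^sup>2" using that by (simp add: norm_power[symmetric])
    then show ?thesis using True by (simp add: power2_less_imp_less)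
  qed
  have fh: "f z = h (z\<^sup>2)" if "z \<in> ball 0 \<epsilon>" for z
  proof -
    have "csqrt (z\<^sup>2) = z \<or> csqrt (z\<^sup>2) = - z" by (metis power2_csqrt power2_eq_iff)
    then show ?thesis using even[OF that] by (auto simp: h_def)
  qed
  have fcont: "continuous_on (ball 0 \<epsilon>) f" using f by (rule holomorphic_on_imp_continuous_on)
  have hol: "h holomorphic_on ball 0 (\<epsilon>\<^sup>2) - {0}"
  proof (rule holomorphic_onI)
    fix w :: complex assume w: "w \<in> ball 0 (\<epsilon>\<^sup>2) - {0}"
    define b where "b c x = c * csqrt (x / c\<^sup>2)" for c x :: complex
    obtain c :: complex where c: "c = 1 \<or> c = \<i>" "w / c\<^sup>2 \<notin> \<real>\<^sub>\<le>\<^sub>0"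
    proof (cases "w \<in> \<real>\<^sub>\<le>\<^sub>0")
      case True
      then have "- w \<notin> \<real>\<^sub>\<le>\<^sub>0" using w by (auto simp: complex_nonpos_Reals_iff complex_eq_iff)
      then show ?thesis using that[of \<i>] by simp
    qed (use that[of 1] in simp)
    have bsq: "(b c x)\<^sup>2 = x" for x using c(1) by (auto simp: b_def power_mult_distrib)
    have "csqrt field_differentiable at (w / c\<^sup>2)" using c(2)
        by (rule field_differentiable_at_csqrt)
    then have db: "b c field_differentiable at w"
      unfolding b_def[abs_def] using c(1)
      by (intro field_differentiable_mult field_differentiable_const
          field_differentiable_compose[of "\<lambda>x. x / c\<^sup>2" w csqrt, unfolded o_def])
         (auto intro!: derivative_intros field_differentiable_ident field_differentiable_divide
             field_differentiable_const)
    have bin: "b c x \<in> ball 0 \<epsilon>" if "x \<in> ball 0 (\<epsilon>\<^sup>2)" for x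
    proof -
      have "(cmod (b c x))\<^sup>2 < \<epsilon>\<^sup>2" using that bsq[of x] by (simp add: norm_power[symmetric])
      then show ?thesis using True by (simp add: power2_less_imp_less)
    qed
    have "f field_differentiable at (b c w)"
      using f bin[of w] w by (meson DiffD1 holomorphic_on_imp_differentiable_at open_ball)
    then have "(\<lambda>x. f (b c x)) field_differentiable at w"
      using field_differentiable_compose[OF db] by (simp add: o_def)
    moreover have "f (b c x) = h x" if "x \<in> ball 0 (\<epsilon>\<^sup>2)" for x
      using fh[OF bin[OF that]] bsq by simp
    ultimately have "h field_differentiable at w"
      using w unfolding field_differentiable_def
      by (metis (no_types, lifting) DiffD1 has_field_derivative_transform_within_open open_ball)
    then show "h field_differentiable at w within ball 0 (\<epsilon>\<^sup>2) - {0}"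
      by (rule field_differentiable_at_within)
  qed
  have cs0: "isCont csqrt 0"
  proof -
    have "((\<lambda>w. sqrt (cmod w)) \<longlongrightarrow> sqrt (cmod 0)) (at 0)" by (intro tendsto_intros)
    then have "((\<lambda>w. cmod (csqrt w)) \<longlongrightarrow> 0) (at 0)" by simp
    then have "(csqrt \<longlongrightarrow> 0) (at 0)" by (rule tendsto_norm_zero_cancel)
    then show ?thesis by (simp add: isCont_def)
  qed
  have "isCont f (csqrt 0)" using fcont True by (simp add: continuous_on_eq_continuous_at)
  then have "isCont h 0" unfolding h_def[abs_def] using isCont_o2[OF cs0] by simp
  moreover have "continuous_on (ball 0 (\<epsilon>\<^sup>2) - {0}) h" using hol
      by (rule holomorphic_on_imp_continuous_on)
  then have "isCont h w" if "w \<in> ball 0 (\<epsilon>\<^sup>2)" "w \<noteq> 0" for w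
    using that by (simp add: continuous_on_eq_continuous_at open_delete)
  ultimately have "continuous_on (ball 0 (\<epsilon>\<^sup>2)) h"
    by (metis continuous_at_imp_continuous_on)
  then have "h holomorphic_on ball 0 (\<epsilon>\<^sup>2)"
    by (rule no_isolated_singularity[OF _ hol]) auto
  then show ?thesis by (rule that[OF _ fh])
next
  case False
  then have "\<not> cmod z < \<epsilon>" for z using norm_ge_zero[of z] by linarith
  then show ?thesis using that[of "\<lambda>_. 0"] by simp
qed

lemma taylor2_bigo:
  assumes g: "g holomorphic_on ball 0 \<epsilon>" "0 < \<epsilon>"
  shows "(\<lambda>z. g z - g 0 - deriv g 0 * z) \<in> O[at 0](\<lambda>z. z\<^sup>2)"
proof -
  define q where "q z = (if z = 0 then deriv g 0 else (g z - g 0) / z)" for z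
  have q: "q holomorphic_on ball 0 \<epsilon>"
    using pole_lemma_open[OF g(1), of 0] by (simp add: q_def[abs_def] cong: if_cong)
  have "((\<lambda>z. (q z - q 0) / z) \<longlongrightarrow> deriv q 0) (at 0)"
    using holomorphic_derivI[OF q open_ball, of 0 UNIV] g(2) by (simp add: DERIV_def)
  then have "(\<lambda>z. (q z - q 0) / z) \<in> O[at 0](\<lambda>_. 1)" by (intro bigoI_tendsto[where c =
      "deriv q 0"]) auto
  then have "(\<lambda>z. z\<^sup>2 * ((q z - q 0) / z)) \<in> O[at 0](\<lambda>z. z\<^sup>2 * 1)"
    by (rule landau_o.big.mult_left)
  moreover have "z\<^sup>2 * ((q z - q 0) / z) = g z - g 0 - deriv g 0 * z" for z
    by (cases "z = 0") (simp_all add: q_def power2_eq_square field_simps)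
  ultimately show ?thesis by simp
qed

section \<open>The branches of the dispersion relation\<close>

lemma entire2_diff:
  assumes "entire2 f" "entire2 g"
  shows "entire2 (\<lambda>x y. f x y - g x y)"
  using entire2_add[OF assms(1) entire2_mult[OF entire2_const[of "-1"] assms(2)]] by simp

lemma entire2_scaled_wave:
  "entire2 (\<lambda>\<mu> z. fst (scaled_wave r \<tau> \<mu> z n)) \<and> entire2 (\<lambda>\<mu> z. snd (scaled_wave r \<tau> \<mu> z n))"
proof (induction n)
  case 0
  have "entire2 (\<lambda>\<mu> z. - \<i> * z)" by (intro entire2_mult entire2_const entire2_snd)
  then show ?case by (simp add: entire2_const)
next
  case (Suc n)
  have w: "entire2 (\<lambda>\<mu> z. wave_number r (z * \<mu>) n * of_real (\<tau> n))"
    unfolding wave_number_def by (cases "even n") (auto intro!: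
        entire2_mult entire2_const entire2_fst entire2_snd)
  have c: "entire2 (\<lambda>\<mu> z. cos (wave_number r (z * \<mu>) n * of_real (\<tau> n)))"
    by (rule entire2_comp[OF _ w]) (intro holomorphic_intros)
  have s: "entire2 (\<lambda>\<mu> z. sn (wave_number r (z * \<mu>) n) (\<tau> n))"
    unfolding sn_def by (intro entire2_mult entire2_const entire2_comp[OF csinc_holomorphic w])
  have b: "entire2 (\<lambda>\<mu> z. contrast (z\<^sup>2) n)" "entire2 (\<lambda>\<mu> z. flux_coeff r z n)"
    unfolding contrast_def flux_coeff_def power2_eq_square
    by (cases "even n"; auto intro!: entire2_mult entire2_const entire2_snd)+
  show ?case unfolding scaled_wave.simps Let_def fst_conv snd_conv
    using Suc by (intro conjI entire2_add entire2_diff entire2_mult c s b entire2_fst) auto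
qed

lemma entire2_dispersion: "entire2 (dispersion r \<tau> n)"
  unfolding dispersion_def[abs_def] using entire2_scaled_wave
  by (intro entire2_diff entire2_mult entire2_const entire2_snd) auto

definition wronskian_sum :: "real \<Rightarrow> (nat \<Rightarrow> real) \<Rightarrow> nat \<Rightarrow> complex \<Rightarrow> complex" where
  "wronskian_sum r \<tau> n \<mu> = (\<Sum>m<n. if even m then of_real (r\<^sup>2 * \<tau> m) * (fst (scaled_wave r \<tau> \<mu> 0
      m))\<^sup>2
               else of_real (\<tau> m) * (snd (scaled_wave r \<tau> \<mu> 0 m))\<^sup>2)"

text \<open>The slope \<open>- B / A\<close> of the branch through a zero. With \<open>x = 0\<close>, the Wronskian gives
  \<open>A U = - wronskian_sum\<close> and the Casoratian gives \<open>U x' = - \<i>\<close> for the derivative \<open>x'\<close> in \<open>z\<close>;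
  hence \<open>B U = U x' - \<i> U\<^sup>2 = - \<i> (1 + U\<^sup>2)\<close>.\<close>

lemma dispersion_partials:
  assumes "0 < n" "\<And>m. m < n \<Longrightarrow> 0 < \<tau> m" "0 < r" and root: "\<rho> \<in> roots0 r \<tau> n"
  defines "U \<equiv> fst (scaled_wave r \<tau> (of_real \<rho>) 0 n)"
  obtains A B where
    "((\<lambda>\<mu>. dispersion r \<tau> n \<mu> 0) has_field_derivative A) (at (of_real \<rho>))" "A \<noteq> 0"
    "((\<lambda>z. dispersion r \<tau> n (of_real \<rho>) z) has_field_derivative B) (at 0)"
    "- B / A = - \<i> * (1 + U\<^sup>2) / wronskian_sum r \<tau> n (of_real \<rho>)"
    "wronskian_sum r \<tau> n (of_real \<rho>) \<noteq> 0"
proof -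
  have "\<exists>A. ((\<lambda>\<mu>. snd (scaled_wave r \<tau> \<mu> 0 n)) has_field_derivative A) (at (of_real \<rho>)) \<and>
      A * U = - wronskian_sum r \<tau> n (of_real \<rho>) \<and> A \<noteq> 0"
    unfolding U_def wronskian_sum_def
    by (rule root_wronskian[of n \<tau> r \<rho>, OF assms(1) _ assms(3,4)]) (use assms(2) in blast)+
  then obtain A where A: "((\<lambda>\<mu>. snd (scaled_wave r \<tau> \<mu> 0 n)) has_field_derivative A) (at (of_real
      \<rho>))"
      "A * U = - wronskian_sum r \<tau> n (of_real \<rho>)" "A \<noteq> 0" by blast
  have x0: "snd (scaled_wave r \<tau> (of_real \<rho>) 0 n) = 0" using root by (simp add: roots0_def)
  have U: "U \<noteq> 0" using limit_wave_nonzero x0 unfolding U_def by blast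
  obtain u' x' where d: "((\<lambda>z. fst (scaled_wave r \<tau> (of_real \<rho>) z n)) has_field_derivative u') (at
      0)"
     "((\<lambda>z. snd (scaled_wave r \<tau> (of_real \<rho>) z n)) has_field_derivative x') (at 0)"
     and w: "U * x' - snd (scaled_wave r \<tau> (of_real \<rho>) 0 n) * u' = - \<i>"
    using scaled_wave_z_deriv[of r \<tau> "of_real \<rho>" n] unfolding U_def by blast
  have "((\<lambda>z. dispersion r \<tau> n (of_real \<rho>) z) has_field_derivative x' - \<i> * U) (at 0)"
    unfolding dispersion_def U_def by (rule derivative_eq_intros d refl)+ simp
  moreover have "((\<lambda>\<mu>. dispersion r \<tau> n \<mu> 0) has_field_derivative A) (at (of_real \<rho>))"
    using A(1) by (simp add: dispersion_def)
  moreover have W: "wronskian_sum r \<tau> n (of_real \<rho>) \<noteq> 0" using A U by auto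
  moreover have "- (x' - \<i> * U) / A = - \<i> * (1 + U\<^sup>2) / wronskian_sum r \<tau> n (of_real \<rho>)"
  proof -
    have "U * x' = - \<i>" using w x0 by simp
    have "- (x' - \<i> * U) / A = - (U * x' - \<i> * U\<^sup>2) / (A * U)"
      using U A(3) by (simp add: field_simps power2_eq_square)
    also have "\<dots> = - \<i> * (1 + U\<^sup>2) / wronskian_sum r \<tau> n (of_real \<rho>)"
      unfolding A(2) \<open>U * x' = - \<i>\<close> using W by (simp add: field_simps)
    finally show ?thesis .
  qed
  ultimately show ?thesis using that A(3) by blast
qed

lemma finite_separation:
  fixes R :: "real set"
  assumes "finite R"
  obtains d where "0 < d" "\<And>x y. x \<in> R \<Longrightarrow> y \<in> R \<Longrightarrow> x \<noteq> y \<Longrightarrow> d \<le> \<bar>x - y\<bar>"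
proof -
  define S where "S = insert 1 ((\<lambda>(x, y). \<bar>x - y\<bar>) ` {(x, y). x \<in> R \<and> y \<in> R \<and> x \<noteq> y})"
  have "finite {(x, y). x \<in> R \<and> y \<in> R \<and> x \<noteq> y}"
    by (rule finite_subset[of _ "R \<times> R"]) (use assms in auto)
  then have S: "finite S" "S \<noteq> {}" by (auto simp: S_def)
  have "0 < Min S" using S by (subst Min_gr_iff) (auto simp: S_def)
  moreover have "Min S \<le> \<bar>x - y\<bar>" if "x \<in> R" "y \<in> R" "x \<noteq> y" for x y
    using S that by (intro Min_le) (auto simp: S_def)
  ultimately show ?thesis using that by blast
qed

lemma zero_free_tube:
  fixes h :: "complex \<Rightarrow> complex \<Rightarrow> complex"
  assumes h: "continuous_on UNIV (\<lambda>p. h (fst p) (snd p))" and K: "compact K"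
    and ne: "\<And>\<mu>. \<mu> \<in> K \<Longrightarrow> h \<mu> 0 \<noteq> 0"
  obtains \<epsilon> where "0 < \<epsilon>" "\<And>\<mu> z. \<mu> \<in> K \<Longrightarrow> z \<in> ball 0 \<epsilon> \<Longrightarrow> h \<mu> z \<noteq> 0"
proof -
  have "continuous_on UNIV (\<lambda>p::complex \<times> complex. h (snd p) (fst p))"
    using continuous_on_compose2[OF h, of UNIV "\<lambda>p. (snd p, fst p)"] by (simp add:
        continuous_intros)
  then have op: "open ((\<lambda>p::complex \<times> complex. h (snd p) (fst p)) -` (- {0}))"
    by (rule open_vimage[rotated]) auto
  have sub: "{0} \<times> K \<subseteq> (\<lambda>p. h (snd p) (fst p)) -` (- {0})" using ne by auto
  from Elementary_Topology.tube_lemma[OF K op sub]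
  obtain X where X: "0 \<in> X" "open X" "X \<times> K \<subseteq> (\<lambda>p. h (snd p) (fst p)) -` (- {0})"
    by (elim exE conjE) (rule that)
  then obtain e where "0 < e" "ball 0 e \<subseteq> X" by (auto simp: open_contains_ball)
  have "h \<mu> z \<noteq> 0" if "\<mu> \<in> K" "z \<in> ball 0 e" for \<mu> z
    using subsetD[OF X(3), of "(z, \<mu>)"] that \<open>ball 0 e \<subseteq> X\<close> by auto
  with \<open>0 < e\<close> show ?thesis by (rule that)
qed

text \<open>Each zero at \<open>z = 0\<close> continues to an analytic branch inside a disc around it; these discs
  are disjoint, since their radii are at most a third of the least distance \<open>d\<close> between two zeros.
  All zeros lie in a fixed disc, and its part outside the small discs is compact and free of zeros
  for \<open>z = 0\<close>, hence for all small \<open>z\<close>. So there are no other zeros. The last property follows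
  from uniqueness of the branch at 0, because \<open>dispersion\<close> changes its sign with \<open>(\<mu>, z)\<close>.\<close>

lemma dispersion_branches:
  assumes n: "odd n" and \<tau>: "\<And>m. m < n \<Longrightarrow> 0 < \<tau> m" and r: "0 < r"
  defines "R \<equiv> roots0 r \<tau> n"
  obtains \<epsilon> g where "0 < \<epsilon>"
    "\<And>\<rho>. \<rho> \<in> R \<Longrightarrow> g \<rho> holomorphic_on ball 0 \<epsilon>"
    "\<And>\<rho>. \<rho> \<in> R \<Longrightarrow> g \<rho> 0 = of_real \<rho>"
    "\<And>\<rho>. \<rho> \<in> R \<Longrightarrow> deriv (g \<rho>) 0 =
       - \<i> * (1 + (fst (scaled_wave r \<tau> (of_real \<rho>) 0 n))\<^sup>2) / wronskian_sum r \<tau> n (of_real \<rho>)"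
    "\<And>\<rho> z. \<rho> \<in> R \<Longrightarrow> z \<in> ball 0 \<epsilon> \<Longrightarrow> dispersion r \<tau> n (g \<rho> z) z = 0"
    "\<And>\<mu> z. z \<in> ball 0 \<epsilon> \<Longrightarrow> cmod (z * \<mu>) < \<epsilon> \<Longrightarrow> dispersion r \<tau> n \<mu> z = 0 \<Longrightarrow> \<exists>\<rho>\<in>R. \<mu> = g \<rho> z"
    "\<And>\<rho> \<rho>' z. \<rho> \<in> R \<Longrightarrow> \<rho>' \<in> R \<Longrightarrow> \<rho> \<noteq> \<rho>' \<Longrightarrow> z \<in> ball 0 \<epsilon> \<Longrightarrow> g \<rho> z \<noteq> g \<rho>' z"
    "\<And>\<rho> z. \<rho> \<in> R \<Longrightarrow> z \<in> ball 0 \<epsilon> \<Longrightarrow> z \<noteq> 0 \<Longrightarrow> g \<rho> z \<noteq> 0"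
    "\<And>z. z \<in> ball 0 \<epsilon> \<Longrightarrow> g 0 (- z) = - g 0 z"
proof -
  have n0: "0 < n" using n by (auto elim: oddE)
  have R: "finite R" unfolding R_def using card_roots0(1)[OF n] \<tau> r by blast
  have R0: "0 \<in> R" unfolding R_def by (rule roots0_0)
  obtain d where d: "0 < d" "\<And>x y. x \<in> R \<Longrightarrow> y \<in> R \<Longrightarrow> x \<noteq> y \<Longrightarrow> d \<le> \<bar>x - y\<bar>"
    using finite_separation[OF R] by metis
  let ?H = "dispersion r \<tau> n"
  let ?slope = "\<lambda>\<rho>. - \<i> * (1 + (fst (scaled_wave r \<tau> (of_real \<rho>) 0 n))\<^sup>2) / wronskian_sum r \<tau> n
      (of_real \<rho>)"
  define good where "good \<rho> \<epsilon> s g \<longleftrightarrow> 0 < \<epsilon> \<and> 0 < s \<and> s \<le> d / 3 \<and> g holomorphic_on ball 0 \<epsilon> \<and> g 0 =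
      of_real \<rho> \<and>
     deriv g 0 = ?slope \<rho> \<and> (\<forall>z\<in>ball 0 \<epsilon>. g z \<in> cball (of_real \<rho>) s \<and> ?H (g z) z = 0) \<and>
     (\<forall>z\<in>ball 0 \<epsilon>. \<forall>\<mu>\<in>cball (of_real \<rho>) s. ?H \<mu> z = 0 \<longrightarrow> \<mu> = g z)" for \<rho> \<epsilon> s g
  have "\<exists>\<epsilon> s g. good \<rho> \<epsilon> s g" if \<rho>: "\<rho> \<in> R" for \<rho>
  proof -
    obtain A B where AB: "((\<lambda>\<mu>. ?H \<mu> 0) has_field_derivative A) (at (of_real \<rho>))" "A \<noteq> 0"
      "((\<lambda>z. ?H (of_real \<rho>) z) has_field_derivative B) (at 0)" "- B / A = ?slope \<rho>"
      by (rule dispersion_partials[OF n0 \<tau> r \<rho>[unfolded R_def]]) (assumption, rule that)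
    have "?H (of_real \<rho>) 0 = 0" using \<rho> by (simp add: dispersion_def R_def roots0_def)
    have d3: "0 < d / 3" using d(1) by simp
    obtain \<epsilon> s g where "0 < \<epsilon>" "0 < s" "s \<le> d / 3" "g holomorphic_on ball 0 \<epsilon>" "g 0 = of_real \<rho>"
      "deriv g 0 = - B / A"
      "\<And>z. z \<in> ball 0 \<epsilon> \<Longrightarrow> g z \<in> cball (of_real \<rho>) s \<and> ?H (g z) z = 0"
      "\<And>z \<mu>. z \<in> ball 0 \<epsilon> \<Longrightarrow> \<mu> \<in> cball (of_real \<rho>) s \<Longrightarrow> ?H \<mu> z = 0 \<Longrightarrow> \<mu> = g z"
      by (rule analytic_implicit_function[OF entire2_dispersion \<open>?H (of_real \<rho>) 0 =
          0\<close> AB(1-3) d3]) (rule that)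
    then have "good \<rho> \<epsilon> s g" unfolding good_def AB(4)[symmetric] by blast
    then show ?thesis by blast
  qed
  then obtain E s g where good: "\<And>\<rho>. \<rho> \<in> R \<Longrightarrow> good \<rho> (E \<rho>) (s \<rho>) (g \<rho>)" by metis
  obtain ea M where ea: "0 < ea" and M: "\<And>\<mu> z. cmod (z * \<mu>) < ea \<Longrightarrow> ?H \<mu> z = 0 \<Longrightarrow> cmod \<mu> < M"
    by (rule dispersion_bounded_zeros[OF n \<tau> r]) (assumption, rule that)
  define K where "K = cball 0 M - (\<Union>\<rho>\<in>R. ball (of_real \<rho> :: complex) (s \<rho>))"
  have "open (\<Union>\<rho>\<in>R. ball (of_real \<rho> :: complex) (s \<rho>))" by auto
  with compact_cball[of "0::complex" M] have "compact K" unfolding K_def by (rule compact_diff)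
  moreover have "?H \<mu> 0 \<noteq> 0" if "\<mu> \<in> K" for \<mu>
  proof
    assume "?H \<mu> 0 = 0"
    then have x0: "snd (scaled_wave r \<tau> \<mu> 0 n) = 0" by (simp add: dispersion_def)
    have "\<mu> \<in> \<real>" using roots_real[of n \<tau> r \<mu>] n0 \<tau> r x0 by blast
    then obtain \<rho> where "\<mu> = of_real \<rho>" by (auto elim: Reals_cases)
    then have \<rho>: "\<rho> \<in> R" using x0 by (simp add: R_def roots0_def)
    then have "0 < s \<rho>" using good by (simp add: good_def)
    then show False using that \<rho> \<open>\<mu> = of_real \<rho>\<close> by (auto simp: K_def)
  qed
  ultimately obtain ek where ek: "0 < ek" "\<And>\<mu> z. \<mu> \<in> K \<Longrightarrow> z \<in> ball 0 ek \<Longrightarrow> ?H \<mu> z \<noteq> 0"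
    using zero_free_tube[OF entire2_continuous[OF entire2_dispersion]] by metis
  have g0: "g 0 0 = 0" "g 0 holomorphic_on ball 0 (E 0)" "0 < E 0" "deriv (g 0) 0 = ?slope 0"
    using good[OF R0] by (auto simp: good_def)
  have "wronskian_sum r \<tau> n (of_real 0) \<noteq> 0"
    by (rule dispersion_partials[OF n0 \<tau> r R0[unfolded R_def]])
  then have ne0: "deriv (g 0) 0 \<noteq> 0" unfolding g0(4) by (simp add: limit_wave_at_0)
  have "((\<lambda>z. (g 0 (0 + z) - g 0 0) / z) \<longlongrightarrow> deriv (g 0) 0) (at 0)"
    using holomorphic_derivI[OF g0(2) open_ball, of 0 UNIV] g0(3) by (simp add: DERIV_def)
  from tendsto_imp_eventually_ne[OF this ne0]
  have "\<forall>\<^sub>F z in at 0. (g 0 (0 + z) - g 0 0) / z \<noteq> 0" .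
  then obtain e0 where e0: "0 < e0" "\<And>z. z \<noteq> 0 \<Longrightarrow> z \<in> ball 0 e0 \<Longrightarrow> g 0 z \<noteq> 0"
    unfolding eventually_at using g0(1) by (auto simp: dist_norm)
  (* below ea the zeros are bounded, below ek the compact set K is free of them, below e0 the branch
     at 0 is not zero, and below E \<rho> the branch at \<rho> exists *)
  define \<epsilon> where "\<epsilon> = Min (insert ea (insert ek (insert e0 (E ` R))))"
  have fin: "finite (insert ea (insert ek (insert e0 (E ` R))))" using R by simp
  have "0 < \<epsilon>" unfolding \<epsilon>_def using fin ea ek e0 good
    by (subst Min_gr_iff) (auto simp: good_def)
  have le: "\<epsilon> \<le> ea" "\<epsilon> \<le> ek" "\<epsilon> \<le> e0" "\<And>\<rho>. \<rho> \<in> R \<Longrightarrow> \<epsilon> \<le> E \<rho>"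
    unfolding \<epsilon>_def by (rule Min_le[OF fin]; simp)+
  have near: "cmod (g \<rho> z - of_real \<rho>) \<le> d / 3" and Hg: "?H (g \<rho> z) z = 0" if "\<rho> \<in> R"
      "z \<in> ball 0 \<epsilon>" for \<rho> z
  proof -
    have "z \<in> ball 0 (E \<rho>)" using le(4)[OF that(1)] that(2) by simp
    then have gz: "g \<rho> z \<in> cball (of_real \<rho>) (s \<rho>)" "?H (g \<rho> z) z = 0" and "s \<rho> \<le> d / 3"
      using good[OF that(1)] unfolding good_def by blast+
    then show "cmod (g \<rho> z - of_real \<rho>) \<le> d / 3" "?H (g \<rho> z) z = 0"
      by (simp_all add: dist_norm norm_minus_commute)
  qed
  have sep: "d \<le> cmod (of_real x - of_real y)" if "x \<in> R" "y \<in> R" "x \<noteq> y" for x y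
    using d(2)[OF that] by (metis norm_of_real of_real_diff)
  have inj: "\<rho> = \<rho>'" if "\<rho> \<in> R" "\<rho>' \<in> R" "z \<in> ball 0 \<epsilon>" "cmod (w - of_real \<rho>) \<le> d / 3"
     "cmod (w - of_real \<rho>') \<le> d / 3" for \<rho> \<rho>' w and z :: complex
  proof (rule ccontr)
    assume "\<rho> \<noteq> \<rho>'"
    then have "d \<le> cmod (of_real \<rho> - of_real \<rho>')" using sep that by blast
    also have "\<dots> \<le> cmod (w - of_real \<rho>) + cmod (w - of_real \<rho>')"
      using norm_triangle_ineq4[of "w - of_real \<rho>'" "w - of_real \<rho>"] by simp
    finally show False using that d(1) by linarith
  qed
  have complete: "\<exists>\<rho>\<in>R. \<mu> = g \<rho> z" if z: "z \<in> ball 0 \<epsilon>" and zm: "cmod (z * \<mu>) < \<epsilon>" and H: "?H \<mu> z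
      = 0" for \<mu> z
  proof -
    have "cmod (z * \<mu>) < ea" "z \<in> ball 0 ek" using z zm le(1,2) by auto
    then have "cmod \<mu> < M" "\<mu> \<notin> K" using M[OF _ H] ek(2)[of \<mu> z] H by blast+
    then obtain \<rho> where \<rho>: "\<rho> \<in> R" "\<mu> \<in> ball (of_real \<rho>) (s \<rho>)" by (auto simp: K_def)
    then have "\<mu> \<in> cball (of_real \<rho>) (s \<rho>)" "z \<in> ball 0 (E \<rho>)" using z le(4)[OF \<rho>(1)] by auto
    then have "\<mu> = g \<rho> z" using good[OF \<rho>(1)] H unfolding good_def by blast
    with \<rho>(1) show ?thesis by blast
  qed
  show ?thesis
  proof (rule that[of \<epsilon> g])
    show "g \<rho> holomorphic_on ball 0 \<epsilon>" if "\<rho> \<in> R" for \<rho>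
      using good[OF that] le(4)[OF that] holomorphic_on_subset[of "g \<rho>" "ball 0 (E \<rho>)" "ball 0 \<epsilon>"]
      by (simp add: good_def subset_ball)
    show "g \<rho> 0 = of_real \<rho>" "deriv (g \<rho>) 0 = ?slope \<rho>" if "\<rho> \<in> R" for \<rho>
      using good[OF that] by (simp_all add: good_def)
    show "g \<rho> z \<noteq> g \<rho>' z" if "\<rho> \<in> R" "\<rho>' \<in> R" "\<rho> \<noteq> \<rho>'" "z \<in> ball 0 \<epsilon>" for \<rho> \<rho>' z
      using inj[OF that(1,2,4), of "g \<rho> z"] near[OF that(1,4)] near[OF that(2,4)] that(3) by metis
    show "g \<rho> z \<noteq> 0" if "\<rho> \<in> R" "z \<in> ball 0 \<epsilon>" "z \<noteq> 0" for \<rho> z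
    proof (cases "\<rho> = 0")
      case True
      then show ?thesis using e0(2)[of z] that le(3) by simp
    next
      case False
      then show ?thesis using inj[OF that(1) R0 that(2), of "g \<rho> z"] near[OF that(1,2)] d(1) by auto
    qed
    show "g 0 (- z) = - g 0 z" if z: "z \<in> ball 0 \<epsilon>" for z
    proof -
      have mz: "- z \<in> ball 0 \<epsilon>" using z by simp
      have "- g 0 (- z) \<in> cball (of_real 0) (s 0)" "?H (- g 0 (- z)) z = 0"
        using good[OF R0] mz le(4)[OF R0] dispersion_odd[of r \<tau> n "g 0 (- z)" "- z"]
            by (auto simp: good_def)
      then have "- g 0 (- z) = g 0 z"
        using good[OF R0] z le(4)[OF R0] unfolding good_def by (metis mem_ball order_less_le_trans)
      then show ?thesis by (metis minus_minus)
    qed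
  qed (use \<open>0 < \<epsilon>\<close> Hg complete in auto)
qed

section \<open>Continuity relative to the branch of the square root\<close>

text \<open>The values of \<open>usqrt\<close> at nonzero arguments.\<close>

definition upper_half :: "complex set" where
  "upper_half = {z. 0 < Im z \<or> Im z = 0 \<and> 0 < Re z}"

lemma usqrt_sq [simp]: "(usqrt z)\<^sup>2 = z"
  by (simp add: usqrt_def del: csqrt.simps)

lemma norm_usqrt: "cmod (usqrt z) = sqrt (cmod z)"
  by (simp add: usqrt_def del: csqrt.simps)

lemma usqrt_eq_0 [simp]: "usqrt z = 0 \<longleftrightarrow> z = 0"
  by (metis norm_usqrt norm_eq_zero real_sqrt_eq_zero_cancel_iff)

lemma usqrt_0 [simp]: "usqrt 0 = 0"
  by simp

lemma usqrt_upper: "z \<noteq> 0 \<Longrightarrow> usqrt z \<in> upper_half"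
proof -
  assume z: "z \<noteq> 0"
  have c: "0 < Re (csqrt z) \<or> Re (csqrt z) = 0 \<and> 0 \<le> Im (csqrt z)" using csqrt_principal by blast
  show ?thesis
  proof (cases "Im (csqrt z) < 0")
    case True
    then show ?thesis by (simp add: usqrt_def upper_half_def del: csqrt.simps)
  next
    case False
    have "csqrt z \<noteq> 0" using z by simp
    then have "Im (csqrt z) \<noteq> 0 \<or> Re (csqrt z) \<noteq> 0" by (auto simp: complex_eq_iff simp del:
        csqrt.simps)
    then show ?thesis using False c by (auto simp: usqrt_def upper_half_def simp del: csqrt.simps)
  qed
qed

lemma usqrt_unique:
  assumes "w \<in> upper_half" "w\<^sup>2 = z"
  shows "usqrt z = w"
proof -
  have "z \<noteq> 0" using assms by (auto simp: upper_half_def)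
  then have "usqrt z \<in> upper_half" by (rule usqrt_upper)
  moreover have "usqrt z = w \<or> usqrt z = - w" using assms(2) by (metis power2_eq_iff usqrt_sq)
  ultimately show ?thesis using assms(1) by (auto simp: upper_half_def)
qed

lemma usqrt_scale: "0 \<le> c \<Longrightarrow> usqrt (of_real (c\<^sup>2) * z) = of_real c * usqrt z"
proof (cases "c = 0 \<or> z = 0")
  case False
  assume "0 \<le> c"
  with False have "of_real c * usqrt z \<in> upper_half"
    using usqrt_upper[of z] by (auto simp: upper_half_def zero_less_mult_iff)
  then show ?thesis by (rule usqrt_unique) (simp add: power_mult_distrib)
qed auto

lemma convex_upper_half: "convex upper_half"
proof (rule convexI)
  fix x y and u v :: real
  assume x: "x \<in> upper_half" and y: "y \<in> upper_half" and uv: "0 \<le> u" "0 \<le> v" "u + v = 1"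
  show "u *\<^sub>R x + v *\<^sub>R y \<in> upper_half"
  proof (cases "u = 0 \<or> v = 0")
    case True
    then show ?thesis using x y uv by auto
  next
    case False
    then have uv: "0 < u" "0 < v" using uv by auto
    have im: "0 \<le> Im x" "0 \<le> Im y" using x y by (auto simp: upper_half_def)
    show ?thesis
    proof (cases "Im x = 0 \<and> Im y = 0")
      case True
      then show ?thesis using x y uv by (auto simp: upper_half_def intro!: add_pos_pos)
    next
      case False
      then have "0 < u * Im x + v * Im y"
        using im uv by (metis add_nonneg_pos add_pos_nonneg less_eq_real_def mult_nonneg_nonneg
            mult_pos_pos)
      then show ?thesis by (simp add: upper_half_def)
    qed
  qed
qed

text \<open>Off the cut \<open>usqrt z = \<i> csqrt (- z)\<close>. On the closed upper half plane the cut of \<open>csqrt\<close> is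
  avoided by turning through a quarter.\<close>

lemma continuous_usqrt:
  "continuous_on (UNIV - \<real>\<^sub>\<ge>\<^sub>0) usqrt" "continuous_on {z. z \<noteq> 0 \<and> 0 \<le> Im z} usqrt"
proof -
  have 1: "usqrt z = \<i> * csqrt (- z)" if "z \<in> UNIV - \<real>\<^sub>\<ge>\<^sub>0" for z
  proof (rule usqrt_unique)
    have "- z \<notin> \<real>\<^sub>\<le>\<^sub>0" using that by (auto simp: complex_nonpos_Reals_iff complex_nonneg_Reals_iff)
    moreover have "- z \<in> \<real>\<^sub>\<le>\<^sub>0" if "Re (csqrt (- z)) = 0"
    proof -
      have "(csqrt (- z))\<^sup>2 = - z" by (rule power2_csqrt)
      then show ?thesis using that
        by (metis complex_nonpos_Reals_iff Im_power2 Re_power2 diff_0 mult_zero_left mult_zero_right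
            neg_le_0_iff_le zero_eq_power2 zero_le_power2)
    qed
    ultimately have "0 < Re (csqrt (- z))" using csqrt_principal by blast
    then show "\<i> * csqrt (- z) \<in> upper_half" by (simp add: upper_half_def del: csqrt.simps)
  qed (simp add: power_mult_distrib)
  have cs: "continuous_on (UNIV - \<real>\<^sub>\<le>\<^sub>0) csqrt"
    by (intro continuous_at_imp_continuous_on ballI continuous_at_csqrt) auto
  have "continuous_on (UNIV - \<real>\<^sub>\<ge>\<^sub>0) (\<lambda>z. csqrt (- z))"
    by (rule continuous_on_compose2[OF cs], intro continuous_intros)
       (auto simp: complex_nonpos_Reals_iff complex_nonneg_Reals_iff)
  then have "continuous_on (UNIV - \<real>\<^sub>\<ge>\<^sub>0) (\<lambda>z. \<i> * csqrt (- z))"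
    by (rule continuous_on_mult_left)
  then show "continuous_on (UNIV - \<real>\<^sub>\<ge>\<^sub>0) usqrt"
    by (rule continuous_on_eq) (simp add: 1)
  define c where "c = csqrt \<i>"
  have c2: "c\<^sup>2 = \<i>" unfolding c_def by (rule power2_csqrt)
  have cc: "0 < Re c" "Re c = Im c"
    by (simp_all add: c_def)
  have 2: "usqrt z = c * csqrt (- \<i> * z)" if "z \<in> {z. z \<noteq> 0 \<and> 0 \<le> Im z}" for z
  proof (rule usqrt_unique)
    define w where "w = csqrt (- \<i> * z)"
    have w2: "w\<^sup>2 = - \<i> * z" by (simp add: w_def del: csqrt.simps)
    have "0 \<le> Re (w\<^sup>2)" using that unfolding w2 by simp
    then have "(Im w)\<^sup>2 \<le> (Re w)\<^sup>2" by (simp add: power2_eq_square)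
    then have "\<bar>Im w\<bar> \<le> \<bar>Re w\<bar>" by (simp add: abs_le_square_iff)
    moreover have "0 \<le> Re w" unfolding w_def using csqrt_principal[of "- \<i> * z"] by auto
    moreover have "w \<noteq> 0" using that w2 by auto
    ultimately have "0 < Re w" "- Im w \<le> Re w" "Im w \<le> Re w"
      by (auto simp: complex_eq_iff abs_le_iff)
    then have "0 \<le> Re w + Im w" "Re w + Im w = 0 \<Longrightarrow> 0 < Re w - Im w" by auto
    then have "0 < Im c * (Re w + Im w) \<or> Im c * (Re w + Im w) = 0 \<and> 0 < Im c * (Re w - Im w)"
      using cc by (cases "Re w + Im w = 0") auto
    then have "c * w \<in> upper_half" using cc by (simp add: upper_half_def algebra_simps)
    then show "c * csqrt (- \<i> * z) \<in> upper_half" by (simp add: w_def)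
    have "\<i> * (- \<i> * z) = z" by (simp add: mult.assoc[symmetric])
    then show "(c * csqrt (- \<i> * z))\<^sup>2 = z" by (simp only: power_mult_distrib c2 power2_csqrt)
  qed
  have "continuous_on {z. z \<noteq> 0 \<and> 0 \<le> Im z} (\<lambda>z. csqrt (- \<i> * z))"
    by (rule continuous_on_compose2[OF cs], intro continuous_intros)
       (auto simp: complex_nonpos_Reals_iff complex_eq_iff)
  then have "continuous_on {z. z \<noteq> 0 \<and> 0 \<le> Im z} (\<lambda>z. c * csqrt (- \<i> * z))"
    by (rule continuous_on_mult_left)
  then show "continuous_on {z. z \<noteq> 0 \<and> 0 \<le> Im z} usqrt"
    by (rule continuous_on_eq) (simp only: 2)
qed

lemma usqrt_ball: "z \<in> ball 0 (\<epsilon>\<^sup>2) \<Longrightarrow> 0 < \<epsilon> \<Longrightarrow> usqrt z \<in> ball 0 \<epsilon>"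
  using real_sqrt_less_mono[of "cmod z" "\<epsilon>\<^sup>2"] by (simp add: norm_usqrt)

lemma filterlim_usqrt: "filterlim usqrt (at 0) (at 0)"
proof -
  have "((\<lambda>z. sqrt (cmod z)) \<longlongrightarrow> sqrt (cmod 0)) (at (0::complex))" by (intro tendsto_intros)
  then have "((\<lambda>z. cmod (usqrt z)) \<longlongrightarrow> 0) (at 0)" by (simp add: norm_usqrt)
  then have "(usqrt \<longlongrightarrow> 0) (at 0)" by (rule tendsto_norm_zero_cancel)
  then show ?thesis by (auto simp: filterlim_at eventually_at_filter)
qed

lemma branch_continuous_usqrt:
  assumes "continuous_on (ball 0 \<epsilon>) G" "0 < \<epsilon>"
  shows "branch_continuous_on (ball 0 (\<epsilon>\<^sup>2) - {0}) (\<lambda>z. G (usqrt z))"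
  unfolding branch_continuous_on_def
  by (intro conjI continuous_on_compose2[OF assms(1)] continuous_on_subset[OF continuous_usqrt(1)]
      continuous_on_subset[OF continuous_usqrt(2)])
     (use usqrt_ball[OF _ assms(2)] in auto)

text \<open>On \<open>upper_half\<close>, \<open>z \<mapsto> z\<^sup>2\<close> is a bijection onto the punctured plane with inverse \<open>usqrt\<close>, and
  the two conditions of branch continuity become continuity near the points with \<open>Im z > 0\<close> and
  near the positive real axis.\<close>

lemma branch_continuous_pullback:
  assumes "branch_continuous_on (ball 0 (\<epsilon>\<^sup>2) - {0}) f" "0 < \<epsilon>"
  shows "continuous_on (upper_half \<inter> ball 0 \<epsilon>) (\<lambda>z. f (z\<^sup>2))"
proof -
  let ?B = "ball 0 (\<epsilon>\<^sup>2) - {0::complex}"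
  have f: "continuous_on (?B - \<real>\<^sub>\<ge>\<^sub>0) f" "continuous_on {z \<in> ?B. 0 \<le> Im z} f"
    using assms(1) by (auto simp: branch_continuous_on_def)
  have sq: "z\<^sup>2 \<in> ?B" if "z \<noteq> 0" "z \<in> ball 0 \<epsilon>" for z
    using that assms(2) by (simp add: norm_power power_strict_mono)
  define S1 where "S1 = {z. 0 < Im z} \<inter> ball 0 \<epsilon>"
  define S2 where "S2 = {z. 0 < Re z \<and> 0 \<le> Im z} \<inter> ball 0 \<epsilon>"
  have c1: "continuous_on S1 (\<lambda>z. f (z\<^sup>2))"
  proof (rule continuous_on_compose2[OF f(1)])
    show "(\<lambda>z. z\<^sup>2) ` S1 \<subseteq> ?B - \<real>\<^sub>\<ge>\<^sub>0"
    proof (intro image_subsetI DiffI)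
      fix z assume z: "z \<in> S1"
      then have "z \<noteq> 0" "z \<in> ball 0 \<epsilon>" by (auto simp: S1_def)
      then show "z\<^sup>2 \<in> ball 0 (\<epsilon>\<^sup>2)" "z\<^sup>2 \<notin> {0}" using sq[of z] by auto
      show "z\<^sup>2 \<notin> \<real>\<^sub>\<ge>\<^sub>0"
      proof
        assume "z\<^sup>2 \<in> \<real>\<^sub>\<ge>\<^sub>0"
        then have "Re z * Im z = 0" "0 \<le> (Re z)\<^sup>2 - (Im z)\<^sup>2"
          by (auto simp: complex_nonneg_Reals_iff power2_eq_square)
        moreover have "0 < Im z" using z by (simp add: S1_def)
        ultimately show False by (auto simp: not_le[symmetric])
      qed
    qed
  qed (intro continuous_intros)
  have c2: "continuous_on S2 (\<lambda>z. f (z\<^sup>2))"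
  proof (rule continuous_on_compose2[OF f(2)])
    show "(\<lambda>z. z\<^sup>2) ` S2 \<subseteq> {z \<in> ?B. 0 \<le> Im z}"
    proof (rule image_subsetI)
      fix z assume z: "z \<in> S2"
      then have "z \<noteq> 0" "z \<in> ball 0 \<epsilon>" by (auto simp: S2_def)
      moreover have "0 \<le> Im (z\<^sup>2)" using z by (simp add: S2_def Im_power2)
      ultimately show "z\<^sup>2 \<in> {z \<in> ?B. 0 \<le> Im z}" using sq[of z] by auto
    qed
  qed (intro continuous_intros)
  let ?S = "upper_half \<inter> ball 0 \<epsilon>"
  show ?thesis
    unfolding continuous_on_eq_continuous_within
  proof
    fix z assume z: "z \<in> ?S"
    show "continuous (at z within ?S) (\<lambda>z. f (z\<^sup>2))"
    proof (cases "0 < Im z")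
      case True
      then have "at z within ?S = at z within S1"
        by (intro at_within_nhd[of z "{z. 0 < Im z}"])
           (auto simp: S1_def upper_half_def open_halfspace_Im_gt)
      moreover have "z \<in> S1" using True z by (simp add: S1_def)
      ultimately show ?thesis using c1 by (simp add: continuous_on_eq_continuous_within)
    next
      case False
      then have "at z within ?S = at z within S2" "z \<in> S2"
        using z by (intro at_within_nhd[of z "{z. 0 < Re z}"],
           auto simp: S2_def upper_half_def open_halfspace_Re_gt)
      then show ?thesis using c2 by (simp add: continuous_on_eq_continuous_within)
    qed
  qed
qed

text \<open>The sets where \<open>f\<close> agrees with one of the finitely many \<open>g\<close> are closed and disjoint and
  cover \<open>S\<close>.\<close>

lemma connected_choice:
  fixes f :: "'a::topological_space \<Rightarrow> 'b::real_normed_vector"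
  assumes S: "connected S" "S \<noteq> {}" and G: "finite G" and f: "continuous_on S f"
    and g: "\<And>g. g \<in> G \<Longrightarrow> continuous_on S g"
    and val: "\<And>x. x \<in> S \<Longrightarrow> \<exists>g\<in>G. f x = g x"
    and dist: "\<And>x g h. x \<in> S \<Longrightarrow> g \<in> G \<Longrightarrow> h \<in> G \<Longrightarrow> g \<noteq> h \<Longrightarrow> g x \<noteq> h x"
  shows "\<exists>g\<in>G. \<forall>x\<in>S. f x = g x"
proof -
  obtain x0 g0 where x0: "x0 \<in> S" "g0 \<in> G" "f x0 = g0 x0" using S(2) val by blast
  define A where "A h = {x \<in> S. f x = h x}" for h
  have cl: "closedin (top_of_set S) (A h)" if "h \<in> G" for h
  proof -
    have "continuous_on S (\<lambda>x. f x - h x)" by (intro continuous_on_diff f g that)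
    from continuous_closedin_preimage_constant[OF this, of 0] show ?thesis by (simp add: A_def)
  qed
  have "closedin (top_of_set S) (\<Union>h\<in>G - {g0}. A h)"
    using cl G by (intro closedin_Union) auto
  moreover have "closedin (top_of_set S) (A g0)" using cl x0 by blast
  moreover have "S \<subseteq> A g0 \<union> (\<Union>h\<in>G - {g0}. A h)" using val by (fastforce simp: A_def)
  moreover have "A g0 \<inter> (\<Union>h\<in>G - {g0}. A h) = {}" using dist x0 by (fastforce simp: A_def)
  moreover have "A g0 \<noteq> {}" using x0 by (auto simp: A_def)
  ultimately have "(\<Union>h\<in>G - {g0}. A h) = {}" using S(1) unfolding connected_closedin by blast
  then have "\<forall>x\<in>S. f x = g0 x" using \<open>S \<subseteq> _\<close> by (auto simp: A_def)
  then show ?thesis using x0 by blast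
qed

section \<open>Eigenvectors of the capacitance matrix\<close>

context scattering_chain
begin

text \<open>Amplitude and flux \<open>\<mu> x\<close> of the limiting problem at the left end of the resonator \<open>i\<close>,
  numbered from 0. Across a resonator the amplitude does not change, and across a gap the flux
  does not.\<close>

definition amp :: "complex \<Rightarrow> nat \<Rightarrow> complex" where
  "amp \<mu> i = fst (scaled_wave r piece \<mu> 0 (2 * i))"

definition flux :: "complex \<Rightarrow> nat \<Rightarrow> complex" where
  "flux \<mu> i = \<mu> * snd (scaled_wave r piece \<mu> 0 (2 * i))"

lemma amp_0: "amp \<mu> 0 = 1" and flux_0: "flux \<mu> 0 = 0"
  by (simp_all add: amp_def flux_def)

lemma flux_Suc: "flux \<mu> (Suc i) = flux \<mu> i - (of_real r * \<mu>)\<^sup>2 * of_real (piece (2 * i)) * amp \<mu> i"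
proof -
  have "2 * Suc i = Suc (Suc (2 * i))" by simp
  then show ?thesis unfolding flux_def amp_def
    by (simp only: limit_wave_Suc) (simp add: algebra_simps power2_eq_square)
qed

lemma amp_Suc: "amp \<mu> (Suc i) = amp \<mu> i + of_real (piece (Suc (2 * i))) * flux \<mu> (Suc i)"
proof -
  have "2 * Suc i = Suc (Suc (2 * i))" by simp
  then show ?thesis unfolding flux_def amp_def
    by (simp only: limit_wave_Suc) (simp add: algebra_simps)
qed

lemma scaled_wave_last: "fst (scaled_wave r piece \<mu> 0 last_brk) = amp \<mu> (N - 1)"
  "\<mu> * snd (scaled_wave r piece \<mu> 0 last_brk) = flux \<mu> N"
proof -
  show "fst (scaled_wave r piece \<mu> 0 last_brk) = amp \<mu> (N - 1)"
    unfolding last_brk(2) amp_def by (simp del: scaled_wave.simps(2) add: limit_wave_Suc)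
  have N': "2 * N = Suc last_brk" using last_brk(2) N by simp
  show "\<mu> * snd (scaled_wave r piece \<mu> 0 last_brk) = flux \<mu> N"
    unfolding flux_def N' using last_brk(1) by (simp del: scaled_wave.simps(2) add: limit_wave_Suc)
qed

text \<open>The difference quotient of \<open>a\<close> across the gap on the left of resonator \<open>i\<close>. It is 0 to the
  left of the first and to the right of the last resonator, which encodes the first and the last
  row of the matrix.\<close>

definition grad :: "(nat \<Rightarrow> 'a) \<Rightarrow> nat \<Rightarrow> 'a::real_field" where
  "grad a i = (if i = 0 \<or> i = N then 0 else (a i - a (i - 1)) / of_real (piece (2 * i - 1)))"

lemma theta_pieces:
  assumes "i < N"
  shows "i \<noteq> 0 \<Longrightarrow> cap_theta xm xp r (2 * i) = 1 / (piece (2 * i - 1) * (r * piece (2 * i)))"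
    and "cap_theta xm xp r (Suc (2 * i)) = 1 / (piece (Suc (2 * i)) * (r * piece (2 * i)))"
proof -
  have e: "cap_t xm xp r (Suc (2 * i)) = r * piece (2 * i)" for i
    by (simp add: cap_t_def piece_even)
  have o: "cap_t xm xp r (2 * i) = piece (2 * i - 1)" if "i \<noteq> 0" for i
    using that piece_odd[of "i - 1"] by (cases i) (simp_all add: cap_t_def)
  show "i \<noteq> 0 \<Longrightarrow> cap_theta xm xp r (2 * i) = 1 / (piece (2 * i - 1) * (r * piece (2 * i)))"
    by (simp add: cap_theta_def e o)
  show "cap_theta xm xp r (Suc (2 * i)) = 1 / (piece (Suc (2 * i)) * (r * piece (2 * i)))"
    using o[of "Suc i"] e[of i] by (simp add: cap_theta_def mult.commute)
qed

lemma capacitance_row: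
  assumes i: "i < N"
  shows "(\<Sum>j<N. capacitance_matrix N xm xp r $$ (i, j) * a j) * (r * piece (2 * i)) =
     grad a i - grad a (Suc i)"
proof -
  let ?\<theta> = "cap_theta xm xp r"
  let ?D = "(if i = 0 then 0 else ?\<theta> (2 * i)) + (if Suc i = N then 0 else ?\<theta> (Suc (2 * i)))"
  have "capacitance_matrix N xm xp r $$ (i, j) * a j =
      (if j = i then ?D * a i else 0) + (if j = Suc i then - ?\<theta> (Suc (2 * i)) * a (Suc i) else 0)
      + (if j = i - 1 then (if i = 0 then 0 else - ?\<theta> (2 * i) * a (i - 1)) else 0)" if "j < N" for j
    using that i by (auto simp: capacitance_matrix_def Let_def)
  then have "(\<Sum>j<N. capacitance_matrix N xm xp r $$ (i, j) * a j) =
     (\<Sum>j<N. (if j = i then ?D * a i else 0) + (if j = Suc i then - ?\<theta> (Suc (2 * i)) * a (Suc i)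
         else 0)
      + (if j = i - 1 then (if i = 0 then 0 else - ?\<theta> (2 * i) * a (i - 1)) else 0))"
    by (intro sum.cong) auto
  also have "\<dots> = ?D * a i + (if Suc i < N then - ?\<theta> (Suc (2 * i)) * a (Suc i) else 0)
      + (if i = 0 then 0 else - ?\<theta> (2 * i) * a (i - 1))"
    unfolding sum.distrib sum.delta[OF finite_lessThan] using i by auto
  also have "\<dots> = (if i = 0 then 0 else ?\<theta> (2 * i) * (a i - a (i - 1)))
      - (if Suc i = N then 0 else ?\<theta> (Suc (2 * i)) * (a (Suc i) - a i))"
    using i by (auto simp: algebra_simps)
  finally have eq: "(\<Sum>j<N. capacitance_matrix N xm xp r $$ (i, j) * a j) = \<dots>" .
  have p: "0 < piece (2 * i)" using i last_brk(2) by (intro piece_pos) auto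
  have "r * piece (2 * i) \<noteq> 0" using p r_pos by simp
  then have 1: "?\<theta> (2 * i) * x * (r * piece (2 * i)) = x / piece (2 * i - 1)" if "i \<noteq> 0" for x
    unfolding theta_pieces(1)[OF i that] by simp
  have 2: "?\<theta> (Suc (2 * i)) * x * (r * piece (2 * i)) = x / piece (Suc (2 * i))" for x
    unfolding theta_pieces(2)[OF i] using \<open>r * piece (2 * i) \<noteq> 0\<close> by simp
  show ?thesis unfolding eq left_diff_distrib using i by (simp add: grad_def 1 2)
qed

lemma eigenvector_rows:
  "eigenvector (capacitance_matrix N xm xp r) a lm \<longleftrightarrow>
     a \<in> carrier_vec N \<and> a \<noteq> 0\<^sub>v N \<and>
     (\<forall>i<N. grad (vec_index a) i - grad (vec_index a) (Suc i) =
         lm * r * piece (2 * i) * vec_index a i)"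
proof -
  let ?C = "capacitance_matrix N xm xp r"
  have C: "?C \<in> carrier_mat N N" by (simp add: capacitance_matrix_def)
  have "?C *\<^sub>v a = lm \<cdot>\<^sub>v a \<longleftrightarrow>
      (\<forall>i<N. grad (vec_index a) i - grad (vec_index a) (Suc i) =
          lm * r * piece (2 * i) * vec_index a i)"
    if a: "a \<in> carrier_vec N"
  proof -
    have "?C *\<^sub>v a = lm \<cdot>\<^sub>v a \<longleftrightarrow> (\<forall>i<N. vec_index (?C *\<^sub>v a) i = vec_index (lm \<cdot>\<^sub>v a) i)"
    proof
      assume "\<forall>i<N. vec_index (?C *\<^sub>v a) i = vec_index (lm \<cdot>\<^sub>v a) i"
      then show "?C *\<^sub>v a = lm \<cdot>\<^sub>v a" using a C by (intro eq_vecI) auto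
    qed metis
    also have "\<dots> \<longleftrightarrow> (\<forall>i<N. (\<Sum>j<N. ?C $$ (i, j) * vec_index a j) = lm * vec_index a i)"
      using a C by (auto simp: scalar_prod_def lessThan_atLeast0)
    also have "\<dots> \<longleftrightarrow> (\<forall>i<N. grad (vec_index a) i - grad (vec_index a) (Suc i) =
        lm * r * piece (2 * i) * vec_index a i)"
    proof (intro all_cong)
      fix i assume i: "i < N"
      have "0 < piece (2 * i)" using i last_brk(2) by (intro piece_pos) auto
      then have "r * piece (2 * i) \<noteq> 0" using r_pos by simp
      then have eq: "(\<Sum>j<N. ?C $$ (i, j) * vec_index a j) = lm * vec_index a i \<longleftrightarrow>
         (\<Sum>j<N. ?C $$ (i, j) * vec_index a j) * (r * piece (2 * i)) =
             lm * vec_index a i * (r * piece (2 * i))"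
        by (rule mult_right_cancel[symmetric])
      have q: "lm * vec_index a i * (r * piece (2 * i)) = lm * r * piece (2 * i) * vec_index a i"
        by simp
      show "(\<Sum>j<N. ?C $$ (i, j) * vec_index a j) = lm * vec_index a i \<longleftrightarrow>
         grad (vec_index a) i - grad (vec_index a) (Suc i) = lm * r * piece (2 * i) * vec_index a i"
        using eq unfolding capacitance_row[OF i] q .
    qed
    finally show ?thesis .
  qed
  then show ?thesis using C unfolding eigenvector_def by auto
qed

text \<open>The row equations determine \<open>a\<close> recursively from its first entry; they are the recursion for
  \<open>amp\<close> and \<open>flux\<close>.\<close>

lemma eigenvector_amp:
  assumes ev: "eigenvector (capacitance_matrix N xm xp r) a lm" and \<mu>: "of_real lm =
      of_real r * \<mu>\<^sup>2"
  shows "i < N \<Longrightarrow> of_real (vec_index a i) = of_real (vec_index a 0) * amp \<mu> i"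
    and "vec_index a 0 \<noteq> 0" and "flux \<mu> N = 0"
proof -
  let ?a = "vec_index a"
  have a: "a \<in> carrier_vec N" "a \<noteq> 0\<^sub>v N"
    and rows: "\<And>i. i < N \<Longrightarrow> grad ?a i - grad ?a (Suc i) = lm * r * piece (2 * i) * ?a i"
    using ev unfolding eigenvector_rows by auto
  have step: "i < N \<longrightarrow> of_real (?a i) = of_real (?a 0) * amp \<mu> i \<and>
      of_real (- grad ?a i) = - of_real (?a 0) * flux \<mu> i" for i
  proof (induction i)
    case 0
    show ?case by (simp add: amp_0 flux_0 grad_def)
  next
    case (Suc i)
    show ?case
    proof
      assume Si: "Suc i < N"
      then have IH: "of_real (?a i) = of_real (?a 0) * amp \<mu> i"
        "of_real (- grad ?a i) = - of_real (?a 0) * flux \<mu> i" using Suc by auto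
      have "of_real (grad ?a (Suc i)) = (of_real (grad ?a i) - of_real (lm * r * piece (2 * i) *
          ?a i) :: complex)"
        using rows[of i] Si by (metis Suc_lessD diff_diff_eq2 add_diff_cancel_left' of_real_diff)
      also have "\<dots> = of_real (?a 0) * flux \<mu> (Suc i)"
        using IH unfolding flux_Suc of_real_mult \<mu> by (simp add: algebra_simps power2_eq_square)
      finally have g: "of_real (grad ?a (Suc i)) = of_real (?a 0) * flux \<mu> (Suc i)" .
      have "0 < piece (Suc (2 * i))" using Si last_brk(2) by (intro piece_pos) auto
      then have "?a (Suc i) = ?a i + piece (Suc (2 * i)) * grad ?a (Suc i)"
        using Si by (simp add: grad_def)
      then have "of_real (?a (Suc i)) = (of_real (?a i) + of_real (piece (Suc (2 * i))) * of_real
          (grad ?a (Suc i)) :: complex)"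
        by (metis of_real_add of_real_mult)
      also have "\<dots> = of_real (?a 0) * amp \<mu> (Suc i)"
        unfolding IH g amp_Suc by (simp add: algebra_simps)
      finally show "of_real (?a (Suc i)) = of_real (?a 0) * amp \<mu> (Suc i) \<and>
        of_real (- grad ?a (Suc i)) = - of_real (?a 0) * flux \<mu> (Suc i)" using g by simp
    qed
  qed
  show amp: "of_real (?a i) = of_real (?a 0) * amp \<mu> i" if "i < N" for i using step that by blast
  show a0: "?a 0 \<noteq> 0"
  proof
    assume "?a 0 = 0"
    then have "?a i = 0" if "i < N" for i using amp[OF that] by simp
    then have "a = 0\<^sub>v N" using a(1) by (intro eq_vecI) auto
    then show False using a(2) by simp
  qed
  have N': "N = Suc (N - 1)" "N - 1 < N" using N by auto
  have "grad ?a (Suc (N - 1)) = 0" using N by (simp add: grad_def)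
  then have "of_real (grad ?a (N - 1)) = (of_real (lm * r * piece (2 * (N - 1)) * ?a (N - 1)) ::
      complex)"
    using rows[OF N'(2)] by simp
  moreover have "of_real (grad ?a (N - 1)) = of_real (?a 0) * flux \<mu> (N - 1)"
    using step[of "N - 1"] N'(2) by simp
  moreover have "of_real (?a 0) * flux \<mu> N = of_real (?a 0) * flux \<mu> (N - 1)
      - of_real r * \<mu>\<^sup>2 * of_real r * of_real (piece (2 * (N - 1))) * (of_real (?a 0) * amp \<mu> (N -
          1))"
    unfolding arg_cong[OF N'(1), of "flux \<mu>"] flux_Suc
    by (simp add: algebra_simps power2_eq_square)
  ultimately have "of_real (?a 0) * flux \<mu> N = 0"
    unfolding amp[OF N'(2), symmetric] \<mu>[symmetric] by simp
  then show "flux \<mu> N = 0" using a0 by simp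
qed

lemma amp_eigenvector:
  assumes root: "\<rho> \<in> roots0 r piece last_brk"
  shows "eigenvector (capacitance_matrix N xm xp r) (vec N (\<lambda>i. Re (amp (of_real \<rho>) i))) (r * \<rho>\<^sup>2)"
proof -
  let ?\<mu> = "of_real \<rho> :: complex"
  define b y where "b i = Re (amp ?\<mu> i)" and "y i = Re (flux ?\<mu> i)" for i
  have b: "amp ?\<mu> i = of_real (b i)" for i
    using limit_wave_real[of r piece \<rho> "2 * i"] by (simp add: amp_def b_def)
  have y: "flux ?\<mu> i = of_real (y i)" for i
    using limit_wave_real[of r piece \<rho> "2 * i"] by (simp add: flux_def y_def)
  have "of_real (y (Suc i)) = (of_real (y i - (r * \<rho>)\<^sup>2 * piece (2 * i) * b i) :: complex)" for i
    using flux_Suc[of ?\<mu> i] unfolding b y by simp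
  then have yS: "y (Suc i) = y i - (r * \<rho>)\<^sup>2 * piece (2 * i) * b i" for i
    unfolding of_real_eq_iff .
  have "of_real (b (Suc i)) = (of_real (b i + piece (Suc (2 * i)) * y (Suc i)) :: complex)" for i
    using amp_Suc[of ?\<mu> i] unfolding b y by simp
  then have bS: "b (Suc i) = b i + piece (Suc (2 * i)) * y (Suc i)" for i
    unfolding of_real_eq_iff .
  have y0: "y 0 = 0" by (simp add: y_def flux_0)
  have yN: "y N = 0" using root scaled_wave_last(2)[of ?\<mu>] by (simp add: y_def roots0_def)
  let ?v = "vec N b"
  have grad: "grad (vec_index ?v) i = y i" if i: "i \<le> N" for i
  proof (cases "i = 0 \<or> i = N")
    case True
    then show ?thesis using y0 yN by (auto simp: grad_def)
  next
    case False
    then obtain j where j: "i = Suc j" by (cases i) auto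
    have "0 < piece (Suc (2 * j))" using False i j last_brk(2) by (intro piece_pos) auto
    then show ?thesis using False i j bS[of j] by (simp add: grad_def)
  qed
  have "vec_index ?v 0 = 1" using N amp_0 by (simp add: b_def)
  then have "?v \<noteq> 0\<^sub>v N" using N by (metis One_nat_def Suc_le_eq index_zero_vec(1) zero_neq_one)
  moreover have "grad (vec_index ?v) i - grad (vec_index ?v) (Suc i) =
      r * \<rho>\<^sup>2 * r * piece (2 * i) * vec_index ?v i"
    if "i < N" for i
    using that grad[of i] grad[of "Suc i"] yS[of i] by (simp add: power2_eq_square mult_ac)
  ultimately have "eigenvector (capacitance_matrix N xm xp r) ?v (r * \<rho>\<^sup>2)"
    unfolding eigenvector_rows by auto
  then show ?thesis by (simp add: b_def[abs_def])
qed

lemma zero_flux_root: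
  assumes "flux \<mu> N = 0"
  obtains \<rho> where "\<rho> \<in> roots0 r piece last_brk" "\<mu> = of_real \<rho>"
proof (cases "\<mu> = 0")
  case True
  then show ?thesis using that[of 0] roots0_0 by simp
next
  case False
  then have x0: "snd (scaled_wave r piece \<mu> 0 last_brk) = 0" using assms scaled_wave_last(2)[of \<mu>]
      by simp
  have "0 < last_brk" using last_brk(2) by simp
  then have "\<mu> \<in> \<real>" using roots_real[of last_brk piece r \<mu>] piece_pos r_pos x0 by blast
  then obtain \<rho> where "\<mu> = of_real \<rho>" by (auto elim: Reals_cases)
  then show ?thesis using that[of \<rho>] x0 by (simp add: roots0_def)
qed

lemma eigenvalues_roots:
  "{x. eigenvalue (capacitance_matrix N xm xp r) x} = (\<lambda>\<rho>. r * \<rho>\<^sup>2) ` roots0 r piece last_brk"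
proof (intro equalityI subsetI)
  fix x assume "x \<in> {x. eigenvalue (capacitance_matrix N xm xp r) x}"
  then obtain a where ev: "eigenvector (capacitance_matrix N xm xp r) a x" by (auto simp:
      eigenvalue_def)
  define \<mu> where "\<mu> = csqrt (of_real (x / r))"
  have "\<mu>\<^sup>2 = of_real (x / r)" unfolding \<mu>_def by (rule power2_csqrt)
  then have \<mu>: "of_real x = of_real r * \<mu>\<^sup>2" using r_pos by simp
  obtain \<rho> where \<rho>: "\<rho> \<in> roots0 r piece last_brk" "\<mu> = of_real \<rho>"
    using zero_flux_root[OF eigenvector_amp(3)[OF ev \<mu>]] by metis
  have "of_real x = (of_real (r * \<rho>\<^sup>2) :: complex)" using \<mu> \<rho>(2) by simp
  then have "x = r * \<rho>\<^sup>2" unfolding of_real_eq_iff .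
  then show "x \<in> (\<lambda>\<rho>. r * \<rho>\<^sup>2) ` roots0 r piece last_brk" using \<rho>(1) by blast
next
  fix x assume "x \<in> (\<lambda>\<rho>. r * \<rho>\<^sup>2) ` roots0 r piece last_brk"
  then show "x \<in> {x. eigenvalue (capacitance_matrix N xm xp r) x}"
    using amp_eigenvector by (auto simp: eigenvalue_def)
qed


section \<open>The first order terms\<close>

lemma sum_even_indices:
  fixes f :: "nat \<Rightarrow> 'a::comm_monoid_add"
  shows "(\<Sum>m<Suc (2 * k). if even m then f m else 0) = (\<Sum>i<Suc k. f (2 * i))"
  by (induction k) (simp_all add: add.assoc)

definition mass :: "complex \<Rightarrow> complex" where
  "mass \<mu> = (\<Sum>i<N. of_real (piece (2 * i)) * (amp \<mu> i)\<^sup>2)"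

lemma even_part: "(\<Sum>m<last_brk. if even m then of_real (r\<^sup>2 * piece m) * (fst (scaled_wave r piece
    \<mu> 0 m))\<^sup>2 else 0)
    = of_real (r\<^sup>2) * mass \<mu>"
proof -
  have "N = Suc (N - 1)" using N by simp
  then show ?thesis
    unfolding last_brk(2) sum_even_indices mass_def amp_def
    by (metis (no_types, lifting) of_real_mult mult.assoc sum.cong sum_distrib_left)
qed

text \<open>Summation by parts without conjugation.\<close>

lemma virial:
  "fst (scaled_wave r \<tau> \<mu> 0 n) * snd (scaled_wave r \<tau> \<mu> 0 n) =
     \<mu> * ((\<Sum>m<n. if even m then 0 else of_real (\<tau> m) * (snd (scaled_wave r \<tau> \<mu> 0 m))\<^sup>2)
        - (\<Sum>m<n. if even m then of_real (r\<^sup>2 * \<tau> m) * (fst (scaled_wave r \<tau> \<mu> 0 m))\<^sup>2 else 0))"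
proof (induction n)
  case (Suc n)
  show ?case
    unfolding limit_wave_Suc sum.lessThan_Suc
    using Suc by (cases "even n") (simp_all add: algebra_simps power2_eq_square)
qed simp

text \<open>At a zero \<open>\<mu> \<noteq> 0\<close> the left side of \<open>virial\<close> vanishes, so the two parts of \<open>wronskian_sum\<close>
  are equal; at \<open>\<mu> = 0\<close> the second one vanishes.\<close>

lemma wronskian_mass:
  assumes "\<rho> \<in> roots0 r piece last_brk"
  shows "wronskian_sum r piece last_brk (of_real \<rho>) = (if \<rho> =
      0 then 1 else 2) * of_real (r\<^sup>2) * mass (of_real \<rho>)"
proof -
  let ?u = "\<lambda>m. fst (scaled_wave r piece (of_real \<rho>) 0 m)" and ?x =
      "\<lambda>m. snd (scaled_wave r piece (of_real \<rho>) 0 m)"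
  let ?A = "\<Sum>m<last_brk. if even m then of_real (r\<^sup>2 * piece m) * (?u m)\<^sup>2 else 0"
  let ?B = "\<Sum>m<last_brk. if even m then 0 else of_real (piece m) * (?x m)\<^sup>2"
  have W: "wronskian_sum r piece last_brk (of_real \<rho>) = ?A + ?B"
    unfolding wronskian_sum_def sum.distrib[symmetric] by (intro sum.cong) auto
  have "of_real \<rho> * (?B - ?A) = 0"
    using virial[of piece "of_real \<rho>" last_brk] assms by (simp add: roots0_def)
  moreover have "?B = 0" if "\<rho> = 0" using that by (simp add: limit_wave_at_0 cong: if_cong)
  ultimately have "?B = (if \<rho> = 0 then 0 else ?A)" by auto
  then show ?thesis unfolding W even_part by simp
qed

text \<open>The derivative at \<open>z = 0\<close> of the branch through \<open>\<rho>\<close>.\<close>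

definition slope :: "real \<Rightarrow> complex" where
  "slope \<rho> = - \<i> * (1 + (fst (scaled_wave r piece (of_real \<rho>) 0 last_brk))\<^sup>2) / wronskian_sum r
      piece last_brk (of_real \<rho>)"

lemma slope_0: "of_real v * slope 0 = - 2 * \<i> * of_real (v / (r\<^sup>2 * (\<Sum>j=1..N. res_length xm xp j)))"
proof -
  have "(\<Sum>i<N. piece (2 * i)) = (\<Sum>j=1..N. res_length xm xp j)"
    unfolding piece_even by (rule sum.reindex_bij_witness[of _ "\<lambda>j. j - 1" "\<lambda>i. i + 1"]) auto
  moreover have "mass 0 = of_real (\<Sum>i<N. piece (2 * i))"
    by (simp add: mass_def amp_def limit_wave_at_0)
  ultimately have "wronskian_sum r piece last_brk (of_real 0) =
      of_real (r\<^sup>2 * (\<Sum>j=1..N. res_length xm xp j))"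
    using wronskian_mass[OF roots0_0] by simp
  then show ?thesis unfolding slope_def by (simp add: limit_wave_at_0 del: of_real_mult of_real_sum)
qed

text \<open>An eigenvector is a multiple of the vector of amplitudes, whose first entry is 1 and whose
  last entry is \<open>u\<close> at the right end. The ratio does not depend on the multiple.\<close>

lemma slope_damping:
  assumes ev: "eigenvector (capacitance_matrix N xm xp r) a (r * \<rho>\<^sup>2)"
    and \<rho>: "\<rho> \<in> roots0 r piece last_brk" "\<rho> \<noteq> 0"
  shows "of_real v * slope \<rho> = - \<i> * of_real (v / (2 * r\<^sup>2) * damping_ratio N xm xp a)"
proof -
  let ?\<mu> = "of_real \<rho> :: complex"
  have \<mu>: "of_real (r * \<rho>\<^sup>2) = of_real r * ?\<mu>\<^sup>2" by simp
  note E = eigenvector_amp[OF ev \<mu>]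
  let ?a0 = "of_real (vec_index a 0) :: complex"
  have a0: "?a0 \<noteq> 0" using E(2) by simp
  have "(\<Sum>j=1..N. (vec_index a (j - 1))\<^sup>2 * res_length xm xp j) =
      (\<Sum>i<N. (vec_index a i)\<^sup>2 * piece (2 * i))"
    unfolding piece_even by (rule sum.reindex_bij_witness[of _ "\<lambda>i. i + 1" "\<lambda>j. j - 1"]) auto
  also have "of_real \<dots> = (\<Sum>i<N. (of_real (vec_index a i))\<^sup>2 * of_real (piece (2 * i)) :: complex)"
    by simp
  also have "\<dots> = (\<Sum>i<N. ?a0\<^sup>2 * (of_real (piece (2 * i)) * (amp ?\<mu> i)\<^sup>2))"
  proof (intro sum.cong refl)
    fix i assume "i \<in> {..<N}"
    then have e: "of_real (vec_index a i) = ?a0 * amp ?\<mu> i" using E(1)[of i] by simp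
    show "(of_real (vec_index a i))\<^sup>2 * of_real (piece (2 * i)) =
        ?a0\<^sup>2 * (of_real (piece (2 * i)) * (amp ?\<mu> i)\<^sup>2)"
      unfolding e by (simp add: power_mult_distrib)
  qed
  also have "\<dots> = ?a0\<^sup>2 * mass ?\<mu>" by (simp add: mass_def sum_distrib_left)
  finally have den: "of_real (\<Sum>j=1..N. (vec_index a (j - 1))\<^sup>2 * res_length xm xp j) =
      ?a0\<^sup>2 * mass ?\<mu>" .
  have "of_real ((vec_index a 0)\<^sup>2 + (vec_index a (N - 1))\<^sup>2) = ?a0\<^sup>2 * (1 + (amp ?\<mu> (N - 1))\<^sup>2)"
  proof -
    have e: "of_real (vec_index a (N - 1)) = ?a0 * amp ?\<mu> (N - 1)" using E(1)[of "N - 1"] N by simp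
    show ?thesis unfolding of_real_add of_real_power e by (simp add:
        power_mult_distrib algebra_simps)
  qed
  then have "of_real (damping_ratio N xm xp a) = ?a0\<^sup>2 * (1 + (amp ?\<mu> (N - 1))\<^sup>2) / (?a0\<^sup>2 * mass
      ?\<mu>)"
    unfolding damping_ratio_def of_real_divide den by simp
  also have "\<dots> = (1 + (amp ?\<mu> (N - 1))\<^sup>2) / mass ?\<mu>" using a0 by simp
  finally have D: "of_real (damping_ratio N xm xp a) = (1 + (amp ?\<mu> (N - 1))\<^sup>2) / mass ?\<mu>" .
  show ?thesis
    unfolding slope_def wronskian_mass[OF \<rho>(1)] scaled_wave_last of_real_mult D using \<rho>(2) by simp
qed

section \<open>Frequencies for small contrast\<close>

lemma norm_powr_three_halves: "cmod (\<delta> powr (3/2)) = cmod (usqrt \<delta> * (usqrt \<delta>)\<^sup>2)"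
proof (cases "\<delta> = 0")
  case False
  have "cmod (\<delta> powr (3/2)) = cmod \<delta> powr (3/2)"
    using norm_powr_real_powr'[of "3/2" \<delta>] by simp
  also have "\<dots> = cmod \<delta> powr (1/2 + 1)" by simp
  also have "\<dots> = sqrt (cmod \<delta>) * cmod \<delta>" unfolding powr_add using False by (simp add:
      powr_half_sqrt)
  finally show ?thesis by (simp add: norm_mult norm_usqrt)
qed simp

lemma branch_continuous_on_subset:
  assumes "branch_continuous_on V f" "U \<subseteq> V"
  shows "branch_continuous_on U f"
proof -
  note A = assms(1)[unfolded branch_continuous_on_def]
  show ?thesis
    unfolding branch_continuous_on_def
    by (intro conjI continuous_on_subset[OF conjunct1[OF A]] continuous_on_subset[OF conjunct2[OF
        A]])
       (use assms(2) in auto)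
qed

lemma holomorphic_ball_analytic:
  assumes "f holomorphic_on ball 0 \<epsilon>" "0 < \<epsilon>"
  shows "f analytic_on {0}"
  unfolding analytic_at using assms by (intro exI[of _ "ball 0 \<epsilon>"]) simp

text \<open>The frequencies are \<open>v z g z\<close> with \<open>z = usqrt \<delta>\<close>, where \<open>g\<close> runs through the branches. Any
  other subwavelength frequency takes its values among them and 0; as a function of \<open>z\<close> in a half
  disc, which is connected, it cannot change from one to another. For \<open>\<rho> = 0\<close> the branch is odd,
  so that \<open>z g z\<close> is even and hence an analytic function of \<open>z\<^sup>2 = \<delta>\<close>.\<close>

lemma frequencies_at_0:
  obtains \<Omega> :: "real \<Rightarrow> complex \<Rightarrow> complex" where
    "exactly_frequencies (at 0) (subwavelength_at_0 N xm xp v vb)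
       (insert (\<lambda>_. 0) (\<Omega> ` roots0 r piece last_brk)) (2 * N)"
    "analytic_function_of (at 0) (\<lambda>\<delta>. \<delta>) (\<Omega> 0)"
    "(\<lambda>\<delta>. \<Omega> 0 \<delta> - of_real v * slope 0 * \<delta>) \<in> O[at 0](\<lambda>\<delta>. \<delta>\<^sup>2)"
    "\<And>\<rho>. \<rho> \<in> roots0 r piece last_brk \<Longrightarrow> analytic_function_of (at 0) usqrt (\<Omega> \<rho>)"
    "\<And>\<rho>. \<rho> \<in> roots0 r piece last_brk \<Longrightarrow>
       (\<lambda>\<delta>. \<Omega> \<rho> \<delta> - (of_real v * of_real \<rho> * usqrt \<delta> + of_real v * slope \<rho> * \<delta>))
           \<in> O[at 0](\<lambda>\<delta>. \<delta> powr (3/2))"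
proof -
  let ?R = "roots0 r piece last_brk" and ?H = "dispersion r piece last_brk"
  note pp = last_brk(1) piece_pos r_pos
  obtain \<epsilon> g where \<epsilon>: "0 < \<epsilon>"
    and g_hol: "\<And>\<rho>. \<rho> \<in> ?R \<Longrightarrow> g \<rho> holomorphic_on ball 0 \<epsilon>"
    and g0: "\<And>\<rho>. \<rho> \<in> ?R \<Longrightarrow> g \<rho> 0 = of_real \<rho>"
    and dg: "\<And>\<rho>. \<rho> \<in> ?R \<Longrightarrow> deriv (g \<rho>) 0 = slope \<rho>"
    and gH: "\<And>\<rho> z. \<rho> \<in> ?R \<Longrightarrow> z \<in> ball 0 \<epsilon> \<Longrightarrow> ?H (g \<rho> z) z = 0"
    and compl: "\<And>\<mu> z. z \<in> ball 0 \<epsilon> \<Longrightarrow> cmod (z * \<mu>) < \<epsilon> \<Longrightarrow> ?H \<mu> z = 0 \<Longrightarrow> \<exists>\<rho>\<in>?R. \<mu> = g \<rho> z"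
    and inj: "\<And>\<rho> \<rho>' z. \<rho> \<in> ?R \<Longrightarrow> \<rho>' \<in> ?R \<Longrightarrow> \<rho> \<noteq> \<rho>' \<Longrightarrow> z \<in> ball 0 \<epsilon> \<Longrightarrow> g \<rho> z \<noteq> g \<rho>' z"
    and nz: "\<And>\<rho> z. \<rho> \<in> ?R \<Longrightarrow> z \<in> ball 0 \<epsilon> \<Longrightarrow> z \<noteq> 0 \<Longrightarrow> g \<rho> z \<noteq> 0"
    and odd: "\<And>z. z \<in> ball 0 \<epsilon> \<Longrightarrow> g 0 (- z) = - g 0 z"
    by (rule dispersion_branches[of last_brk piece r, OF last_brk(1) _ r_pos, folded slope_def],
        erule piece_pos, rule that)
  define G where "G \<rho> z = of_real v * z * g \<rho> z" for \<rho> z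
  define \<Omega> where "\<Omega> \<rho> \<delta> = G \<rho> (usqrt \<delta>)" for \<rho> \<delta>
  have G_hol: "G \<rho> holomorphic_on ball 0 \<epsilon>" if "\<rho> \<in> ?R" for \<rho>
    unfolding G_def[abs_def] by (intro holomorphic_intros g_hol that)
  have v0: "(of_real v :: complex) \<noteq> 0" using v by simp
  have res: "resonant_frequency N xm xp v vb \<delta> \<omega> \<longleftrightarrow>
      \<omega> = 0 \<or> ?H (\<omega> / (of_real v * usqrt \<delta>)) (usqrt \<delta>) = 0" if "\<delta> \<noteq> 0" for \<delta> \<omega>
  proof -
    have z: "usqrt \<delta> \<noteq> 0" using that by simp
    have "\<omega> / of_real v = usqrt \<delta> * (\<omega> / (of_real v * usqrt \<delta>))" using z v0 by simp
    then show ?thesis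
      using outgoing_dispersion[OF z, of r piece last_brk "\<omega> / (of_real v * usqrt \<delta>)"]
        resonant_iff_outgoing[OF that, of \<omega>] z v0 by simp
  qed
  have inball: "usqrt \<delta> \<in> ball 0 \<epsilon>" if "\<delta> \<in> ball 0 (\<epsilon>\<^sup>2)" for \<delta> using usqrt_ball[OF that \<epsilon>] .
  have \<epsilon>2: "0 < \<epsilon>\<^sup>2" using \<epsilon> by simp
  have G_quot: "G \<rho> z / (of_real v * z) = g \<rho> z" if "z \<noteq> 0" for \<rho> z
    using that v0 by (simp add: G_def)
  have \<Omega>_res: "resonant_frequency N xm xp v vb \<delta> (\<Omega> \<rho> \<delta>)" if "\<rho> \<in> ?R" "\<delta> \<in> ball 0 (\<epsilon>\<^sup>2) - {0}"
      for \<rho> \<delta>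
    using that inball[of \<delta>] gH[OF that(1), of "usqrt \<delta>"] by (simp add: res \<Omega>_def G_quot)
  have all_res: "\<exists>\<rho>\<in>?R. \<omega> = \<Omega> \<rho> \<delta>"
    if "resonant_frequency N xm xp v vb \<delta> \<omega>" "\<omega> \<noteq> 0" "cmod \<omega> < v * \<epsilon>" "\<delta> \<in> ball 0 (\<epsilon>\<^sup>2) - {0}"
        for \<omega> \<delta>
  proof -
    let ?z = "usqrt \<delta>" and ?\<mu> = "\<omega> / (of_real v * usqrt \<delta>)"
    have z: "?z \<in> ball 0 \<epsilon>" "?z \<noteq> 0" using that(4) inball by auto
    have H: "?H ?\<mu> ?z = 0" using that res[of \<delta> \<omega>] by auto
    have "?z * ?\<mu> = \<omega> / of_real v" using z by simp
    then have "cmod (?z * ?\<mu>) < \<epsilon>" using that(3) v \<epsilon> by (simp add: norm_divide field_simps)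
    then obtain \<rho> where "\<rho> \<in> ?R" "?\<mu> = g \<rho> ?z" using compl[OF z(1) _ H] by blast
    then show ?thesis using z(2) v0 by (intro bexI[of _ \<rho>]) (auto simp: \<Omega>_def G_def field_simps)
  qed
  have \<Omega>_nz: "\<Omega> \<rho> \<delta> \<noteq> 0" if "\<rho> \<in> ?R" "\<delta> \<in> ball 0 (\<epsilon>\<^sup>2) - {0}" for \<rho> \<delta>
    using that nz[OF that(1) inball[of \<delta>]] v0 by (simp add: \<Omega>_def G_def)
  have \<Omega>_inj: "\<Omega> \<rho> \<delta> \<noteq> \<Omega> \<rho>' \<delta>" if "\<rho> \<in> ?R" "\<rho>' \<in> ?R" "\<rho> \<noteq> \<rho>'" "\<delta> \<in> ball 0 (\<epsilon>\<^sup>2) - {0}" for \<rho> \<rho>' \<delta>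
    using that inj[OF that(1-3) inball[of \<delta>]] v0 by (simp add: \<Omega>_def G_def)
  have G_cont: "continuous_on (ball 0 \<epsilon>) (G \<rho>)" if "\<rho> \<in> ?R" for \<rho>
    using G_hol[OF that] by (rule holomorphic_on_imp_continuous_on)
  have \<Omega>_lim: "(\<Omega> \<rho> \<longlongrightarrow> 0) (at 0)" if "\<rho> \<in> ?R" for \<rho>
  proof -
    have "isCont (G \<rho>) 0" using G_cont[OF that] \<epsilon> by (simp add: continuous_on_eq_continuous_at)
    then have "(G \<rho> \<longlongrightarrow> 0) (at 0)" by (simp add: isCont_def G_def)
    then show ?thesis unfolding \<Omega>_def[abs_def] using filterlim_usqrt by (rule filterlim_compose)
  qed
  have sub: "subwavelength_at_0 N xm xp v vb (\<Omega> \<rho>)" if "\<rho> \<in> ?R" for \<rho>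
    unfolding subwavelength_at_0_def
  proof (intro conjI exI[of _ "\<epsilon>\<^sup>2"] \<epsilon>2 ballI \<Omega>_res[OF that] \<Omega>_lim[OF that])
    show "branch_continuous_on (ball 0 (\<epsilon>\<^sup>2) - {0}) (\<Omega> \<rho>)"
      using branch_continuous_usqrt[OF G_cont[OF that] \<epsilon>] by (simp add: \<Omega>_def[abs_def])
  qed
  have sub0: "subwavelength_at_0 N xm xp v vb (\<lambda>_. 0)"
    unfolding subwavelength_at_0_def branch_continuous_on_def
    by (auto simp: res intro!: exI[of _ 1])
  let ?S = "insert (\<lambda>_. 0) (\<Omega> ` ?R)"
  (* functions in ?S are told apart by their values at any one point of the punctured disc *)
  define \<delta>0 :: complex where "\<delta>0 = of_real (\<epsilon>\<^sup>2 / 2)"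
  have \<delta>0: "\<delta>0 \<in> ball 0 (\<epsilon>\<^sup>2) - {0}" using \<epsilon>2 by (simp add: \<delta>0_def norm_power norm_divide)
  have finR: "finite ?R" and cardR: "card ?R = last_brk"
    using card_roots0[of last_brk piece r] pp by blast+
  have "inj_on \<Omega> ?R" using \<Omega>_inj[OF _ _ _ \<delta>0] by (metis inj_onI)
  moreover have "(\<lambda>_. 0) \<notin> \<Omega> ` ?R" using \<Omega>_nz[OF _ \<delta>0] by (metis imageE)
  ultimately have card: "card ?S = 2 * N"
    using finR cardR last_brk(2) N by (simp add: card_image)
  have near0: "eventually P (at 0)" if "\<And>\<delta>. \<delta> \<in> ball 0 (\<epsilon>\<^sup>2) - {0} \<Longrightarrow> P \<delta>" for P :: "complex \<Rightarrow> bool"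
    unfolding eventually_at using \<epsilon>2 that by (intro exI[of _ "\<epsilon>\<^sup>2"]) (auto simp: dist_norm)
  have distinct: "\<omega> \<delta> \<noteq> \<omega>' \<delta>" if "\<omega> \<in> ?S" "\<omega>' \<in> ?S" "\<omega> \<noteq> \<omega>'" "\<delta> \<in> ball 0 (\<epsilon>\<^sup>2) - {0}" for \<omega> \<omega>' \<delta>
    using that(1-3) \<Omega>_nz[OF _ that(4)] \<Omega>_inj[OF _ _ _ that(4)] by (auto; metis)
  have complete: "\<exists>\<omega>'\<in>?S. \<forall>\<^sub>F \<delta> in at 0. \<omega> \<delta> = \<omega>' \<delta>" if "subwavelength_at_0 N xm xp v vb \<omega>" for \<omega>
  proof -
    note P = that[unfolded subwavelength_at_0_def]
    obtain e1 where "0 < e1 \<and> (\<forall>\<delta>\<in>ball 0 e1 - {0}. resonant_frequency N xm xp v vb \<delta> (\<omega> \<delta>)) \<and>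
      branch_continuous_on (ball 0 e1 - {0}) \<omega>"
      using conjunct1[OF P] by (rule exE)
    then have e1: "0 < e1" "\<And>\<delta>. \<delta> \<in> ball 0 e1 - {0} \<Longrightarrow> resonant_frequency N xm xp v vb \<delta> (\<omega> \<delta>)"
      "branch_continuous_on (ball 0 e1 - {0}) \<omega>" by auto
    note lim = conjunct2[OF P]
    have "\<forall>\<^sub>F \<delta> in at 0. cmod (\<omega> \<delta>) < v * \<epsilon>"
      using tendstoD[OF lim, of "v * \<epsilon>"] v \<epsilon> by (simp add: dist_norm)
    then obtain e2 where e2: "0 < e2" "\<And>\<delta>. \<delta> \<in> ball 0 e2 - {0} \<Longrightarrow> cmod (\<omega> \<delta>) < v * \<epsilon>"
      unfolding eventually_at by (auto simp: dist_norm)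
    (* e is a radius for z, so its square has to respect the radii e1 and e2 for \<delta> *)
    define e where "e = min \<epsilon> (sqrt (min e1 e2))"
    have e: "0 < e" "e \<le> \<epsilon>" using \<epsilon> e1 e2 by (auto simp: e_def)
    have "e \<le> sqrt (min e1 e2)" by (simp add: e_def)
    then have "e\<^sup>2 \<le> (sqrt (min e1 e2))\<^sup>2" using e(1) by (intro power_mono) auto
    then have e': "e\<^sup>2 \<le> e1" "e\<^sup>2 \<le> e2" using e1(1) e2(1) by (auto simp: real_sqrt_pow2)
    have e\<epsilon>: "e\<^sup>2 \<le> \<epsilon>\<^sup>2" using e by (intro power_mono) auto
    let ?T = "upper_half \<inter> ball 0 e"
    have sq: "z\<^sup>2 \<in> ball 0 (e\<^sup>2) - {0}" "usqrt (z\<^sup>2) = z" if "z \<in> ?T" for z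
    proof -
      show "usqrt (z\<^sup>2) = z" using that by (intro usqrt_unique) auto
      have "z \<noteq> 0" using that by (auto simp: upper_half_def)
      then show "z\<^sup>2 \<in> ball 0 (e\<^sup>2) - {0}" using that e(1) by (simp add:
          norm_power power_strict_mono)
    qed
    have bc: "branch_continuous_on (ball 0 (e\<^sup>2) - {0}) \<omega>"
      by (rule branch_continuous_on_subset[OF e1(3)]) (use e'(1) in auto)
    have "\<exists>h\<in>insert (\<lambda>_. 0) (G ` ?R). \<forall>z\<in>?T. \<omega> (z\<^sup>2) = h z"
    proof (rule connected_choice)
      show "connected ?T" by (intro convex_connected convex_Int convex_upper_half convex_ball)
      have "of_real (e / 2) \<in> ?T" using e by (auto simp: upper_half_def)
      then show "?T \<noteq> {}" by blast
      show "continuous_on ?T (\<lambda>z. \<omega> (z\<^sup>2))" by (rule branch_continuous_pullback[OF bc e(1)])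
      show "continuous_on ?T h" if "h \<in> insert (\<lambda>_. 0) (G ` ?R)" for h
        using that e(2) by (auto intro: continuous_on_subset[OF G_cont])
      fix z assume z: "z \<in> ?T"
      then have d: "z\<^sup>2 \<in> ball 0 (\<epsilon>\<^sup>2) - {0}" "z\<^sup>2 \<in> ball 0 e1 - {0}" "z\<^sup>2 \<in> ball 0 e2 - {0}"
        using sq(1)[OF z] e' e\<epsilon> by auto
      show "\<exists>h\<in>insert (\<lambda>_. 0) (G ` ?R). \<omega> (z\<^sup>2) = h z"
      proof (cases "\<omega> (z\<^sup>2) = 0")
        case False
        then obtain \<rho> where "\<rho> \<in> ?R" "\<omega> (z\<^sup>2) = \<Omega> \<rho> (z\<^sup>2)"
          using all_res[OF e1(2)[OF d(2)] _ e2(2)[OF d(3)] d(1)] by blast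
        then show ?thesis using sq(2)[OF z] by (auto simp: \<Omega>_def)
      qed auto
      fix h h' assume h: "h \<in> insert (\<lambda>_. 0) (G ` ?R)" "h' \<in> insert (\<lambda>_. 0) (G ` ?R)" "h \<noteq> h'"
      have "z \<noteq> 0" "z \<in> ball 0 \<epsilon>" using z e(2) by (auto simp: upper_half_def)
      then have "G \<rho> z \<noteq> 0" "\<rho> \<noteq> \<rho>' \<Longrightarrow> G \<rho> z \<noteq> G \<rho>' z" if "\<rho> \<in> ?R" "\<rho>' \<in> ?R" for \<rho> \<rho>'
        using nz[OF that(1)] inj[OF that] v0 by (auto simp: G_def)
      then show "h z \<noteq> h' z" using h by (auto; metis)
    qed (use finR in simp)
    then obtain h where h: "h \<in> insert (\<lambda>_. 0) (G ` ?R)" "\<And>z. z \<in> ?T \<Longrightarrow> \<omega> (z\<^sup>2) = h z" by blast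
    have "\<omega> \<delta> = h (usqrt \<delta>)" if "\<delta> \<in> ball 0 (e\<^sup>2) - {0}" for \<delta>
      using h(2)[of "usqrt \<delta>"] usqrt_upper[of \<delta>] usqrt_ball[of \<delta> e] that e(1) by simp
    then have "\<forall>\<^sub>F \<delta> in at 0. \<omega> \<delta> = h (usqrt \<delta>)"
      unfolding eventually_at using e(1) by (intro exI[of _ "e\<^sup>2"]) (auto simp: dist_norm)
    moreover have "(\<lambda>\<delta>. h (usqrt \<delta>)) \<in> ?S" using h(1) by (auto simp: \<Omega>_def[abs_def])
    ultimately show ?thesis by (rule bexI[where x = "\<lambda>\<delta>. h (usqrt \<delta>)"])
  qed
  have exact: "exactly_frequencies (at 0) (subwavelength_at_0 N xm xp v vb) ?S (2 * N)"
    unfolding exactly_frequencies_def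
  proof (intro conjI ballI impI allI)
    show "\<forall>\<^sub>F \<delta> in at 0. \<omega> \<delta> \<noteq> \<omega>' \<delta>" if "\<omega> \<in> ?S" "\<omega>' \<in> ?S" "\<omega> \<noteq> \<omega>'" for \<omega> \<omega>'
      by (rule near0) (rule distinct[OF that])
    show "subwavelength_at_0 N xm xp v vb \<omega>" if "\<omega> \<in> ?S" for \<omega> using that sub sub0 by blast
  qed (use finR card complete in auto)
  have "G 0 (- z) = G 0 z" if "z \<in> ball 0 \<epsilon>" for z using odd[OF that] by (simp add: G_def)
  from even_holomorphic[OF G_hol[OF roots0_0] this]
  obtain h where h: "h holomorphic_on ball 0 (\<epsilon>\<^sup>2)" "\<And>z. z \<in> ball 0 \<epsilon> \<Longrightarrow> G 0 z = h (z\<^sup>2)" by metis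
  have \<Omega>h: "\<Omega> 0 \<delta> = h \<delta>" if "\<delta> \<in> ball 0 (\<epsilon>\<^sup>2)" for \<delta>
    using h(2)[OF inball[OF that]] by (simp add: \<Omega>_def)
  have h0: "h 0 = 0" using \<Omega>h[of 0] \<epsilon> by (simp add: \<Omega>_def G_def)
  have an: "analytic_function_of (at 0) (\<lambda>\<delta>. \<delta>) (\<Omega> 0)"
    unfolding analytic_function_of_def
  proof (intro exI[of _ h] conjI)
    show "h analytic_on {0}" by (rule holomorphic_ball_analytic[OF h(1) \<epsilon>2])
    show "\<forall>\<^sub>F \<delta> in at 0. \<Omega> 0 \<delta> = h \<delta>" by (rule near0) (use \<Omega>h in auto)
  qed
  have dh: "deriv h 0 = of_real v * slope 0"
  proof -
    have "((\<lambda>w. (h (0 + w) - h 0) / w) \<longlongrightarrow> deriv h 0) (at 0)"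
      using holomorphic_derivI[OF h(1) open_ball, of 0 UNIV] \<epsilon> by (simp add: DERIV_def)
    moreover have "filterlim (\<lambda>z::complex. z\<^sup>2) (at 0) (at 0)"
      by (auto simp: filterlim_at eventually_at_filter intro!: tendsto_eq_intros)
    ultimately have "((\<lambda>z. (h (0 + z\<^sup>2) - h 0) / z\<^sup>2) \<longlongrightarrow> deriv h 0) (at 0)"
      by (rule filterlim_compose)
    moreover have "\<forall>\<^sub>F z in at 0. (h (0 + z\<^sup>2) - h 0) / z\<^sup>2 =
        of_real v * ((g 0 (0 + z) - g 0 0) / z)"
      unfolding eventually_at
    proof (intro exI[of _ \<epsilon>] conjI \<epsilon> ballI impI)
      fix z :: complex assume z: "z \<noteq> 0 \<and> dist z 0 < \<epsilon>"
      then have "h (z\<^sup>2) = of_real v * z * g 0 z" using h(2)[of z] by (simp add: G_def)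
      then show "(h (0 + z\<^sup>2) - h 0) / z\<^sup>2 = of_real v * ((g 0 (0 + z) - g 0 0) / z)"
        using z h0 g0[OF roots0_0] by (simp add: power2_eq_square)
    qed
    ultimately have 1: "((\<lambda>z. of_real v * ((g 0 (0 + z) - g 0 0) / z)) \<longlongrightarrow> deriv h 0) (at 0)"
      by (rule Lim_transform_eventually)
    have "((\<lambda>z. (g 0 (0 + z) - g 0 0) / z) \<longlongrightarrow> slope 0) (at 0)"
      using holomorphic_derivI[OF g_hol[OF roots0_0] open_ball, of 0 UNIV] \<epsilon> dg[OF roots0_0]
      by (simp add: DERIV_def)
    then have "((\<lambda>z. of_real v * ((g 0 (0 + z) - g 0 0) / z)) \<longlongrightarrow> of_real v * slope 0) (at 0)"
      by (rule tendsto_mult_left)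
    with 1 show ?thesis by (rule LIM_unique)
  qed
  have "(\<lambda>\<delta>. h \<delta> - h 0 - deriv h 0 * \<delta>) \<in> O[at 0](\<lambda>\<delta>. \<delta>\<^sup>2)" by (rule taylor2_bigo[OF h(1) \<epsilon>2])
  moreover have "\<forall>\<^sub>F \<delta> in at 0. \<Omega> 0 \<delta> - of_real v * slope 0 * \<delta> = h \<delta> - h 0 - deriv h 0 * \<delta>"
    by (rule near0) (use \<Omega>h h0 dh in auto)
  ultimately have big0: "(\<lambda>\<delta>. \<Omega> 0 \<delta> - of_real v * slope 0 * \<delta>) \<in> O[at 0](\<lambda>\<delta>. \<delta>\<^sup>2)"
    by (subst landau_o.big.in_cong) auto
  have anu: "analytic_function_of (at 0) usqrt (\<Omega> \<rho>)" if "\<rho> \<in> ?R" for \<rho>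
    unfolding analytic_function_of_def
    by (intro exI[of _ "G \<rho>"] conjI holomorphic_ball_analytic[OF G_hol[OF that] \<epsilon>])
       (simp add: \<Omega>_def)
  have bigu: "(\<lambda>\<delta>. \<Omega> \<rho> \<delta> - (of_real v * of_real \<rho> * usqrt \<delta> + of_real v * slope \<rho> * \<delta>))
      \<in> O[at 0](\<lambda>\<delta>. \<delta> powr (3/2))"
    if "\<rho> \<in> ?R" for \<rho>
  proof -
    have "(\<lambda>z. g \<rho> z - g \<rho> 0 - deriv (g \<rho>) 0 * z) \<in> O[at 0](\<lambda>z. z\<^sup>2)"
      by (rule taylor2_bigo[OF g_hol[OF that] \<epsilon>])
    moreover have "(\<lambda>z::complex. of_real v * z) \<in> O[at 0](\<lambda>z. z)"
      by (rule bigoI[of _ v]) (use v in \<open>simp add: norm_mult\<close>)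
    ultimately have "(\<lambda>z. of_real v * z * (g \<rho> z - g \<rho> 0 - deriv (g \<rho>) 0 * z))
        \<in> O[at 0](\<lambda>z. z * z\<^sup>2)"
      by (rule landau_o.big.mult[rotated])
    from landau_o.big.compose[OF this filterlim_usqrt]
    have L: "(\<lambda>\<delta>. of_real v * usqrt \<delta> * (g \<rho> (usqrt \<delta>) - g \<rho> 0 - deriv (g \<rho>) 0 * usqrt \<delta>))
         \<in> O[at 0](\<lambda>\<delta>. usqrt \<delta> * (usqrt \<delta>)\<^sup>2)" .
    have eq: "(\<lambda>\<delta>. of_real v * usqrt \<delta> * (g \<rho> (usqrt \<delta>) - g \<rho> 0 - deriv (g \<rho>) 0 * usqrt \<delta>))
        = (\<lambda>\<delta>. \<Omega> \<rho> \<delta> - (of_real v * of_real \<rho> * usqrt \<delta> + of_real v * slope \<rho> * \<delta>))"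
    proof
      fix \<delta> :: complex
      have "of_real v * usqrt \<delta> * (g \<rho> (usqrt \<delta>) - of_real \<rho> - slope \<rho> * usqrt \<delta>) =
        G \<rho> (usqrt \<delta>) - (of_real v * of_real \<rho> * usqrt \<delta> + of_real v * slope \<rho> * (usqrt \<delta>)\<^sup>2)"
        by (simp add: G_def algebra_simps power2_eq_square)
      then show "of_real v * usqrt \<delta> * (g \<rho> (usqrt \<delta>) - g \<rho> 0 - deriv (g \<rho>) 0 * usqrt \<delta>)
        = \<Omega> \<rho> \<delta> - (of_real v * of_real \<rho> * usqrt \<delta> + of_real v * slope \<rho> * \<delta>)"
        unfolding g0[OF that] dg[OF that] \<Omega>_def usqrt_sq .
    qed
    from iffD2[OF landau_o.big.norm_iff L[unfolded eq]] show ?thesis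
      unfolding norm_powr_three_halves[symmetric] by (rule iffD1[OF landau_o.big.norm_iff])
  qed
  show ?thesis by (rule that[OF exact an big0 anu bigu])
qed


section \<open>Frequencies for large contrast\<close>

text \<open>The substitution under which the resonances are invariant. It is an involution that
  exchanges 0 and infinity.\<close>

definition dual :: "complex \<Rightarrow> complex" where
  "dual \<delta> = of_real (r\<^sup>2) / \<delta>"

lemma dual_dual [simp]: "dual (dual \<delta>) = \<delta>"
  using r_pos by (cases "\<delta> = 0") (simp_all add: dual_def)

lemma dual_eq_0 [simp]: "dual \<delta> = 0 \<longleftrightarrow> \<delta> = 0"
  using r_pos by (auto simp: dual_def)

lemma filterlim_dual: "filterlim dual (at 0) at_infinity" "filterlim dual at_infinity (at 0)"
proof -
  have "((\<lambda>\<delta>. of_real (r\<^sup>2) * inverse \<delta>) \<longlongrightarrow> of_real (r\<^sup>2) * 0) (at_infinity :: complex filter)"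
    by (intro tendsto_intros tendsto_inverse_0)
  then have "(dual \<longlongrightarrow> 0) at_infinity" by (simp add: dual_def[abs_def] divide_inverse)
  moreover have "\<forall>\<^sub>F \<delta>::complex in at_infinity. \<delta> \<noteq> 0"
    unfolding eventually_at_infinity by (intro exI[of _ 1]) auto
  then have "\<forall>\<^sub>F \<delta> in at_infinity. dual \<delta> \<noteq> 0" by simp
  ultimately show "filterlim dual (at 0) at_infinity" by (simp add: filterlim_at)
  have "filterlim (\<lambda>\<delta>::complex. inverse \<delta>) at_infinity (at 0)"
      by (rule filterlim_inverse_at_infinity)
  then have "filterlim (\<lambda>\<delta>. of_real (r\<^sup>2) * inverse \<delta>) at_infinity (at (0::complex))"
    using r_pos by (intro tendsto_mult_filterlim_at_infinity[OF tendsto_const]) auto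
  then show "filterlim dual at_infinity (at 0)" by (simp add: dual_def[abs_def] divide_inverse)
qed

lemma eventually_dual: "(\<forall>\<^sub>F \<delta> in at_infinity. P (dual \<delta>)) \<longleftrightarrow> (\<forall>\<^sub>F \<delta> in at 0. P \<delta>)"
proof
  assume "\<forall>\<^sub>F \<delta> in at_infinity. P (dual \<delta>)"
  from eventually_compose_filterlim[OF this filterlim_dual(2)] show "\<forall>\<^sub>F \<delta> in at 0. P \<delta>" by simp
next
  assume "\<forall>\<^sub>F \<delta> in at 0. P \<delta>"
  from eventually_compose_filterlim[OF this filterlim_dual(1)]
  show "\<forall>\<^sub>F \<delta> in at_infinity. P (dual \<delta>)" .
qed

lemma branch_continuous_scale:
  assumes "branch_continuous_on (ball 0 (c * \<epsilon>) - {0}) f" "0 < c"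
  shows "branch_continuous_on (ball 0 \<epsilon> - {0}) (\<lambda>\<eta>. f (of_real c * \<eta>))"
proof -
  note A = assms(1)[unfolded branch_continuous_on_def]
  have c: "of_real c * \<eta> \<in> ball 0 (c * \<epsilon>) - {0}" if "\<eta> \<in> ball 0 \<epsilon> - {0}" for \<eta> :: complex
    using that assms(2) by (simp add: norm_mult)
  have "of_real c * \<eta> \<in> \<real>\<^sub>\<ge>\<^sub>0 \<longleftrightarrow> \<eta> \<in> \<real>\<^sub>\<ge>\<^sub>0" "0 \<le> Im (of_real c * \<eta>) \<longleftrightarrow> 0 \<le> Im \<eta>" for \<eta> :: complex
    using assms(2) by (simp_all add: complex_nonneg_Reals_iff zero_le_mult_iff)
  note c = c this
  show ?thesis
    unfolding branch_continuous_on_def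
  proof
    show "continuous_on (ball 0 \<epsilon> - {0} - \<real>\<^sub>\<ge>\<^sub>0) (\<lambda>\<eta>. f (of_real c * \<eta>))"
      by (rule continuous_on_compose2[OF conjunct1[OF A]], intro continuous_intros, rule
          image_subsetI)
         (use c in blast)
    show "continuous_on {z \<in> ball 0 \<epsilon> - {0}. 0 \<le> Im z} (\<lambda>\<eta>. f (of_real c * \<eta>))"
      by (rule continuous_on_compose2[OF conjunct2[OF A]], intro continuous_intros, rule
          image_subsetI)
         (use c in blast)
  qed
qed

text \<open>Branch continuity in \<open>1 / \<delta>\<close> is branch continuity in \<open>dual \<delta>\<close>, because the two differ by a
  positive factor, which maps the cut and the upper half plane to themselves.\<close>

lemma subwavelength_dual:
  "subwavelength_at_infinity N xm xp v vb \<omega> \<longleftrightarrow> subwavelength_at_0 N xm xp v vb (\<lambda>\<delta>. \<omega> (dual \<delta>))"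
proof -
  have r2: "0 < r\<^sup>2" using r_pos by simp
  have lim: "(\<omega> \<longlongrightarrow> 0) at_infinity \<longleftrightarrow> ((\<lambda>\<delta>. \<omega> (dual \<delta>)) \<longlongrightarrow> 0) (at 0)"
  proof
    assume "(\<omega> \<longlongrightarrow> 0) at_infinity"
    then show "((\<lambda>\<delta>. \<omega> (dual \<delta>)) \<longlongrightarrow> 0) (at 0)" using filterlim_dual(2) by (rule filterlim_compose)
  next
    assume "((\<lambda>\<delta>. \<omega> (dual \<delta>)) \<longlongrightarrow> 0) (at 0)"
    from filterlim_compose[OF this filterlim_dual(1)] show "(\<omega> \<longlongrightarrow> 0) at_infinity" by simp
  qed
  have scale: "(\<lambda>\<delta>. \<omega> (dual \<delta>)) = (\<lambda>\<delta>. \<omega> (1 / (of_real (1 / r\<^sup>2) * \<delta>)))"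
    "(\<lambda>\<eta>. \<omega> (1 / \<eta>)) = (\<lambda>\<eta>. \<omega> (dual (of_real (r\<^sup>2) * \<eta>)))"
    using r2 by (simp_all add: dual_def)
  have rd: "resonant_frequency N xm xp v vb (dual \<delta>) x \<longleftrightarrow> resonant_frequency N xm xp v vb \<delta> x"
    if "\<delta> \<noteq> 0" for \<delta> x
    unfolding dual_def by (rule resonant_duality[OF that, symmetric])
  have res: "(\<forall>\<delta>. 1 / \<epsilon> < norm \<delta> \<longrightarrow> resonant_frequency N xm xp v vb \<delta> (\<omega> \<delta>)) \<longleftrightarrow>
     (\<forall>\<delta>\<in>ball 0 (r\<^sup>2 * \<epsilon>) - {0}. resonant_frequency N xm xp v vb \<delta> (\<omega> (dual \<delta>)))" if "0 < \<epsilon>" for \<epsilon>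
  proof -
    have dom: "1 / \<epsilon> < norm (dual \<delta>) \<longleftrightarrow> \<delta> \<in> ball 0 (r\<^sup>2 * \<epsilon>) - {0}" for \<delta>
    proof (cases "\<delta> = 0")
      case True
      then show ?thesis using that by (simp add: dual_def)
    next
      case False
      then show ?thesis using that r2 by (simp add: dual_def norm_divide norm_power field_simps)
    qed
    have "(\<forall>\<delta>. 1 / \<epsilon> < norm \<delta> \<longrightarrow> resonant_frequency N xm xp v vb \<delta> (\<omega> \<delta>)) \<longleftrightarrow>
      (\<forall>\<delta>. 1 / \<epsilon> < norm (dual \<delta>) \<longrightarrow> resonant_frequency N xm xp v vb (dual \<delta>) (\<omega> (dual \<delta>)))"
      by (metis dual_dual)
    also have "\<dots> \<longleftrightarrow> (\<forall>\<delta>\<in>ball 0 (r\<^sup>2 * \<epsilon>) - {0}. resonant_frequency N xm xp v vb \<delta> (\<omega> (dual \<delta>)))"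
      unfolding dom by (simp add: Ball_def rd del: mem_ball)
    finally show ?thesis .
  qed
  show ?thesis
    unfolding subwavelength_at_infinity_def subwavelength_at_0_def lim
  proof (intro conj_cong refl iffI)
    assume "\<exists>\<epsilon>>0. (\<forall>\<delta>. 1 / \<epsilon> < norm \<delta> \<longrightarrow> resonant_frequency N xm xp v vb \<delta> (\<omega> \<delta>)) \<and>
            branch_continuous_on (ball 0 \<epsilon> - {0}) (\<lambda>\<eta>. \<omega> (1 / \<eta>))"
    then obtain \<epsilon> where e: "0 < \<epsilon>" "\<forall>\<delta>. 1 / \<epsilon> < norm \<delta> \<longrightarrow> resonant_frequency N xm xp v vb \<delta> (\<omega> \<delta>)"
       "branch_continuous_on (ball 0 \<epsilon> - {0}) (\<lambda>\<eta>. \<omega> (1 / \<eta>))" by blast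
    have "branch_continuous_on (ball 0 ((1 / r\<^sup>2) * (r\<^sup>2 * \<epsilon>)) - {0}) (\<lambda>\<eta>. \<omega> (1 / \<eta>))"
      using e(3) r2 by simp
    then have bc: "branch_continuous_on (ball 0 (r\<^sup>2 * \<epsilon>) - {0}) (\<lambda>\<delta>. \<omega> (dual \<delta>))"
      unfolding scale(1) by (rule branch_continuous_scale) (use r2 in simp)
    have "0 < r\<^sup>2 * \<epsilon>" using e(1) r2 by simp
    with bc e(2)[unfolded res[OF e(1)]]
    show "\<exists>\<epsilon>>0. (\<forall>\<delta>\<in>ball 0 \<epsilon> - {0}. resonant_frequency N xm xp v vb \<delta> (\<omega> (dual \<delta>))) \<and>
            branch_continuous_on (ball 0 \<epsilon> - {0}) (\<lambda>\<delta>. \<omega> (dual \<delta>))" by blast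
  next
    assume "\<exists>\<epsilon>>0. (\<forall>\<delta>\<in>ball 0 \<epsilon> - {0}. resonant_frequency N xm xp v vb \<delta> (\<omega> (dual \<delta>))) \<and>
            branch_continuous_on (ball 0 \<epsilon> - {0}) (\<lambda>\<delta>. \<omega> (dual \<delta>))"
    then obtain \<epsilon> where e: "0 < \<epsilon>" "\<forall>\<delta>\<in>ball 0 \<epsilon> - {0}. resonant_frequency N xm xp v vb \<delta> (\<omega> (dual
        \<delta>))"
       "branch_continuous_on (ball 0 \<epsilon> - {0}) (\<lambda>\<delta>. \<omega> (dual \<delta>))" by blast
    have e': "r\<^sup>2 * (\<epsilon> / r\<^sup>2) = \<epsilon>" "0 < \<epsilon> / r\<^sup>2" using e(1) r2 by simp_all
    have "branch_continuous_on (ball 0 (r\<^sup>2 * (\<epsilon> / r\<^sup>2)) - {0}) (\<lambda>\<delta>. \<omega> (dual \<delta>))"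
      unfolding e'(1) by (rule e(3))
    then have bc: "branch_continuous_on (ball 0 (\<epsilon> / r\<^sup>2) - {0}) (\<lambda>\<eta>. \<omega> (1 / \<eta>))"
      unfolding scale(2) by (rule branch_continuous_scale) (rule r2)
    have "\<forall>\<delta>. 1 / (\<epsilon> / r\<^sup>2) < norm \<delta> \<longrightarrow> resonant_frequency N xm xp v vb \<delta> (\<omega> \<delta>)"
      unfolding res[OF e'(2)] e'(1) by (rule e(2))
    with bc e'(2)
    show "\<exists>\<epsilon>>0. (\<forall>\<delta>. 1 / \<epsilon> < norm \<delta> \<longrightarrow> resonant_frequency N xm xp v vb \<delta> (\<omega> \<delta>)) \<and>
            branch_continuous_on (ball 0 \<epsilon> - {0}) (\<lambda>\<eta>. \<omega> (1 / \<eta>))" by blast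
  qed
qed

lemma exactly_frequencies_dual:
  assumes "exactly_frequencies (at 0) (subwavelength_at_0 N xm xp v vb) S n"
  shows "exactly_frequencies at_infinity (subwavelength_at_infinity N xm xp v vb) ((\<lambda>\<omega> \<delta>. \<omega> (dual
      \<delta>)) ` S) n"
proof -
  let ?D = "\<lambda>(\<omega> :: complex \<Rightarrow> complex) \<delta>. \<omega> (dual \<delta>)"
  have DD: "?D (?D \<omega>) = \<omega>" for \<omega> by simp
  have inj: "inj_on ?D S" by (rule inj_on_inverseI[of _ ?D]) simp
  note E = assms[unfolded exactly_frequencies_def]
  show ?thesis
    unfolding exactly_frequencies_def
  proof (intro conjI ballI impI allI)
    show "finite (?D ` S)" "card (?D ` S) = n" using E inj by (simp_all add: card_image)
    show "subwavelength_at_infinity N xm xp v vb \<omega>" if "\<omega> \<in> ?D ` S" for \<omega>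
      using that E unfolding subwavelength_dual by auto
    show "\<forall>\<^sub>F \<delta> in at_infinity. \<omega> \<delta> \<noteq> \<omega>' \<delta>" if "\<omega> \<in> ?D ` S" "\<omega>' \<in> ?D ` S" "\<omega> \<noteq> \<omega>'" for \<omega> \<omega>'
    proof -
      obtain f f' where f: "f \<in> S" "f' \<in> S" "\<omega> = ?D f" "\<omega>' = ?D f'" "f \<noteq> f'"
          using \<open>\<omega> \<in> _\<close> \<open>\<omega>' \<in> _\<close> \<open>\<omega> \<noteq> _\<close> by blast
      then have "\<forall>\<^sub>F \<delta> in at 0. f \<delta> \<noteq> f' \<delta>" using E by blast
      then show ?thesis unfolding f(3,4) by (subst eventually_dual)
    qed
    fix \<omega> assume "subwavelength_at_infinity N xm xp v vb \<omega>"
    then obtain f where f: "f \<in> S" "\<forall>\<^sub>F \<delta> in at 0. ?D \<omega> \<delta> = f \<delta>"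
      using E unfolding subwavelength_dual by blast
    then have "\<forall>\<^sub>F \<delta> in at_infinity. \<omega> \<delta> = ?D f \<delta>"
      using eventually_dual[of "\<lambda>\<delta>. ?D \<omega> \<delta> = f \<delta>"] by simp
    then show "\<exists>\<omega>'\<in>?D ` S. \<forall>\<^sub>F \<delta> in at_infinity. \<omega> \<delta> = \<omega>' \<delta>"
      by (rule bexI[where x = "?D f"]) (rule imageI[OF f(1)])
  qed
qed

lemma analytic_dual:
  assumes "analytic_function_of (at 0) \<phi> \<omega>" and \<phi>: "\<And>\<delta>. \<phi> (dual \<delta>) = c * \<psi> \<delta>"
  shows "analytic_function_of at_infinity \<psi> (\<lambda>\<delta>. \<omega> (dual \<delta>))"
proof -
  obtain g where g: "g analytic_on {0}" "\<forall>\<^sub>F \<delta> in at 0. \<omega> \<delta> = g (\<phi> \<delta>)"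
    using assms(1) by (auto simp: analytic_function_of_def)
  have "(\<lambda>z. c * z) analytic_on {0}" by (intro analytic_intros)
  then have "(\<lambda>z. g (c * z)) analytic_on {0}"
    by (rule analytic_on_compose_gen[of _ "{0}" g "{0}", unfolded o_def]) (use g(1) in auto)
  moreover have "\<forall>\<^sub>F \<delta> in at_infinity. \<omega> (dual \<delta>) = g (c * \<psi> \<delta>)"
    using g(2) unfolding eventually_dual[symmetric] \<phi> .
  ultimately show ?thesis unfolding analytic_function_of_def by blast
qed

lemma usqrt_dual: "usqrt (dual \<delta>) = of_real r * usqrt (1 / \<delta>)"
  using usqrt_scale[of r "1 / \<delta>"] r_pos by (simp add: dual_def)

section \<open>The spectrum\<close>

text \<open>The zeros are symmetric about 0 and there are \<open>2 N - 1\<close> of them, so exactly \<open>N\<close> are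
  nonnegative.\<close>

lemma enumerate_roots:
  obtains \<rho> :: "nat \<Rightarrow> real" where "\<rho> 1 = 0" "strict_mono_on {1..N} \<rho>"
    "roots0 r piece last_brk = {0} \<union> \<rho> ` {2..N} \<union> (\<lambda>i. - \<rho> i) ` {2..N}"
    "\<And>i. i \<in> {1..N} \<Longrightarrow> \<rho> i \<in> roots0 r piece last_brk"
proof -
  let ?R = "roots0 r piece last_brk"
  define P where "P = {x \<in> ?R. 0 \<le> x}"
  have fin: "finite ?R" and card: "card ?R = last_brk"
    using card_roots0[of last_brk piece r] last_brk(1) piece_pos r_pos by blast+
  have finP: "finite P" using fin by (simp add: P_def)
  have P0: "0 \<in> P" by (simp add: P_def roots0_0)
  let ?Q = "P - {0}"
  have R: "?R = {0} \<union> ?Q \<union> uminus ` ?Q"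
  proof (intro equalityI subsetI)
    fix x assume x: "x \<in> ?R"
    show "x \<in> {0} \<union> ?Q \<union> uminus ` ?Q"
    proof (cases "0 \<le> x")
      case False
      then have "- x \<in> ?Q" using roots0_minus[OF x] by (simp add: P_def)
      then have "- (- x) \<in> uminus ` ?Q" by (rule imageI)
      then show ?thesis by simp
    qed (use x in \<open>auto simp: P_def\<close>)
  next
    fix x assume "x \<in> {0} \<union> ?Q \<union> uminus ` ?Q"
    then show "x \<in> ?R" using roots0_0 roots0_minus by (auto simp: P_def)
  qed
  have "card ?R = card ({0} \<union> ?Q) + card (uminus ` ?Q)"
    by (subst R, rule card_Un_disjoint) (use finP in \<open>auto simp: P_def\<close>)
  also have "{0} \<union> ?Q = P" using P0 by auto
  also have "card (uminus ` ?Q) = card P - 1" using finP P0 by (subst card_image) (auto intro: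
      inj_onI)
  finally have "last_brk = card P + (card P - 1)" using card by simp
  then have cP: "card P = N" using last_brk(2) N by linarith
  define xs where "xs = sorted_list_of_set P"
  have xs: "set xs = P" "length xs = N" "sorted_wrt (<) xs"
    using finP cP by (simp_all add: xs_def)
  define \<rho> where "\<rho> i = xs ! (i - 1)" for i
  have mono: "strict_mono_on {1..N} \<rho>"
    using xs(2,3) by (auto simp: strict_mono_on_def \<rho>_def sorted_wrt_iff_nth_less)
  have im: "\<rho> ` {1..N} = P"
  proof -
    have "j \<in> (\<lambda>i. i - 1) ` {1..N}" if "j < N" for j
      using that by (intro image_eqI[of _ _ "Suc j"]) auto
    then have "{..<N} = (\<lambda>i. i - 1) ` {1..N}" by auto
    moreover have "P = (\<lambda>i. xs ! i) ` {..<N}" using xs(1,2) by (auto simp: set_conv_nth)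
    ultimately show ?thesis by (simp only: image_image \<rho>_def[abs_def])
  qed
  have \<rho>1: "\<rho> 1 = 0"
  proof -
    obtain i where i: "i \<in> {1..N}" "\<rho> i = 0" using P0 im by (metis imageE)
    have "0 \<le> \<rho> 1" using im N by (auto simp: P_def)
    show ?thesis
    proof (cases "i = 1")
      case False
      then have "\<rho> 1 < \<rho> i" using i strict_mono_onD[OF mono, of 1 i] N by auto
      then show ?thesis using i \<open>0 \<le> \<rho> 1\<close> by simp
    qed (use i in simp)
  qed
  have "\<rho> ` {2..N} = ?Q"
  proof -
    have "{1..N} = insert 1 {2..N}" using N by auto
    then have "P = insert 0 (\<rho> ` {2..N})" using im \<rho>1 by (metis image_insert)
    moreover have "0 < \<rho> i" if "i \<in> {2..N}" for i
      using strict_mono_onD[OF mono, of 1 i] \<rho>1 that by auto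
    then have "0 \<notin> \<rho> ` {2..N}" by force
    ultimately show ?thesis by auto
  qed
  then have "?R = {0} \<union> \<rho> ` {2..N} \<union> (\<lambda>i. - \<rho> i) ` {2..N}" using R by (simp add:
      image_image[symmetric])
  moreover have "\<rho> i \<in> ?R" if "i \<in> {1..N}" for i using im that by (auto simp: P_def)
  ultimately show ?thesis using that \<rho>1 mono by blast
qed

end

theorem theorem4p5:
  fixes N :: nat and xm xp :: "nat \<Rightarrow> real" and v vb r :: real
  assumes "1 \<le> N" and "resonator_chain N xm xp"
    and "0 < v" and "0 < vb" and "r = v / vb"
  shows "\<exists>lam :: nat \<Rightarrow> real.
    lam 1 = 0 \<and> strict_mono_on {1..N} lam \<and>
    {x. eigenvalue (capacitance_matrix N xm xp r) x} = lam ` {1..N} \<and>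
    (\<forall>a :: nat \<Rightarrow> real vec.
      (\<forall>i\<in>{1..N}. eigenvector (capacitance_matrix N xm xp r) (a i) (lam i)) \<longrightarrow>
      (\<exists>(\<omega>1 :: complex \<Rightarrow> complex) (\<omega>p :: nat \<Rightarrow> complex \<Rightarrow> complex) (\<omega>m :: nat \<Rightarrow> complex \<Rightarrow> complex).
        exactly_frequencies (at 0) (subwavelength_at_0 N xm xp v vb)
          ({(\<lambda>_. 0), \<omega>1} \<union> \<omega>p ` {2..N} \<union> \<omega>m ` {2..N}) (2 * N) \<and>
        analytic_function_of (at 0) (\<lambda>\<delta>. \<delta>) \<omega>1 \<and>
        (\<lambda>\<delta>. \<omega>1 \<delta> -
             (- 2 * \<i> * \<delta> * of_real (v / (r\<^sup>2 * (\<Sum>j=1..N. res_length xm xp j)))))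
          \<in> O[at 0](\<lambda>\<delta>. \<delta>\<^sup>2) \<and>
        (\<forall>i\<in>{2..N}.
          analytic_function_of (at 0) usqrt (\<omega>p i) \<and>
          analytic_function_of (at 0) usqrt (\<omega>m i) \<and>
          (\<lambda>\<delta>. \<omega>p i \<delta> -
               (of_real v * usqrt (of_real (lam i) * \<delta> / of_real r)
                - \<i> * \<delta> * of_real (v / (2 * r\<^sup>2) * damping_ratio N xm xp (a i))))
            \<in> O[at 0](\<lambda>\<delta>. \<delta> powr (3 / 2)) \<and>
          (\<lambda>\<delta>. \<omega>m i \<delta> -
               (- of_real v * usqrt (of_real (lam i) * \<delta> / of_real r)
                - \<i> * \<delta> * of_real (v / (2 * r\<^sup>2) * damping_ratio N xm xp (a i))))
            \<in> O[at 0](\<lambda>\<delta>. \<delta> powr (3 / 2)))) \<and>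
      (\<exists>(\<omega>1 :: complex \<Rightarrow> complex) (\<omega>p :: nat \<Rightarrow> complex \<Rightarrow> complex) (\<omega>m :: nat \<Rightarrow> complex \<Rightarrow> complex).
        exactly_frequencies at_infinity (subwavelength_at_infinity N xm xp v vb)
          ({(\<lambda>_. 0), \<omega>1} \<union> \<omega>p ` {2..N} \<union> \<omega>m ` {2..N}) (2 * N) \<and>
        analytic_function_of at_infinity (\<lambda>\<delta>. 1 / \<delta>) \<omega>1 \<and>
        (\<lambda>\<delta>. \<omega>1 \<delta> -
             (- 2 * \<i> * (1 / \<delta>) * of_real (v / (\<Sum>j=1..N. res_length xm xp j))))
          \<in> O[at_infinity](\<lambda>\<delta>. 1 / \<delta>\<^sup>2) \<and>
        (\<forall>i\<in>{2..N}.
          analytic_function_of at_infinity (\<lambda>\<delta>. usqrt (1 / \<delta>)) (\<omega>p i) \<and>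
          analytic_function_of at_infinity (\<lambda>\<delta>. usqrt (1 / \<delta>)) (\<omega>m i) \<and>
          (\<lambda>\<delta>. \<omega>p i \<delta> -
               (of_real v * usqrt (of_real (lam i) * of_real r / \<delta>)
                - \<i> * (1 / \<delta>) * of_real (v / 2 * damping_ratio N xm xp (a i))))
            \<in> O[at_infinity](\<lambda>\<delta>. \<delta> powr (- 3 / 2)) \<and>
          (\<lambda>\<delta>. \<omega>m i \<delta> -
               (- of_real v * usqrt (of_real (lam i) * of_real r / \<delta>)
                - \<i> * (1 / \<delta>) * of_real (v / 2 * damping_ratio N xm xp (a i))))
            \<in> O[at_infinity](\<lambda>\<delta>. \<delta> powr (- 3 / 2)))))"
proof -
  interpret scattering_chain N xm xp v vb r
    using assms by unfold_locales
  let ?R = "roots0 r piece last_brk"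
  obtain \<rho> where \<rho>: "\<rho> 1 = 0" "strict_mono_on {1..N} \<rho>"
    "?R = {0} \<union> \<rho> ` {2..N} \<union> (\<lambda>i. - \<rho> i) ` {2..N}" "\<And>i. i \<in> {1..N} \<Longrightarrow> \<rho> i \<in> ?R"
    by (rule enumerate_roots) (rule that)
  obtain \<Omega> where exact: "exactly_frequencies (at 0) (subwavelength_at_0 N xm xp v vb)
       (insert (\<lambda>_. 0) (\<Omega> ` ?R)) (2 * N)"
    and an0: "analytic_function_of (at 0) (\<lambda>\<delta>. \<delta>) (\<Omega> 0)"
    and big0: "(\<lambda>\<delta>. \<Omega> 0 \<delta> - of_real v * slope 0 * \<delta>) \<in> O[at 0](\<lambda>\<delta>. \<delta>\<^sup>2)"
    and an: "\<And>\<rho>. \<rho> \<in> ?R \<Longrightarrow> analytic_function_of (at 0) usqrt (\<Omega> \<rho>)"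
    and big: "\<And>\<rho>. \<rho> \<in> ?R \<Longrightarrow>
       (\<lambda>\<delta>. \<Omega> \<rho> \<delta> - (of_real v * of_real \<rho> * usqrt \<delta> + of_real v * slope \<rho> * \<delta>))
           \<in> O[at 0](\<lambda>\<delta>. \<delta> powr (3/2))"
    by (rule frequencies_at_0) (rule that)
  define lam where "lam i = r * (\<rho> i)\<^sup>2" for i
  have pos: "0 < \<rho> i" if "i \<in> {2..N}" for i
    using \<rho>(1) strict_mono_onD[OF \<rho>(2), of 1 i] that by auto
  have nonneg: "0 \<le> \<rho> i" if "i \<in> {1..N}" for i
    using \<rho>(1) pos[of i] that by (cases "i = 1") auto
  have "lam i < lam j" if "i \<in> {1..N}" "j \<in> {1..N}" "i < j" for i j
    using strict_mono_onD[OF \<rho>(2) that] nonneg[OF that(1)] r_pos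
    by (simp add: lam_def power_strict_mono)
  then have lam_mono: "strict_mono_on {1..N} lam" by (auto intro: strict_mono_onI)
  have lam1: "lam 1 = 0" using \<rho>(1) by (simp add: lam_def)
  have idx: "{1..N} = insert 1 {2..N}" using N by auto
  have "(\<lambda>x. r * x\<^sup>2) ` ?R = lam ` {1..N}"
    unfolding \<rho>(3) idx image_Un image_insert image_image lam_def using \<rho>(1) by auto
  then have spec: "{x. eigenvalue (capacitance_matrix N xm xp r) x} = lam ` {1..N}"
    unfolding eigenvalues_roots .
  have set: "insert (\<lambda>_. 0) (\<Omega> ` ?R) =
      {(\<lambda>_. 0), \<Omega> 0} \<union> (\<lambda>i. \<Omega> (\<rho> i)) ` {2..N} \<union> (\<lambda>i. \<Omega> (- \<rho> i)) ` {2..N}"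
    unfolding \<rho>(3) by (auto simp: image_Un image_image)
  let ?D = "\<lambda>(\<omega> :: complex \<Rightarrow> complex) \<delta>. \<omega> (dual \<delta>)"
  have an0D: "analytic_function_of at_infinity (\<lambda>\<delta>. 1 / \<delta>) (?D (\<Omega> 0))"
    by (rule analytic_dual[OF an0, of "of_real (r\<^sup>2)"]) (simp add: dual_def)
  have setD: "?D ` (insert (\<lambda>_. 0) (\<Omega> ` ?R)) =
      {(\<lambda>_. 0), ?D (\<Omega> 0)} \<union> (\<lambda>i. ?D (\<Omega> (\<rho> i))) ` {2..N} \<union> (\<lambda>i. ?D (\<Omega> (- \<rho> i))) ` {2..N}"
    unfolding set by (simp add: image_Un image_image)
  have slope0: "of_real v * slope 0 * \<delta> = - 2 * \<i> * \<delta> * of_real (v / (r\<^sup>2 * (\<Sum>j=1..N. res_length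
      xm xp j)))" for \<delta>
    unfolding slope_0 by (simp only: mult_ac)
  have slope0D: "of_real v * slope 0 * dual \<delta> = - 2 * \<i> * (1 / \<delta>) * of_real (v / (\<Sum>j=1..N.
      res_length xm xp j))" for \<delta>
    unfolding slope0 dual_def using r_pos by simp
  have big0D: "(\<lambda>\<delta>. \<Omega> 0 (dual \<delta>) - of_real v * slope 0 * dual \<delta>) \<in> O[at_infinity](\<lambda>\<delta>. 1 / \<delta>\<^sup>2)"
  proof -
    have L: "(\<lambda>\<delta>. \<Omega> 0 (dual \<delta>) - of_real v * slope 0 * dual \<delta>) \<in> O[at_infinity](\<lambda>\<delta>. (dual \<delta>)\<^sup>2)"
      by (rule landau_o.big.compose[OF big0 filterlim_dual(1)])
    have "(\<lambda>\<delta>. (dual \<delta>)\<^sup>2) \<in> O[at_infinity](\<lambda>\<delta>. 1 / \<delta>\<^sup>2)"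
      by (rule bigoI[of _ "(r\<^sup>2)\<^sup>2"]) (simp add: dual_def norm_divide norm_power power_divide)
    with L show ?thesis by (rule landau_o.big_trans)
  qed
  have bigD: "(\<lambda>\<delta>. \<Omega> x (dual \<delta>) - (of_real v * of_real x * usqrt (dual \<delta>) + of_real v * slope x *
      dual \<delta>))
       \<in> O[at_infinity](\<lambda>\<delta>. \<delta> powr (- 3 / 2))" if "x \<in> ?R" for x
  proof -
    have L: "(\<lambda>\<delta>. \<Omega> x (dual \<delta>) - (of_real v * of_real x * usqrt (dual \<delta>) + of_real v * slope x *
        dual \<delta>))
       \<in> O[at_infinity](\<lambda>\<delta>. dual \<delta> powr (3 / 2))"
      by (rule landau_o.big.compose[OF big[OF that] filterlim_dual(1)])
    have "cmod (dual \<delta> powr (3 / 2)) = r ^ 3 * cmod (\<delta> powr (- 3 / 2))" for \<delta>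
    proof (cases "\<delta> = 0")
      case False
      have "cmod (dual \<delta> powr (3 / 2)) = (r\<^sup>2 / cmod \<delta>) powr (3 / 2)"
        using norm_powr_real_powr'[of "3/2" "dual \<delta>"] r_pos by (simp add:
            dual_def norm_divide norm_power)
      also have "\<dots> = (r\<^sup>2) powr (3/2) * cmod \<delta> powr (- 3 / 2)"
      proof -
        have e: "(- 3 / 2 :: real) = - (3 / 2)" by simp
        show ?thesis unfolding e powr_minus_divide powr_divide by simp
      qed
      also have "(r\<^sup>2) powr (3/2) = r ^ 3"
      proof -
        have "r\<^sup>2 = r powr 2" using r_pos by simp
        then have "(r\<^sup>2) powr (3/2) = r powr 3" by (simp only: powr_powr) simp
        also have "\<dots> = r ^ 3" using r_pos by simp
        finally show ?thesis .
      qed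
      finally show ?thesis using norm_powr_real_powr'[of "-3/2" \<delta>] by simp
    qed (simp add: dual_def)
    then have "(\<lambda>\<delta>. dual \<delta> powr (3 / 2)) \<in> O[at_infinity](\<lambda>\<delta>. \<delta> powr (- 3 / 2))"
      by (intro bigoI[of _ "r ^ 3"]) simp
    with L show ?thesis by (rule landau_o.big_trans)
  qed
  show ?thesis
  proof (intro exI[of _ lam] conjI lam1 lam_mono spec, intro allI impI, goal_cases)
    case (1 a)
    note ev = 1
    have damp: "of_real v * slope x = - \<i> * of_real (v / (2 * r\<^sup>2) * damping_ratio N xm xp (a i))"
      if "i \<in> {2..N}" "x = \<rho> i \<or> x = - \<rho> i" for i x
    proof (rule slope_damping)
      have "r * x\<^sup>2 = lam i" using that(2) by (auto simp: lam_def)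
      then show "eigenvector (capacitance_matrix N xm xp r) (a i) (r * x\<^sup>2)" using ev that(1)
          by auto
      show "x \<in> ?R" "x \<noteq> 0" using that \<rho>(4)[of i] roots0_minus pos[OF that(1)] by auto
    qed
    have sq: "usqrt (of_real (lam i) * \<delta> / of_real r) = of_real (\<rho> i) * usqrt \<delta>" if "i \<in> {2..N}"
        for i \<delta>
    proof -
      have "of_real (lam i) * \<delta> / of_real r = of_real ((\<rho> i)\<^sup>2) * \<delta>" using r_pos by (simp add:
          lam_def)
      then show ?thesis using usqrt_scale[of "\<rho> i" \<delta>] pos[OF that] by simp
    qed
    have lead: "of_real v * of_real (\<rho> i) * usqrt \<delta> + of_real v * slope (\<rho> i) * \<delta> =
        of_real v * usqrt (of_real (lam i) * \<delta> / of_real r)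
                - \<i> * \<delta> * of_real (v / (2 * r\<^sup>2) * damping_ratio N xm xp (a i))"
      "of_real v * of_real (- \<rho> i) * usqrt \<delta> + of_real v * slope (- \<rho> i) * \<delta> =
        - of_real v * usqrt (of_real (lam i) * \<delta> / of_real r)
                - \<i> * \<delta> * of_real (v / (2 * r\<^sup>2) * damping_ratio N xm xp (a i))"
      if "i \<in> {2..N}" for i \<delta>
      unfolding sq[OF that] damp[OF that, of "\<rho> i", simplified] damp[OF that, of "- \<rho> i",
          simplified]
      by (simp_all add: mult_ac)
    have leadD: "of_real v * of_real (\<rho> i) * usqrt (dual \<delta>) + of_real v * slope (\<rho> i) * dual \<delta> =
        of_real v * usqrt (of_real (lam i) * of_real r / \<delta>)
                - \<i> * (1 / \<delta>) * of_real (v / 2 * damping_ratio N xm xp (a i))"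
      "of_real v * of_real (- \<rho> i) * usqrt (dual \<delta>) + of_real v * slope (- \<rho> i) * dual \<delta> =
        - of_real v * usqrt (of_real (lam i) * of_real r / \<delta>)
                - \<i> * (1 / \<delta>) * of_real (v / 2 * damping_ratio N xm xp (a i))"
      if "i \<in> {2..N}" for i \<delta>
    proof -
      have 1: "of_real (lam i) * dual \<delta> / of_real r = of_real (lam i) * of_real r / \<delta>"
        using r_pos by (simp add: dual_def power2_eq_square)
      have 2: "dual \<delta> * of_real (v / (2 * r\<^sup>2) * d) = (1 / \<delta>) * of_real (v / 2 * d)" for d
        using r_pos by (simp add: dual_def)
      show "of_real v * of_real (\<rho> i) * usqrt (dual \<delta>) + of_real v * slope (\<rho> i) * dual \<delta> =
        of_real v * usqrt (of_real (lam i) * of_real r / \<delta>)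
                - \<i> * (1 / \<delta>) * of_real (v / 2 * damping_ratio N xm xp (a i))"
       "of_real v * of_real (- \<rho> i) * usqrt (dual \<delta>) + of_real v * slope (- \<rho> i) * dual \<delta> =
        - of_real v * usqrt (of_real (lam i) * of_real r / \<delta>)
                - \<i> * (1 / \<delta>) * of_real (v / 2 * damping_ratio N xm xp (a i))"
        unfolding lead[OF that] 1 mult.assoc[of \<i>] 2 by simp_all
    qed
    have mem: "\<rho> i \<in> ?R" "- \<rho> i \<in> ?R" if "i \<in> {2..N}" for i
      using that \<rho>(4)[of i] roots0_minus by auto
    have F0: "analytic_function_of (at 0) usqrt (\<Omega> (\<rho> i)) \<and>
          analytic_function_of (at 0) usqrt (\<Omega> (- \<rho> i)) \<and>
          (\<lambda>\<delta>. \<Omega> (\<rho> i) \<delta> -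
               (of_real v * usqrt (of_real (lam i) * \<delta> / of_real r)
                - \<i> * \<delta> * of_real (v / (2 * r\<^sup>2) * damping_ratio N xm xp (a i))))
            \<in> O[at 0](\<lambda>\<delta>. \<delta> powr (3 / 2)) \<and>
          (\<lambda>\<delta>. \<Omega> (- \<rho> i) \<delta> -
               (- of_real v * usqrt (of_real (lam i) * \<delta> / of_real r)
                - \<i> * \<delta> * of_real (v / (2 * r\<^sup>2) * damping_ratio N xm xp (a i))))
            \<in> O[at 0](\<lambda>\<delta>. \<delta> powr (3 / 2))" if "i \<in> {2..N}" for i
      by (intro conjI an[OF mem(1)[OF that]] an[OF mem(2)[OF that]]
          big[OF mem(1)[OF that], unfolded lead(1)[OF that]] big[OF mem(2)[OF that], unfolded
              lead(2)[OF that]])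
    have FD: "analytic_function_of at_infinity (\<lambda>\<delta>. usqrt (1 / \<delta>)) (?D (\<Omega> (\<rho> i))) \<and>
          analytic_function_of at_infinity (\<lambda>\<delta>. usqrt (1 / \<delta>)) (?D (\<Omega> (- \<rho> i))) \<and>
          (\<lambda>\<delta>. ?D (\<Omega> (\<rho> i)) \<delta> -
               (of_real v * usqrt (of_real (lam i) * of_real r / \<delta>)
                - \<i> * (1 / \<delta>) * of_real (v / 2 * damping_ratio N xm xp (a i))))
            \<in> O[at_infinity](\<lambda>\<delta>. \<delta> powr (- 3 / 2)) \<and>
          (\<lambda>\<delta>. ?D (\<Omega> (- \<rho> i)) \<delta> -
               (- of_real v * usqrt (of_real (lam i) * of_real r / \<delta>)
                - \<i> * (1 / \<delta>) * of_real (v / 2 * damping_ratio N xm xp (a i))))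
            \<in> O[at_infinity](\<lambda>\<delta>. \<delta> powr (- 3 / 2))" if "i \<in> {2..N}" for i
      by (intro conjI analytic_dual[OF an usqrt_dual] mem that
          bigD[OF mem(1)[OF that], unfolded leadD(1)[OF that]] bigD[OF mem(2)[OF that], unfolded
              leadD(2)[OF that]])
    show ?case
    proof (rule conjI, goal_cases)
      case 1
      show ?case
        by (rule exI[of _ "\<Omega> 0"], rule exI[of _ "\<lambda>i. \<Omega> (\<rho> i)"], rule exI[of _ "\<lambda>i. \<Omega> (- \<rho> i)"])
           (use exact[unfolded set] an0 big0[unfolded slope0] F0 in blast)
    next
      case 2
      show ?case
        by (rule exI[of _ "?D (\<Omega> 0)"], rule exI[of _ "\<lambda>i. ?D (\<Omega> (\<rho> i))"],
            rule exI[of _ "\<lambda>i. ?D (\<Omega> (- \<rho> i))"])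
           (use exactly_frequencies_dual[OF exact, unfolded setD] an0D big0D[unfolded slope0D] FD
               in blast)
    qed
  qed
qed

end
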